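(* Let $\Phi_{\mathrm{DGZ}}=(a,\mu_L^{<n},\mu_R^{<n})$ be the double Gelfand--Zeitlin moment map on the strongly regular locus of $T^*U(n)$, where $a=(a_1>\dots>a_n)$ is the top row of the right moment map, and put $a^*:=-w_0a=(-a_n,\dots,-a_1)$. Let $p_M$ be the projection retaining only the common top row $a$. Then $$(p_M\circ\Phi_{\mathrm{DGZ}})_*\left(\frac{\omega^{n^2}}{n^2!}\right)=C_n^{\mathrm{DGZ}}\,\Delta(a)^2\,da,$$ where $C_n^{\mathrm{DGZ}}$ is independent of $a$.
   Context: $T^*U(n)\cong U(n)\times\mathfrak u(n)^*$ (left trivialization) with canonical symplectic form $\omega$; $\mathfrak u(n)^*$ is identified with Hermitian matrices. The right and left moment maps of $(h_L,h_R)\cdot(g,\xi)=(h_Lgh_R^{-1},\mathrm{Ad}^*_{h_R}\xi)$ are $-\xi$ and $\mathrm{Ad}_g^*\xi=g\xi g^{-1}$. For a Hermitian matrix the Gelfand--Zeitlin map lists, for $k=n,\dots,1$, the eigenvalues of the upper-left $k\times k$ block in decreasing order; row $k=n$ is the top row. $a$ is the decreasingly ordered spectrum of $-\xi$; the top row of the left moment map is then $a^*$. $\mu_R^{<n}$ and $\mu_L^{<n}$ denote the rows $k<n$ for $-\xi$ and $g\xi g^{-1}$. The strongly regular locus is the open set where all interlacing inequalities between consecutive rows, on both sides, are strict. $w_0$ is the longest element of the symmetric group $S_n$, $\Delta(a)=\prod_{i<j}(a_i-a_j)$, and $da$ is Lebesgue measure on $\{a_1>\dots>a_n\}\subset\mathbb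 R^n$. *)

theory Defs
  imports
    "HOL-Analysis.Analysis"
    "HOL-Computational_Algebra.Fundamental_Theorem_Algebra"
    "Jordan_Normal_Form.Char_Poly"
begin

hide_const (open) Matrix.mat
no_notation Matrix.vec_index (infixl "$" 100)

section \<open>Measures defined by top-degree forms on embedded submanifolds\<close>

text \<open>
  A regular \<open>C\<^sup>1\<close> parametrization of a relatively open piece of a subset \<open>M\<close> of a
  Euclidean space.
\<close>

definition local_parametrization ::
    "'e::euclidean_space set \<Rightarrow> (real^'d) set \<Rightarrow> (real^'d \<Rightarrow> 'e) \<Rightarrow> bool" where
  "local_parametrization M V \<phi> \<longleftrightarrow>
     open V \<and>
     openin (top_of_set M) (\<phi> ` V) \<and>
     (\<exists>\<psi>. homeomorphism V (\<phi> ` V) \<phi> \<psi>) \<and>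
     (\<forall>x\<in>V. \<phi> differentiable (at x) \<and> inj (frechet_derivative \<phi> (at x))) \<and>
     (\<forall>h. continuous_on V (\<lambda>x. frechet_derivative \<phi> (at x) h))"

text \<open>
  \<open>\<Omega> p v\<close> is the value at \<open>p\<close> of a top-degree form on the tangent vectors \<open>v i\<close>, indexed by
  \<open>i :: 'd\<close> with \<open>CARD('d)\<close> the dimension of \<open>M\<close>. The index type carries no order, so \<open>\<Omega>\<close> is
  meaningful up to a global sign; the associated measure only involves the absolute value of
  the density of the pulled-back form.
\<close>

definition is_form_measure ::
    "'e::euclidean_space set \<Rightarrow> ('e \<Rightarrow> ('d::finite \<Rightarrow> 'e) \<Rightarrow> real) \<Rightarrow> 'e measure \<Rightarrow> bool" where
  "is_form_measure M \<Omega> \<mu> \<longleftrightarrow>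
     space \<mu> = M \<and> sets \<mu> = sets (restrict_space borel M) \<and>
     (\<forall>V (\<phi> :: real^'d \<Rightarrow> 'e). local_parametrization M V \<phi> \<longrightarrow>
       (\<forall>B\<in>sets borel. B \<subseteq> V \<longrightarrow>
         emeasure \<mu> (\<phi> ` B) =
           (\<integral>\<^sup>+x\<in>B. ennreal \<bar>\<Omega> (\<phi> x) (\<lambda>i. frechet_derivative \<phi> (at x) (axis i 1))\<bar> \<partial>lborel)))"

definition form_measure ::
    "'e::euclidean_space set \<Rightarrow> ('e \<Rightarrow> ('d::finite \<Rightarrow> 'e) \<Rightarrow> real) \<Rightarrow> 'e measure" where
  "form_measure M \<Omega> = (THE \<mu>. is_form_measure M \<Omega> \<mu>)"

text \<open>
  Value of \<open>\<omega>\<^sup>N / N!\<close>, where \<open>N = CARD('d)\<close>, on \<open>2 N\<close> vectors \<open>v\<close>. The vectors are ordered as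
  \<open>v (Inl d\<^sub>1), v (Inr d\<^sub>1), v (Inl d\<^sub>2), v (Inr d\<^sub>2), \<dots>\<close>; the order of the pairs is immaterial.
  The wedge product is normalized by
  \<open>(\<alpha> \<and> \<beta>)(u, v) = \<alpha> u * \<beta> v - \<alpha> v * \<beta> u\<close> for one-forms, which gives
  \<open>\<omega>\<^sup>N (v\<^sub>1, \<dots>, v\<^sub>2\<^sub>N) = (\<Sum>\<sigma>. sign \<sigma> * (\<Prod>k. \<omega> (v\<^bsub>\<sigma>(2k-1)\<^esub>) (v\<^bsub>\<sigma>(2k)\<^esub>))) / 2\<^sup>N\<close>.
\<close>

definition liouville_form ::
    "('v \<Rightarrow> 'v \<Rightarrow> real) \<Rightarrow> ('d::finite + 'd \<Rightarrow> 'v) \<Rightarrow> real" where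
  "liouville_form \<omega> v =
     ((\<Sum>\<sigma> | \<sigma> permutes (UNIV :: ('d + 'd) set).
         of_int (sign \<sigma>) * (\<Prod>d\<in>UNIV. \<omega> (v (\<sigma> (Inl d))) (v (\<sigma> (Inr d)))))
       / 2 ^ CARD('d)) / fact CARD('d)"

section \<open>The cotangent bundle of the unitary group\<close>

definition adjoint_matrix :: "complex^'n^'n \<Rightarrow> complex^'n^'n" where
  "adjoint_matrix A = (\<chi> i j. cnj (A $ j $ i))"

definition unitary_group :: "(complex^'n^'n) set" where
  "unitary_group = {g. adjoint_matrix g ** g = mat 1 \<and> g ** adjoint_matrix g = mat 1}"

definition hermitian_matrices :: "(complex^'n^'n) set" where
  "hermitian_matrices = {A. adjoint_matrix A = A}"

text \<open>
  \<open>T\<^sup>*U(n)\<close> in the left trivialization. The Hermitian matrix \<open>\<xi>\<close> stands for the functional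
  \<open>X \<mapsto> Im (tr (\<xi> X))\<close> on skew-Hermitian matrices, i.e. \<open>\<i> Y \<mapsto> tr (\<xi> Y)\<close> for Hermitian \<open>Y\<close>,
  so that the pair \<open>(g, \<xi>)\<close> is the covector \<open>g X \<mapsto> Im (tr (\<xi> X))\<close> at \<open>g\<close>.
\<close>

definition cotangent_unitary :: "((complex^'n^'n) \<times> (complex^'n^'n)) set" where
  "cotangent_unitary = unitary_group \<times> hermitian_matrices"

text \<open>
  The tautological one-form \<open>\<theta>\<close>, extended to the ambient vector space by writing \<open>g\<^sup>*\<close> for the
  inverse of \<open>g\<close>. On tangent vectors of \<open>T\<^sup>*U(n)\<close> neither \<open>\<theta>\<close> nor its exterior derivative
  depends on the chosen extension.
\<close>

definition tautological_form ::
    "(complex^'n^'n) \<times> (complex^'n^'n) \<Rightarrow> (complex^'n^'n) \<times> (complex^'n^'n) \<Rightarrow> real" where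
  "tautological_form p u = Im (trace (snd p ** (adjoint_matrix (fst p) ** fst u)))"

text \<open>\<open>\<omega> = - d\<theta>\<close>, with \<open>d\<theta>\<close> evaluated on constant ambient vector fields.\<close>

definition canonical_form ::
    "(complex^'n^'n) \<times> (complex^'n^'n) \<Rightarrow> (complex^'n^'n) \<times> (complex^'n^'n)
      \<Rightarrow> (complex^'n^'n) \<times> (complex^'n^'n) \<Rightarrow> real" where
  "canonical_form p u v =
     - (frechet_derivative (\<lambda>q. tautological_form q v) (at p) u
        - frechet_derivative (\<lambda>q. tautological_form q u) (at p) v)"

text \<open>The index type \<open>'n \<times> 'n\<close> makes the power of \<open>\<omega>\<close> equal to \<open>n\<^sup>2\<close>.\<close>

definition liouville_measure :: "((complex^'n^'n) \<times> (complex^'n^'n)) measure" where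
  "liouville_measure =
     form_measure cotangent_unitary
       (\<lambda>p (v :: ('n \<times> 'n) + ('n \<times> 'n) \<Rightarrow> _). liouville_form (canonical_form p) v)"

definition right_moment :: "(complex^'n^'n) \<times> (complex^'n^'n) \<Rightarrow> complex^'n^'n" where
  "right_moment p = - snd p"

definition left_moment :: "(complex^'n^'n) \<times> (complex^'n^'n) \<Rightarrow> complex^'n^'n" where
  "left_moment p = fst p ** snd p ** matrix_inv (fst p)"

section \<open>The Gelfand--Zeitlin map\<close>

text \<open>
  Rows and columns are indexed by the linearly ordered type \<open>'n\<close>; \<open>index_of k\<close> is its
  \<open>k\<close>-th element, counted from \<open>0\<close>, and \<open>rank_of\<close> is the inverse map.
\<close>

definition index_of :: "nat \<Rightarrow> 'n::{finite,wellorder}" where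
  "index_of k = sorted_list_of_set (UNIV :: 'n set) ! k"

definition rank_of :: "'n::{finite,wellorder} \<Rightarrow> nat" where
  "rank_of i = card {j. j < i}"

definition upper_left_block :: "nat \<Rightarrow> complex^'n::{finite,wellorder}^'n::_ \<Rightarrow> complex Matrix.mat" where
  "upper_left_block k A = Matrix.mat k k (\<lambda>(i, j). A $ index_of i $ index_of j)"

text \<open>
  Eigenvalues with multiplicity in decreasing order, for matrices with real spectrum; the
  entry at list position \<open>i\<close> is the \<open>(i + 1)\<close>-st largest eigenvalue.
\<close>

definition eigenvalues_decreasing :: "complex Matrix.mat \<Rightarrow> real list" where
  "eigenvalues_decreasing A =
     rev (sorted_list_of_multiset (image_mset Re (proots (char_poly A))))"

definition gz_row :: "nat \<Rightarrow> complex^'n::{finite,wellorder}^'n::_ \<Rightarrow> real list" where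
  "gz_row k A = eigenvalues_decreasing (upper_left_block k A)"

definition gz_top_row :: "complex^'n::{finite,wellorder}^'n::_ \<Rightarrow> real^'n::_" where
  "gz_top_row A = (\<chi> i. gz_row CARD('n) A ! rank_of i)"

definition gz_lower_rows :: "complex^'n::{finite,wellorder}^'n::_ \<Rightarrow> real list list" where
  "gz_lower_rows A = map (\<lambda>k. gz_row k A) (rev [1..<CARD('n)])"

definition gz_strictly_interlacing :: "complex^'n::{finite,wellorder}^'n::_ \<Rightarrow> bool" where
  "gz_strictly_interlacing A \<longleftrightarrow>
     (\<forall>k. 1 \<le> k \<and> k < CARD('n) \<longrightarrow>
       (\<forall>i<k. gz_row (k + 1) A ! i > gz_row k A ! i \<and>
              gz_row k A ! i > gz_row (k + 1) A ! (i + 1)))"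

definition strongly_regular_locus ::
    "((complex^'n::{finite,wellorder}^'n::_) \<times> (complex^'n::_^'n::_)) set" where
  "strongly_regular_locus =
     {p \<in> cotangent_unitary.
        gz_strictly_interlacing (left_moment p) \<and> gz_strictly_interlacing (right_moment p)}"

text \<open>
  The double Gelfand--Zeitlin moment map. The top row \<open>a\<close> is recorded once: that of the left
  moment map is \<open>(- a\<^sub>n, \<dots>, - a\<^sub>1)\<close>.
\<close>

definition double_gz ::
    "(complex^'n::{finite,wellorder}^'n::_) \<times> (complex^'n::_^'n::_)
      \<Rightarrow> (real^'n::_) \<times> real list list \<times> real list list" where
  "double_gz p =
     (gz_top_row (right_moment p), gz_lower_rows (left_moment p), gz_lower_rows (right_moment p))"

definition proj_top :: "(real^'n) \<times> real list list \<times> real list list \<Rightarrow> real^'n" where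
  "proj_top = fst"

section \<open>The base of the projection\<close>

definition open_chamber :: "(real^'n::{finite,wellorder}) set" where
  "open_chamber = {a. \<forall>i j. i < j \<longrightarrow> a $ i > a $ j}"

definition vandermonde :: "real^'n::{finite,wellorder} \<Rightarrow> real" where
  "vandermonde a = (\<Prod>(i, j)\<in>{(i, j). i < j}. a $ i - a $ j)"

end

theory Submission imports Defs
begin

text \<open>
  In the left trivialization \<open>\<omega>\<^sup>N / N!\<close> is a constant multiple of Haar measure times Lebesgue measure
  on Hermitian matrices, because in Cayley charts only the pairings of base with fibre directions
  contribute. Strict interlacing means that consecutive leading blocks have no common eigenvalue;
  by the Sturm recursion each line in a suitable entry meets the exceptional set in finitely many
  points, so almost every Hermitian matrix is strictly interlacing, and conjugation by a unitary
  preserves this. What remains is the distribution of the spectrum \<open>a\<close> of a Hermitian matrix under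
  Lebesgue measure. The map \<open>(a, U) \<mapsto> U diag(a) U\<^sup>*\<close>, restricted to unitary \<open>U\<close> near the identity with
  off-diagonal Cayley coordinates, is injective with Jacobian \<open>\<Delta>(a)\<^sup>2\<close> times a function of \<open>U\<close>. Its image \<open>N\<close>
  contains only a part of each conjugacy class, but the Haar measure of those \<open>g\<close> that move a given
  matrix into \<open>N\<close> is the same for all spectra; averaging over \<open>g\<close> therefore yields the density.
\<close>

section \<open>Alternating multilinear functionals\<close>

text \<open>\<open>form_measure\<close> is a definite description that quantifies over all
  parametrizations, so it carries no information until exactly one such measure is shown to exist.
  This is why a countable atlas is built and why change of variables comes before any geometry.
  Cayley charts serve because the transform and its inverse are rational in the matrix, each chart
  is defined on a whole vector space, and left translates of a chart have the same density.
  Hermitian coordinates are scaled by sqrt 2 off the diagonal so that tr(XY) becomes the Euclidean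
  inner product: conjugation is then orthogonal, and fibre coordinates are dual to the base frame.
  The flag manifold and its invariant measure never appear. Their role is taken by measuring one set
  of pairs (g, x) in two orders, which works because diag(a) has the same stabilizer, the diagonal
  torus, for every regular a. The constant of the theorem is the product of the Liouville constant,
  the total Haar mass and the constant of the spectral density; it is shown to be positive and
  finite without being evaluated.\<close>

definition alternating_multilinear :: "(('d::finite \<Rightarrow> 'v::real_vector) \<Rightarrow> real) \<Rightarrow> bool" where
  "alternating_multilinear F \<longleftrightarrow>
     (\<forall>v i. linear (\<lambda>x. F (v(i := x)))) \<and> (\<forall>v i j. i \<noteq> j \<longrightarrow> v i = v j \<longrightarrow> F v = 0)"

lemma alternating_multilinear_add:
  assumes "alternating_multilinear F"
  shows "F (v(i := x + y)) = F (v(i := x)) + F (v(i := y))"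
  using assms linear_add[of "\<lambda>x. F (v(i := x))" x y] unfolding alternating_multilinear_def by blast

lemma alternating_multilinear_scale:
  assumes "alternating_multilinear F"
  shows "F (v(i := c *\<^sub>R x)) = c * F (v(i := x))"
  using assms linear_scale[of "\<lambda>x. F (v(i := x))" c x] unfolding alternating_multilinear_def by simp

lemma alternating_multilinear_zero:
  assumes "alternating_multilinear F" "v i = 0"
  shows "F v = 0"
  using alternating_multilinear_scale[OF assms(1), of v i 0 0] assms(2)
  by (simp add: fun_upd_idem)

lemma alternating_multilinear_eq_0:
  assumes "alternating_multilinear F" "i \<noteq> j" "v i = v j"
  shows "F v = 0"
  using assms unfolding alternating_multilinear_def by blast

lemma alternating_multilinear_scale_all:
  fixes F :: "('d::finite \<Rightarrow> 'v::real_vector) \<Rightarrow> real"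
  assumes "alternating_multilinear F"
  shows "F (\<lambda>i. c i *\<^sub>R w i) = (\<Prod>i\<in>UNIV. c i) * F w"
proof -
  have "F (\<lambda>i. if i \<in> T then c i *\<^sub>R w i else w i) = (\<Prod>i\<in>T. c i) * F w" if "finite T" for T
    using that
  proof (induction T)
    case (insert a T)
    define v where "v = (\<lambda>i. if i \<in> T then c i *\<^sub>R w i else w i)"
    have "(\<lambda>i. if i \<in> insert a T then c i *\<^sub>R w i else w i) = v(a := c a *\<^sub>R w a)"
      by (auto simp: v_def)
    moreover have "v(a := w a) = v"
      using insert by (auto simp: v_def)
    ultimately show ?case
      using insert alternating_multilinear_scale[OF assms, of v a "c a" "w a"] by (simp add: v_def mult.assoc)
  qed simp
  from this[of UNIV] show ?thesis by simp
qed

text \<open>Polarization: expand the zero value of \<open>F\<close> with \<open>w m + w n\<close> in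
  both slots \<open>m\<close> and \<open>n\<close>.\<close>

lemma alternating_multilinear_swap:
  assumes F: "alternating_multilinear F" and "m \<noteq> n"
  shows "F (w(m := w n, n := w m)) = - F w"
proof -
  let ?f = "\<lambda>x y. F (w(m := x, n := y))"
  have l: "?f (x + x') y = ?f x y + ?f x' y" for x x' y
    using alternating_multilinear_add[OF F, of "w(n := y)" m x x'] \<open>m \<noteq> n\<close>
    by (simp add: fun_upd_twist)
  have r: "?f x (y + y') = ?f x y + ?f x y'" for x y y'
    using alternating_multilinear_add[OF F, of "w(m := x)" n y y'] by simp
  have z: "?f x x = 0" for x
    by (rule alternating_multilinear_eq_0[OF F \<open>m \<noteq> n\<close>]) (use \<open>m \<noteq> n\<close> in auto)
  have "?f (w m + w n) (w m + w n) = (?f (w m) (w m) + ?f (w n) (w m)) + (?f (w m) (w n) + ?f (w n) (w n))"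
    by (simp only: l r)
  then have "?f (w m) (w n) + ?f (w n) (w m) = 0"
    using z[of "w m"] z[of "w n"] z[of "w m + w n"] by linarith
  then show ?thesis by simp
qed

text \<open>Both sides are compatible with products of matrices, so it is enough to check a zero
  row, diagonal matrices, transpositions and transvections. The result serves as the transformation
  law of the Liouville form under a change of parametrization, and as a uniqueness principle for
  determinants.\<close>

theorem alternating_multilinear_det:
  fixes F :: "('d::finite \<Rightarrow> 'v::real_vector) \<Rightarrow> real" and A :: "real^'d^'d"
  assumes F: "alternating_multilinear F"
  shows "F (\<lambda>i. \<Sum>k\<in>UNIV. A $ i $ k *\<^sub>R w k) = Determinants.det A * F w"
proof -
  define P where "P = (\<lambda>A::real^'d^'d. \<forall>w. F (\<lambda>i. \<Sum>k\<in>UNIV. A $ i $ k *\<^sub>R w k) = Determinants.det A * F w)"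
  have "P A"
  proof (rule induct_matrix_elementary)
    fix A B :: "real^'d^'d" assume AB: "P A" "P B"
    show "P (A ** B)"
      unfolding P_def
    proof
      fix w :: "'d \<Rightarrow> 'v"
      have "(\<Sum>k\<in>UNIV. (A ** B) $ i $ k *\<^sub>R w k) = (\<Sum>k\<in>UNIV. A $ i $ k *\<^sub>R (\<Sum>l\<in>UNIV. B $ k $ l *\<^sub>R w l))" for i
        by (simp add: matrix_matrix_mult_def scaleR_sum_left scaleR_sum_right ) (subst sum.swap, rule refl)
      then show "F (\<lambda>i. \<Sum>k\<in>UNIV. (A ** B) $ i $ k *\<^sub>R w k) = Determinants.det (A ** B) * F w"
        using AB unfolding P_def by (simp add: det_mul mult.assoc)
    qed
  next
    fix A :: "real^'d^'d" and i assume 0: "Finite_Cartesian_Product.row i A = 0"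
    then have "\<And>k. A $ i $ k = 0" by (simp add: Finite_Cartesian_Product.row_def Finite_Cartesian_Product.vec_eq_iff)
    then have "F (\<lambda>i. \<Sum>k\<in>UNIV. A $ i $ k *\<^sub>R w k) = 0" for w
      by (intro alternating_multilinear_zero[OF F, of _ i]) simp
    moreover have "Determinants.det A = 0" by (rule det_zero_row[OF 0])
    ultimately show "P A" by (simp add: P_def)
  next
    fix A :: "real^'d^'d" assume d: "\<And>i j. i \<noteq> j \<Longrightarrow> A $ i $ j = 0"
    have "(\<Sum>k\<in>UNIV. A $ i $ k *\<^sub>R w k) = A $ i $ i *\<^sub>R w i" for i and w :: "'d \<Rightarrow> 'v"
      using d by (subst sum.remove[of _ i]) (auto intro!: sum.neutral)
    then show "P A"
      using alternating_multilinear_scale_all[OF F] by (simp add: P_def det_diagonal[OF d])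
  next
    fix m n :: 'd assume mn: "m \<noteq> n"
    let ?t = "Transposition.transpose m n"
    let ?A = "(\<chi> i j. mat 1 $ i $ ?t j) :: real^'d^'d"
    have "(\<Sum>k\<in>UNIV. ?A $ i $ k *\<^sub>R w k) = w (?t i)" for i and w :: "'d \<Rightarrow> 'v"
    proof -
      have "?A $ i $ k *\<^sub>R w k = (if k = ?t i then w k else 0)" for k
        by (simp add: Finite_Cartesian_Product.mat_def)
      then show ?thesis by simp
    qed
    moreover have "(\<lambda>i. w (?t i)) = w(m := w n, n := w m)" for w :: "'d \<Rightarrow> 'v"
      by (auto simp: Transposition.transpose_def fun_eq_iff)
    moreover have "Determinants.det ?A = -1"
      using det_permute_columns[OF permutes_swap_id[of m UNIV n], of "mat 1 :: real^'d^'d"] mn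
      by (simp add: sign_swap_id)
    ultimately show "P ?A"
      using alternating_multilinear_swap[OF F mn] unfolding P_def by (simp del: fun_upd_apply vec_lambda_beta)
  next
    fix m n :: 'd and c :: real assume mn: "m \<noteq> n"
    let ?A = "(\<chi> i j. if i = m \<and> j = n then c else of_bool (i = j)) :: real^'d^'d"
    have "(\<Sum>k\<in>UNIV. ?A $ i $ k *\<^sub>R w k) = (w(m := w m + c *\<^sub>R w n)) i" for i and w :: "'d \<Rightarrow> 'v"
    proof -
      have "?A $ i $ k *\<^sub>R w k = (if k = i then w k else 0) + (if k = n then (if i = m then c *\<^sub>R w k else 0) else 0)" for k
        using mn by auto
      then show ?thesis by (simp add: sum.distrib)
    qed
    then have "(\<lambda>i. \<Sum>k\<in>UNIV. ?A $ i $ k *\<^sub>R w k) = w(m := w m + c *\<^sub>R w n)" for w :: "'d \<Rightarrow> 'v" by blast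
    moreover have "F (w(m := w m + c *\<^sub>R w n)) = F w" for w
      using alternating_multilinear_add[OF F, of w m "w m" "c *\<^sub>R w n"]
        alternating_multilinear_scale[OF F, of w m c "w n"]
        alternating_multilinear_eq_0[OF F mn, of "w(m := w n)"] mn
      by simp
    moreover have "Determinants.det ?A = 1"
    proof -
      have "?A = (\<chi> k. if k = m then Finite_Cartesian_Product.row m (mat 1) + c *s Finite_Cartesian_Product.row n (mat 1) else Finite_Cartesian_Product.row k (mat 1))"
        using mn by (intro arg_cong[where f = vec_lambda] ext)
          (auto simp: Finite_Cartesian_Product.vec_eq_iff vector_add_component vector_smult_component Finite_Cartesian_Product.row_def Finite_Cartesian_Product.mat_def)
      then show ?thesis using det_row_operation[OF mn, of "mat 1" c] by simp
    qed
    ultimately show "P ?A" by (simp add: P_def)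
  qed
  then show ?thesis by (simp add: P_def)
qed

section \<open>Change of variables for an arbitrary finite index type\<close>

text \<open>
  The library states the change of variables formula only for well-ordered index types, and
  product types carry the componentwise order. A copy of the index type with the order of an
  enumeration removes the restriction.
\<close>

typedef 'a enumerated = "UNIV :: 'a set" by auto

instantiation enumerated :: (countable) wellorder
begin

definition "x \<le> y \<longleftrightarrow> to_nat (Rep_enumerated x) \<le> to_nat (Rep_enumerated y)"
definition "x < y \<longleftrightarrow> to_nat (Rep_enumerated x) < to_nat (Rep_enumerated y)"

instance
proof
  fix P :: "'a enumerated \<Rightarrow> bool" and a
  assume *: "\<And>x. (\<And>y. y < x \<Longrightarrow> P y) \<Longrightarrow> P x"
  show "P a"
    by (induction "to_nat (Rep_enumerated a)" arbitrary: a rule: less_induct)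
      (metis * less_enumerated_def)
qed (auto simp: less_eq_enumerated_def less_enumerated_def Rep_enumerated_inject)

end

lemma bij_Abs_enumerated: "bij Abs_enumerated"
  by (metis Abs_enumerated_inverse Rep_enumerated_inverse UNIV_I bij_iff)

instance enumerated :: (finite) finite
  by standard (metis bij_Abs_enumerated bij_betw_finite finite)

definition reindex :: "real^'d::finite \<Rightarrow> real^'d enumerated" where
  "reindex x = (\<chi> i. x $ Rep_enumerated i)"

definition unreindex :: "real^'d::finite enumerated \<Rightarrow> real^'d" where
  "unreindex x = (\<chi> i. x $ Abs_enumerated i)"

lemma reindex_unreindex [simp]: "reindex (unreindex x) = x" "unreindex (reindex y) = y"
  by (simp_all add: reindex_def unreindex_def Rep_enumerated_inverse Abs_enumerated_inverse)

lemma reindex_nth: "reindex x $ i = x $ Rep_enumerated i"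
  by (simp add: reindex_def)

lemma bounded_linear_reindex: "bounded_linear reindex" "bounded_linear unreindex"
  by (intro linear_conv_bounded_linear[THEN iffD1] linearI;
    simp add: reindex_def unreindex_def Finite_Cartesian_Product.vec_eq_iff)+

lemma continuous_reindex: "continuous_on S reindex" "continuous_on T unreindex"
  by (simp_all add: bounded_linear_reindex linear_continuous_on)

lemma measurable_reindex [measurable]:
  "reindex \<in> borel \<rightarrow>\<^sub>M borel" "unreindex \<in> borel \<rightarrow>\<^sub>M borel"
  using continuous_reindex by (auto intro: borel_measurable_continuous_onI)

lemma prod_Basis_vec: "(\<Prod>b\<in>(Basis :: (real^'d) set). f b) = (\<Prod>i\<in>UNIV. f (axis i 1))"
proof -
  have "(Basis :: (real^'d) set) = (\<lambda>i. axis i 1) ` UNIV" by (auto simp: Basis_vec_def)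
  moreover have "inj (\<lambda>i::'d. axis i (1::real))" by (auto simp: inj_on_def axis_eq_axis)
  ultimately show ?thesis using prod.reindex[of "\<lambda>i::'d. axis i (1::real)" UNIV f] by (simp add: o_def)
qed

lemma box_vec_eq: "box (l :: real^'d) u = {x. \<forall>i. l $ i < x $ i \<and> x $ i < u $ i}"
  unfolding box_def Basis_vec_def by (force simp: inner_axis)

lemma distr_reindex: "distr lborel borel reindex = (lborel :: (real^'d::finite enumerated) measure)"
proof (rule lborel_eqI[symmetric])
  fix l u :: "real^'d enumerated" assume le: "\<And>b. b \<in> Basis \<Longrightarrow> l \<bullet> b \<le> u \<bullet> b"
  have "reindex -` box l u = box (unreindex l) (unreindex u)"
    by (auto simp: box_vec_eq reindex_def unreindex_def)
      (metis Abs_enumerated_inverse Rep_enumerated_inverse UNIV_I)+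
  moreover have "(\<Prod>b\<in>Basis. (unreindex u - unreindex l) \<bullet> b) = (\<Prod>b\<in>Basis. (u - l) \<bullet> b)"
    unfolding prod_Basis_vec
    by (simp add: inner_axis unreindex_def prod.reindex_bij_betw[OF bij_Abs_enumerated, of "\<lambda>i. u $ i - l $ i"])
  moreover have "unreindex l \<bullet> b \<le> unreindex u \<bullet> b" if "b \<in> Basis" for b
  proof -
    obtain i where "b = axis i 1" using \<open>b \<in> Basis\<close> by (auto simp: Basis_vec_def)
    then show ?thesis
      using le[of "axis (Abs_enumerated i) 1"] by (auto simp: Basis_vec_def inner_axis unreindex_def)
  qed
  ultimately show "emeasure (distr lborel borel reindex) (box l u) = (\<Prod>b\<in>Basis. (u - l) \<bullet> b)"
    by (simp add: emeasure_distr emeasure_lborel_box)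
qed simp

text \<open>As a function of the rows, the determinant after renaming is alternating and multilinear
  with value 1 at the identity. \<open>alternating_multilinear_det\<close> then identifies it with
  the determinant, and no sum over permutations has to be reindexed.\<close>

lemma det_eq_of_unreindexed:
  fixes A :: "real^'d^'d"
  shows "Determinants.det (\<chi> i j. A $ Rep_enumerated i $ Rep_enumerated j) = Determinants.det A"
proof -
  define F :: "('d \<Rightarrow> real^'d) \<Rightarrow> real" where
    "F = (\<lambda>v. Determinants.det (\<chi> i j. v (Rep_enumerated i) $ Rep_enumerated j))"
  have upd: "(\<chi> i j. (v(k := x)) (Rep_enumerated i) $ Rep_enumerated j) =
     (\<chi> i. if i = Abs_enumerated k then reindex x else reindex (v (Rep_enumerated i)))" for v k x
    by (auto simp: Finite_Cartesian_Product.vec_eq_iff reindex_def Abs_enumerated_inverse Rep_enumerated_inverse)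
  have "alternating_multilinear F"
    unfolding alternating_multilinear_def
  proof (intro conjI allI impI)
    fix v :: "'d \<Rightarrow> real^'d" and k
    show "linear (\<lambda>x. F (v(k := x)))"
    proof (rule linearI)
      fix x y :: "real^'d"
      have "reindex (x + y) = reindex x + reindex y" by (simp add: linear_add bounded_linear.linear bounded_linear_reindex)
      then show "F (v(k := x + y)) = F (v(k := x)) + F (v(k := y))"
        unfolding F_def upd
        by (simp only: Determinants.det_row_add[where a = "\<lambda>_. reindex x" and b = "\<lambda>_. reindex y"])
    next
      fix c and x :: "real^'d"
      have "reindex (c *\<^sub>R x) = c *s reindex x" by (simp add: Finite_Cartesian_Product.vec_eq_iff reindex_def)
      then show "F (v(k := c *\<^sub>R x)) = c *\<^sub>R F (v(k := x))"
        unfolding F_def upd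
        by (simp only: Determinants.det_row_mul[where a = "\<lambda>_. reindex x"] real_scaleR_def)
    qed
  next
    fix v :: "'d \<Rightarrow> real^'d" and i j assume "i \<noteq> j" "v i = v j"
    then show "F v = 0"
      unfolding F_def
      by (intro Determinants.det_identical_rows[of "Abs_enumerated i" "Abs_enumerated j"])
        (auto simp: Abs_enumerated_inject Abs_enumerated_inverse Finite_Cartesian_Product.row_def)
  qed
  from alternating_multilinear_det[OF this, of A "\<lambda>k. axis k 1"]
  have "F (\<lambda>i. \<Sum>k\<in>UNIV. A $ i $ k *\<^sub>R axis k 1) = Determinants.det A * F (\<lambda>k. axis k 1)" .
  moreover have "(\<lambda>i. \<Sum>k\<in>UNIV. A $ i $ k *\<^sub>R axis k 1) = (\<lambda>i. A $ i)"
    by (simp add: fun_eq_iff Finite_Cartesian_Product.vec_eq_iff axis_def if_distrib cong: if_cong)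
  moreover have "(\<chi> i j. axis (Rep_enumerated i) 1 $ Rep_enumerated j) = (mat 1 :: real^'d enumerated^'d enumerated)"
    by (auto simp: Finite_Cartesian_Product.vec_eq_iff Finite_Cartesian_Product.mat_def axis_def Rep_enumerated_inject)
  ultimately show ?thesis
    by (simp add: F_def)
qed

text \<open>\<open>has_measure_differentiable_image\<close> covers images of finite measure. If the
  image has infinite measure, a finite integral of the Jacobian would make the image measurable of
  finite measure, a contradiction; so both sides are infinite.\<close>

lemma emeasure_image_wellorder:
  fixes g :: "real^'d::{finite,wellorder} \<Rightarrow> real^'d::_"
  assumes S: "S \<in> sets borel" and gS: "g ` S \<in> sets borel"
    and der: "\<And>x. x \<in> S \<Longrightarrow> (g has_derivative g' x) (at x)"
    and inj: "inj_on g S"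
  shows "emeasure lborel (g ` S) = (\<integral>\<^sup>+x\<in>S. ennreal \<bar>Determinants.det (matrix (g' x))\<bar> \<partial>lborel)"
proof -
  let ?D = "\<lambda>x. \<bar>Determinants.det (matrix (g' x))\<bar>"
  have S': "S \<in> sets lebesgue" using S by simp
  have der': "(g has_derivative g' x) (at x within S)" if "x \<in> S" for x
    using der[OF that] has_derivative_at_withinI by blast
  note ch = has_measure_differentiable_image[OF S' der' inj]
  have meas: "?D \<in> borel_measurable (lebesgue_on S)"
    using borel_measurable_det_Jacobian[OF S' der'] by simp
  show ?thesis
  proof (cases "emeasure lborel (g ` S) = \<infinity>")
    case False
    then have fm: "g ` S \<in> lmeasurable"
      using gS by (intro fmeasurableI) (simp_all add: top.not_eq_extremum)
    with ch have "(?D has_integral measure lebesgue (g ` S)) S" by blast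
    from nn_integral_has_integral_lebesgue'[OF _ this]
    have "(\<integral>\<^sup>+x\<in>S. ennreal (?D x) \<partial>lborel) = ennreal (measure lebesgue (g ` S))" by simp
    also have "\<dots> = emeasure lborel (g ` S)"
      using emeasure_eq_measure2[OF fm] gS by simp
    finally show ?thesis by simp
  next
    case True
    have "(\<integral>\<^sup>+x\<in>S. ennreal (?D x) \<partial>lborel) = \<infinity>"
    proof (rule ccontr)
      assume fin: "(\<integral>\<^sup>+x\<in>S. ennreal (?D x) \<partial>lborel) \<noteq> \<infinity>"
      let ?f = "\<lambda>x. if x \<in> S then ?D x else 0"
      have "?f \<in> borel_measurable lebesgue"
        using meas S' by (simp add: borel_measurable_if_I)
      moreover have "integral\<^sup>N lebesgue ?f = (\<integral>\<^sup>+x\<in>S. ennreal (?D x) \<partial>lborel)"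
        unfolding nn_integral_completion by (intro nn_integral_cong) (auto simp: indicator_def)
      moreover obtain r where "0 \<le> r" "(\<integral>\<^sup>+x\<in>S. ennreal (?D x) \<partial>lborel) = ennreal r"
        using fin by (cases "(\<integral>\<^sup>+x\<in>S. ennreal (?D x) \<partial>lborel)") auto
      ultimately have "(?f has_integral r) UNIV"
        by (subst has_integral_iff_nn_integral_lebesgue) auto
      then have "(?D has_integral r) S"
        by (simp add: has_integral_restrict_UNIV)
      with ch have "g ` S \<in> lmeasurable" by blast
      then have "emeasure lebesgue (g ` S) < \<infinity>" unfolding fmeasurable_def mem_Collect_eq infinity_ennreal_def by (rule conjunct2)
      then show False using True gS by simp
    qed
    with True show ?thesis by simp
  qed
qed

text \<open>The integrand \<open>g\<close> carries no measurability assumption, and then only an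
  inequality is available. The Jacobian in the next theorem is such an integrand, since
  \<open>g'\<close> is only known to be a derivative at each point of \<open>S\<close>.\<close>

lemma nn_integral_distr_le:
  assumes f: "f \<in> M \<rightarrow>\<^sub>M N"
  shows "(\<integral>\<^sup>+y. g y \<partial>distr M N f) \<le> (\<integral>\<^sup>+x. g (f x) \<partial>M)"
  unfolding nn_integral_def[of "distr M N f"]
proof (rule SUP_least, clarify)
  fix s assume s: "simple_function (distr M N f) s" "s \<le> g"
  then have [measurable]: "s \<in> borel_measurable N"
    using borel_measurable_simple_function by fastforce
  have "integral\<^sup>S (distr M N f) s = (\<integral>\<^sup>+y. s y \<partial>distr M N f)"
    using s by (simp add: nn_integral_eq_simple_integral)
  also have "\<dots> = (\<integral>\<^sup>+x. s (f x) \<partial>M)"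
    using f by (subst nn_integral_distr) auto
  also have "\<dots> \<le> (\<integral>\<^sup>+x. g (f x) \<partial>M)"
    using s by (intro nn_integral_mono) (auto simp: le_fun_def)
  finally show "integral\<^sup>S (distr M N f) s \<le> (\<integral>\<^sup>+x. g (f x) \<partial>M)" .
qed

theorem emeasure_differentiable_image:
  fixes g :: "real^'d \<Rightarrow> real^'d"
  assumes S: "S \<in> sets borel" and gS: "g ` S \<in> sets borel"
    and der: "\<And>x. x \<in> S \<Longrightarrow> (g has_derivative g' x) (at x)"
    and inj: "inj_on g S"
  shows "emeasure lborel (g ` S) = (\<integral>\<^sup>+x\<in>S. ennreal \<bar>Determinants.det (matrix (g' x))\<bar> \<partial>lborel)"
proof -
  let ?h = "reindex \<circ> g \<circ> unreindex" and ?h' = "\<lambda>x. reindex \<circ> g' (unreindex x) \<circ> unreindex"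
  have img: "reindex ` T = unreindex -` T" for T :: "(real^'d) set"
    by (auto simp: image_iff) (metis reindex_unreindex(1))
  have inv: "distr (lborel :: (real^'d enumerated) measure) borel unreindex = lborel"
    unfolding distr_reindex[symmetric] by (subst distr_distr) (auto simp: o_def distr_id2)
  have im: "?h ` (reindex ` S) = unreindex -` (g ` S)"
    unfolding img[symmetric] by (simp add: image_comp o_def)
  have pre: "unreindex -` T \<in> sets borel" if "T \<in> sets borel" for T :: "(real^'d) set"
    using measurable_sets_borel[OF measurable_reindex(2) that] by simp
  have e: "emeasure lborel (unreindex -` T) = emeasure lborel T" if "T \<in> sets borel" for T :: "(real^'d) set"
  proof -
    have "reindex -` unreindex -` T = T" by auto
    then show ?thesis
      using pre[OF that] by (subst distr_reindex[symmetric]) (simp add: emeasure_distr)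
  qed
  have "emeasure lborel (g ` S) = emeasure lborel (?h ` (reindex ` S))"
    unfolding im by (rule e[OF gS, symmetric])
  also have "\<dots> = (\<integral>\<^sup>+x\<in>reindex ` S. ennreal \<bar>Determinants.det (matrix (?h' x))\<bar> \<partial>lborel)"
  proof (rule emeasure_image_wellorder)
    show "reindex ` S \<in> sets borel" unfolding img using S by (rule pre)
    show "?h ` reindex ` S \<in> sets borel" unfolding im using gS by (rule pre)
    show "inj_on ?h (reindex ` S)"
      using inj by (auto simp: inj_on_def) (metis reindex_unreindex(2))
    fix x assume "x \<in> reindex ` S"
    then have "unreindex x \<in> S" by auto
    then show "(?h has_derivative ?h' x) (at x)"
      using bounded_linear_imp_has_derivative[OF bounded_linear_reindex(1)]
        bounded_linear_imp_has_derivative[OF bounded_linear_reindex(2)] der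
      by (intro diff_chain_at) auto
  qed
  also have "\<dots> = (\<integral>\<^sup>+x. ennreal \<bar>Determinants.det (matrix (?h' x))\<bar> * indicator (reindex ` S) x \<partial>distr lborel borel reindex)"
    (is "_ = (\<integral>\<^sup>+x. ?k x \<partial>_)")
    unfolding distr_reindex ..
  also have "\<dots> = (\<integral>\<^sup>+x. ennreal \<bar>Determinants.det (matrix (?h' (reindex x)))\<bar> * indicator (reindex ` S) (reindex x) \<partial>lborel)"
  \<comment> \<open>Equality for a possibly non-measurable integrand: the one-sided estimate is
    applied to \<open>reindex\<close> and to its inverse \<open>unreindex\<close>, and the two
    inequalities close up.\<close>
  proof (rule antisym)
    show "(\<integral>\<^sup>+x. ?k x \<partial>distr lborel borel reindex) \<le> (\<integral>\<^sup>+x. ?k (reindex x) \<partial>lborel)"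
      by (rule nn_integral_distr_le) simp
    have "(\<integral>\<^sup>+x. ?k (reindex x) \<partial>distr lborel borel unreindex) \<le> (\<integral>\<^sup>+x. ?k (reindex (unreindex x)) \<partial>lborel)"
      by (rule nn_integral_distr_le) simp
    then show "(\<integral>\<^sup>+x. ?k (reindex x) \<partial>lborel) \<le> (\<integral>\<^sup>+x. ?k x \<partial>distr lborel borel reindex)"
      by (simp add: inv distr_reindex)
  qed
  also have "\<dots> = (\<integral>\<^sup>+x\<in>S. ennreal \<bar>Determinants.det (matrix (g' x))\<bar> \<partial>lborel)"
  proof (intro nn_integral_cong)
    fix x
    have "matrix (?h' (reindex x)) = (\<chi> i j. matrix (g' x) $ Rep_enumerated i $ Rep_enumerated j)"
    proof -
      have "unreindex (axis j 1) = axis (Rep_enumerated j) 1" for j :: "'d enumerated"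
        by (auto simp: Finite_Cartesian_Product.vec_eq_iff unreindex_def axis_def Rep_enumerated_inverse Abs_enumerated_inverse)
      then show ?thesis
        unfolding matrix_def o_def reindex_unreindex reindex_nth vec_lambda_beta by simp
    qed
    moreover have "indicator (reindex ` S) (reindex x) = (indicator S x :: ennreal)"
      unfolding img by (auto simp: indicator_def)
    ultimately show "ennreal \<bar>Determinants.det (matrix (?h' (reindex x)))\<bar> * indicator (reindex ` S) (reindex x)
      = ennreal \<bar>Determinants.det (matrix (g' x))\<bar> * indicator S x"
      by (simp only: det_eq_of_unreindexed)
  qed
  finally show ?thesis .
qed

lemma homeomorphism_image_eq_vimage:
  assumes "homeomorphism V W \<phi> h" "B \<subseteq> V"
  shows "\<phi> ` B = h -` B \<inter> W"
proof -
  have h: "h (\<phi> x) = x" if "x \<in> V" for x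
    using homeomorphism_apply1[OF assms(1) that] .
  have \<phi>: "\<phi> x \<in> W" if "x \<in> V" for x
    using homeomorphism_image1[OF assms(1)] that by blast
  show ?thesis
  proof (intro equalityI subsetI)
    fix y assume "y \<in> \<phi> ` B"
    then obtain x where "x \<in> B" "y = \<phi> x" by blast
    then show "y \<in> h -` B \<inter> W" using h[of x] \<phi>[of x] assms(2) by auto
  next
    fix y assume "y \<in> h -` B \<inter> W"
    then have "h y \<in> B" "y = \<phi> (h y)" using homeomorphism_apply2[OF assms(1), of y] by auto
    then show "y \<in> \<phi> ` B" by (rule rev_image_eqI)
  qed
qed

text \<open>Invariance of domain makes the inverse continuous on the open image of \<open>V\<close>,
  so the image of \<open>B\<close> is a preimage under a Borel map.\<close>

lemma borel_image_of_open_injection: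
  fixes g :: "'a::euclidean_space \<Rightarrow> 'a"
  assumes "open V" "continuous_on V g" "inj_on g V" "B \<in> sets borel" "B \<subseteq> V"
  shows "g ` B \<in> sets borel"
proof -
  obtain h where h: "homeomorphism V (g ` V) g h"
    using invariance_of_domain_homeomorphism[OF assms(1,2) _ assms(3)] by auto
  have "open (g ` V)" by (rule invariance_of_domain[OF assms(2,1,3)])
  have "h \<in> borel_measurable (restrict_space borel (g ` V))"
    using h by (intro borel_measurable_continuous_on_restrict) (simp add: homeomorphism_def)
  moreover have "g ` B = h -` B \<inter> space (restrict_space borel (g ` V))"
    using homeomorphism_image_eq_vimage[OF h assms(5)] by (simp add: space_restrict_space)
  ultimately have "g ` B \<in> sets (restrict_space borel (g ` V))"
    using measurable_sets[OF _ assms(4), of h] by auto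
  then show ?thesis
    using \<open>open (g ` V)\<close> by (simp add: sets_restrict_space_iff)
qed

text \<open>Instead of approximating \<open>f\<close>, the formula is first proved as an identity of
  measures: pushing the Jacobian density forward gives Lebesgue measure restricted to the image of
  \<open>V\<close>. Integrating \<open>f\<close> against both sides is then immediate.\<close>

lemma nn_integral_differentiable_image:
  fixes g :: "real^'d \<Rightarrow> real^'d"
  assumes V: "open V" and der: "\<And>x. x \<in> V \<Longrightarrow> (g has_derivative g' x) (at x)"
    and inj: "inj_on g V"
    and cont: "continuous_on V (\<lambda>x. Determinants.det (matrix (g' x)))"
    and B: "B \<in> sets borel" "B \<subseteq> V"
    and f[measurable]: "f \<in> borel_measurable borel"
  shows "(\<integral>\<^sup>+y\<in>g ` B. f y \<partial>lborel) = (\<integral>\<^sup>+x\<in>B. f (g x) * ennreal \<bar>Determinants.det (matrix (g' x))\<bar> \<partial>lborel)"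
proof -
  let ?D = "\<lambda>x. \<bar>Determinants.det (matrix (g' x))\<bar>"
  have contg: "continuous_on V g"
    by (rule has_derivative_continuous_on[OF has_derivative_at_withinI[OF der]])
  have img: "g ` T \<in> sets borel" if "T \<in> sets borel" "T \<subseteq> V" for T
    using borel_image_of_open_injection[OF V contg inj that] .
  have [measurable]: "V \<in> sets borel" using V by simp
  \<comment> \<open>Nothing is known about \<open>g\<close> outside \<open>V\<close>. Extension by
    zero gives globally Borel functions, and \<open>D\<close> vanishes wherever \<open>G\<close>
    takes the filler value.\<close>
  define G where "G x = (if x \<in> V then g x else 0)" for x
  define D where "D x = (if x \<in> V then ?D x else 0)" for x
  have [measurable]: "G \<in> borel_measurable borel"
    unfolding G_def using borel_measurable_continuous_on_if[OF _ contg, of "\<lambda>_. 0"] V by simp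
  have [measurable]: "D \<in> borel_measurable borel"
    unfolding D_def using borel_measurable_continuous_on_if[OF _ continuous_on_rabs[OF cont], of "\<lambda>_. 0"] V by simp
  have [measurable]: "g ` V \<in> sets borel" "g ` B \<in> sets borel"
    using img V B by auto
  let ?N = "distr (density lborel (\<lambda>x. ennreal (D x))) borel G"
  have eq: "?N = density lborel (indicator (g ` V))"
  proof (rule measure_eqI)
    fix E :: "(real^'d) set" assume "E \<in> sets ?N"
    then have [measurable]: "E \<in> sets borel" by simp
    have T: "G -` E \<inter> V \<in> sets borel" by measurable
    have "emeasure ?N E = (\<integral>\<^sup>+x\<in>G -` E. ennreal (D x) \<partial>lborel)"
      by (subst emeasure_distr; (subst emeasure_density)?) (auto intro: measurable_sets_borel[of G lborel])
    also have "\<dots> = (\<integral>\<^sup>+x\<in>G -` E \<inter> V. ennreal (?D x) \<partial>lborel)"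
      by (intro nn_integral_cong) (auto simp: D_def indicator_def)
    also have "\<dots> = emeasure lborel (g ` (G -` E \<inter> V))"
      using T img inj_on_subset[OF inj, of "G -` E \<inter> V"] der
      by (intro emeasure_differentiable_image[symmetric]) auto
    also have "g ` (G -` E \<inter> V) = g ` V \<inter> E" by (auto simp: G_def)
    also have "emeasure lborel \<dots> = emeasure (density lborel (indicator (g ` V))) E"
      by (simp add: emeasure_density flip: indicator_inter_arith)
    finally show "emeasure ?N E = emeasure (density lborel (indicator (g ` V))) E" .
  qed simp
  have "(\<integral>\<^sup>+y\<in>g ` B. f y \<partial>lborel) = (\<integral>\<^sup>+y. indicator (g ` V) y * (f y * indicator (g ` B) y) \<partial>lborel)"
    using B by (intro nn_integral_cong) (auto simp: indicator_def)
  also have "\<dots> = (\<integral>\<^sup>+y. f y * indicator (g ` B) y \<partial>?N)"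
    unfolding eq by (subst nn_integral_density) auto
  also have "\<dots> = (\<integral>\<^sup>+x. ennreal (D x) * (f (G x) * indicator (g ` B) (G x)) \<partial>lborel)"
    by (simp add: nn_integral_distr nn_integral_density)
  also have "\<dots> = (\<integral>\<^sup>+x\<in>B. f (g x) * ennreal (?D x) \<partial>lborel)"
    using B inj by (intro nn_integral_cong)
      (auto simp: D_def G_def indicator_def mult_ac inj_on_def)
  finally show ?thesis .
qed

section \<open>Existence and uniqueness of the measure of a top-degree form\<close>

text \<open>The differentiable left inverse \<open>r\<close> is part of the data: composed with any
  other parametrization it yields a differentiable transition map at once, in place of an inverse
  function theorem on \<open>M\<close>. Its derivative is taken within \<open>M\<close>, since only
  the values of \<open>r\<close> on \<open>M\<close> are meaningful.\<close>

definition smooth_chart ::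
    "'e::euclidean_space set \<Rightarrow> (real^'d::finite \<Rightarrow> 'e) \<Rightarrow> ('e \<Rightarrow> real^'d) \<Rightarrow> bool" where
  "smooth_chart M c r \<longleftrightarrow>
     local_parametrization M UNIV c \<and> (\<forall>x. r (c x) = x) \<and>
     (\<exists>r'. (\<forall>p\<in>range c. (r has_derivative r' p) (at p within M)) \<and>
           (\<forall>h. continuous_on (range c) (\<lambda>p. r' p h)))"

definition form_density ::
    "('e::euclidean_space \<Rightarrow> ('d::finite \<Rightarrow> 'e) \<Rightarrow> real) \<Rightarrow> (real^'d \<Rightarrow> 'e) \<Rightarrow> real^'d \<Rightarrow> real" where
  "form_density \<Omega> \<phi> x = \<bar>\<Omega> (\<phi> x) (\<lambda>i. frechet_derivative \<phi> (at x) (axis i 1))\<bar>"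

lemma linear_eq_sum_axis:
  fixes f :: "real^'d \<Rightarrow> 'b::real_vector"
  assumes "linear f"
  shows "f h = (\<Sum>k\<in>UNIV. h $ k *\<^sub>R f (axis k 1))"
proof -
  have "h = (\<Sum>k\<in>UNIV. h $ k *\<^sub>R axis k 1)"
    by (simp add: Finite_Cartesian_Product.vec_eq_iff axis_def if_distrib cong: if_cong)
  then have "f h = f (\<Sum>k\<in>UNIV. h $ k *\<^sub>R axis k 1)" by (rule arg_cong)
  then show ?thesis
    using assms by (simp add: linear_sum linear_scale)
qed

locale volume_form =
  fixes M :: "'e::euclidean_space set" and \<Omega> :: "'e \<Rightarrow> ('d::finite \<Rightarrow> 'e) \<Rightarrow> real"
  assumes closed_M: "closed M"
    and form_det: "\<And>p A w. p \<in> M \<Longrightarrow> \<Omega> p (\<lambda>i. \<Sum>k\<in>UNIV. A $ i $ k *\<^sub>R w k) = Determinants.det (A :: real^'d^'d) * \<Omega> p w"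
    and form_continuous: "\<And>(V :: (real^'d) set) f v. continuous_on V f \<Longrightarrow> (\<And>i. continuous_on V (v i)) \<Longrightarrow>
      continuous_on V (\<lambda>x. \<Omega> (f x) (\<lambda>i. v i x))"
begin

lemma borel_M [measurable]: "M \<in> sets borel"
  using closed_M by simp

lemma parametrization_subset:
  assumes "local_parametrization M V \<phi>" shows "\<phi> ` V \<subseteq> M"
  using assms by (auto simp: local_parametrization_def openin_open)

lemma parametrization_continuous:
  assumes "local_parametrization M V \<phi>" shows "continuous_on V \<phi>"
  using assms by (auto simp: local_parametrization_def homeomorphism_def)

lemma parametrization_inj:
  assumes "local_parametrization M V \<phi>" shows "inj_on \<phi> V"
proof -
  obtain h where "homeomorphism V (\<phi> ` V) \<phi> h" using assms by (auto simp: local_parametrization_def)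
  then show ?thesis by (intro inj_on_inverseI[of _ h]) (simp add: homeomorphism_apply1)
qed

lemma form_density_continuous:
  assumes "local_parametrization M V \<phi>"
  shows "continuous_on V (form_density \<Omega> \<phi>)"
  unfolding form_density_def[abs_def] using assms parametrization_continuous[OF assms]
  by (intro continuous_on_rabs form_continuous) (auto simp: local_parametrization_def)

lemma form_density_measurable:
  assumes "smooth_chart M c r"
  shows "form_density \<Omega> c \<in> borel_measurable borel"
  using form_density_continuous assms unfolding smooth_chart_def
  by (intro borel_measurable_continuous_onI) auto

lemma chart_measurable:
  assumes "smooth_chart M c r"
  shows "c \<in> borel \<rightarrow>\<^sub>M restrict_space borel M"
  using parametrization_continuous[of UNIV c] parametrization_subset[of UNIV c] assms
  by (intro measurable_restrict_space2 borel_measurable_continuous_onI) (auto simp: smooth_chart_def)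

lemma parametrization_image_measurable:
  assumes "local_parametrization M V \<phi>" "B \<in> sets borel" "B \<subseteq> V"
  shows "\<phi> ` B \<in> sets (restrict_space borel M)"
proof -
  obtain T where T: "open T" "\<phi> ` V = M \<inter> T"
    using assms(1) by (auto simp: local_parametrization_def openin_open)
  then have [measurable]: "\<phi> ` V \<in> sets borel" by simp
  obtain h where h: "homeomorphism V (\<phi> ` V) \<phi> h" using assms by (auto simp: local_parametrization_def)
  have "h \<in> borel_measurable (restrict_space borel (\<phi> ` V))"
    using h by (intro borel_measurable_continuous_on_restrict) (simp add: homeomorphism_def)
  from measurable_sets[OF this assms(2)] have "\<phi> ` B \<in> sets (restrict_space borel (\<phi> ` V))"
    using homeomorphism_image_eq_vimage[OF h assms(3)] by (simp add: space_restrict_space)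
  then have "\<phi> ` B \<in> sets borel" by (simp add: sets_restrict_space_iff)
  moreover have "\<phi> ` B \<subseteq> M" using parametrization_subset assms by blast
  ultimately show ?thesis by (simp add: sets_restrict_space_iff)
qed

lemma range_chart_measurable:
  assumes "smooth_chart M c r" shows "range c \<in> sets borel"
  using parametrization_image_measurable[of UNIV c UNIV] assms
  by (auto simp: smooth_chart_def sets_restrict_space_iff)

text \<open>With \<open>\<psi>\<close> equal to \<open>r\<close> after \<open>\<phi>\<close>, the
  chain rule factors the derivative of \<open>\<phi>\<close> through that of \<open>c\<close>, and
  \<open>form_det\<close> turns this into: density of \<open>\<phi>\<close> = density of
  \<open>c\<close> along \<open>\<psi>\<close> times the absolute Jacobian of \<open>\<psi>\<close>.
  The second claim is then the change of variables formula.\<close>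

lemma transition:
  assumes \<phi>: "local_parametrization M V \<phi>" and c: "smooth_chart M c r"
    and B: "B \<in> sets borel" "B \<subseteq> V" "\<phi> ` B \<subseteq> range c"
  shows "r ` \<phi> ` B \<in> sets borel" (is ?th1)
    and "(\<integral>\<^sup>+y\<in>r ` \<phi> ` B. ennreal (form_density \<Omega> c y) \<partial>lborel) =
      (\<integral>\<^sup>+x\<in>B. ennreal (form_density \<Omega> \<phi> x) \<partial>lborel)" (is ?th2)
proof -
  obtain r' where r': "\<And>p. p \<in> range c \<Longrightarrow> (r has_derivative r' p) (at p within M)"
    "\<And>h. continuous_on (range c) (\<lambda>p. r' p h)" and rc: "\<And>x. r (c x) = x"
    and cpar: "local_parametrization M UNIV c"
    using c unfolding smooth_chart_def by blast
  obtain T where T: "open T" "range c = M \<inter> T"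
    using cpar by (auto simp: local_parametrization_def openin_open)
  \<comment> \<open>\<open>\<phi>\<close> may leave the range of \<open>c\<close>; on the open set
    \<open>W\<close> it stays inside, and \<open>B\<close> lies in \<open>W\<close> by the last
    assumption.\<close>
  define W where "W = V \<inter> \<phi> -` T"
  note subM = parametrization_subset[OF \<phi>]
  have "open V" using \<phi> by (simp add: local_parametrization_def)
  then have W: "open W"
    unfolding W_def using parametrization_continuous[OF \<phi>] T by (simp add: continuous_open_preimage)
  have WV: "W \<subseteq> V" by (auto simp: W_def)
  have \<phi>W: "\<phi> ` W \<subseteq> range c" using T subM by (auto simp: W_def)
  have BW: "B \<subseteq> W" using B T by (auto simp: W_def)
  define \<psi> where "\<psi> = r \<circ> \<phi>"
  have c\<psi>: "c (\<psi> x) = \<phi> x" if "x \<in> W" for x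
  proof -
    have "\<phi> x \<in> range c" using \<phi>W that by blast
    then show ?thesis using rc by (auto simp: \<psi>_def)
  qed
  let ?d\<phi> = "\<lambda>x. frechet_derivative \<phi> (at x)" and ?dc = "\<lambda>x. frechet_derivative c (at x)"
  define \<psi>' where "\<psi>' x = r' (\<phi> x) \<circ> ?d\<phi> x" for x
  have d\<phi>: "(\<phi> has_derivative ?d\<phi> x) (at x)" if "x \<in> W" for x
    using \<phi> that WV frechet_derivative_works by (auto simp: local_parametrization_def)
  have dc: "(c has_derivative ?dc x) (at x)" for x
    using cpar frechet_derivative_works by (auto simp: local_parametrization_def)
  have d\<psi>: "(\<psi> has_derivative \<psi>' x) (at x)" if "x \<in> W" for x
  proof -
    have "(\<phi> has_derivative ?d\<phi> x) (at x within W)" using d\<phi>[OF that] has_derivative_at_withinI by blast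
    moreover have "(r has_derivative r' (\<phi> x)) (at (\<phi> x) within \<phi> ` W)"
      using r'(1)[of "\<phi> x"] \<phi>W that T by (intro has_derivative_subset[OF r'(1)]) auto
    ultimately have "(\<psi> has_derivative \<psi>' x) (at x within W)"
      unfolding \<psi>_def \<psi>'_def by (rule diff_chain_within)
    then show ?thesis by (simp add: at_within_open[OF that W])
  qed
  have lin: "linear (\<psi>' x)" if "x \<in> W" for x
    using d\<psi>[OF that] has_derivative_linear by blast
  have chain: "?d\<phi> x = ?dc (\<psi> x) \<circ> \<psi>' x" if "x \<in> W" for x
  proof -
    have "((c \<circ> \<psi>) has_derivative ?dc (\<psi> x) \<circ> \<psi>' x) (at x)"
      by (intro diff_chain_at d\<psi> dc that)
    then have "(\<phi> has_derivative ?dc (\<psi> x) \<circ> \<psi>' x) (at x)"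
      by (rule has_derivative_transform_within_open[OF _ W that]) (simp add: c\<psi>)
    with d\<phi>[OF that] show ?thesis by (rule has_derivative_unique)
  qed
  have dens: "form_density \<Omega> \<phi> x = form_density \<Omega> c (\<psi> x) * \<bar>Determinants.det (matrix (\<psi>' x))\<bar>" if x: "x \<in> W" for x
  proof -
    \<comment> \<open>\<open>form_det\<close> lists the coefficients of the new vectors in rows,
      while \<open>matrix\<close> stores them in columns; the determinant does not see the
      transposition.\<close>
    have "?d\<phi> x (axis i 1) = (\<Sum>k\<in>UNIV. Finite_Cartesian_Product.transpose (matrix (\<psi>' x)) $ i $ k *\<^sub>R ?dc (\<psi> x) (axis k 1))" for i
      unfolding chain[OF x] o_def
      by (subst linear_eq_sum_axis[OF has_derivative_linear[OF dc]])
        (simp add: Finite_Cartesian_Product.transpose_def matrix_def)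
    then show ?thesis
      using form_det[of "\<phi> x" "Finite_Cartesian_Product.transpose (matrix (\<psi>' x))"] x WV subM
      by (simp add: form_density_def c\<psi> det_transpose abs_mult subset_iff)
  qed
  have inj: "inj_on \<psi> W"
  proof (rule inj_onI)
    fix x y assume "x \<in> W" "y \<in> W" "\<psi> x = \<psi> y"
    then have "\<phi> x = \<phi> y" using c\<psi> by metis
    then show "x = y"
      using parametrization_inj[OF \<phi>] WV \<open>x \<in> W\<close> \<open>y \<in> W\<close> by (auto dest: inj_onD)
  qed
  have "continuous_on W \<psi>"
    by (rule has_derivative_continuous_on[OF has_derivative_at_withinI[OF d\<psi>]])
  then show ?th1
    using borel_image_of_open_injection[OF W _ inj B(1) BW] by (simp add: \<psi>_def image_comp)
  have cdet: "continuous_on W (\<lambda>x. Determinants.det (matrix (\<psi>' x)))"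
  proof -
    have "continuous_on W (\<lambda>x. \<psi>' x h)" for h
    proof -
      \<comment> \<open>Continuity of \<open>r'\<close> is known for one fixed direction at a time,
        but here point and direction both vary. Expanding the direction in the standard basis
        separates the two.\<close>
      have *: "\<psi>' x h = (\<Sum>b\<in>Basis. (?d\<phi> x h \<bullet> b) *\<^sub>R r' (\<phi> x) b)" if "x \<in> W" for x
      proof -
        have "linear (r' (\<phi> x))" using r'(1) \<phi>W that has_derivative_linear by blast
        then have "r' (\<phi> x) (\<Sum>b\<in>Basis. (?d\<phi> x h \<bullet> b) *\<^sub>R b) = (\<Sum>b\<in>Basis. (?d\<phi> x h \<bullet> b) *\<^sub>R r' (\<phi> x) b)"
          by (simp add: linear_sum linear_scale)
        then show ?thesis by (simp add: \<psi>'_def euclidean_representation)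
      qed
      have "continuous_on W (\<lambda>x. r' (\<phi> x) b)" for b
        using \<phi>W continuous_on_subset[OF parametrization_continuous[OF \<phi>] WV]
        by (intro continuous_on_compose2[OF r'(2)]) auto
      moreover have "continuous_on W (\<lambda>x. ?d\<phi> x h)"
        using \<phi> by (intro continuous_on_subset[OF _ WV]) (simp add: local_parametrization_def)
      ultimately have "continuous_on W (\<lambda>x. \<Sum>b\<in>Basis. (?d\<phi> x h \<bullet> b) *\<^sub>R r' (\<phi> x) b)"
        by (intro continuous_intros)
      then show ?thesis using * by (simp cong: continuous_on_cong)
    qed
    then have "continuous_on W (\<lambda>x. \<psi>' x h $ k)" for h k
      by (intro continuous_intros)
    then show ?thesis
      unfolding Determinants.det_def matrix_def vec_lambda_beta
      by (intro continuous_on_sum continuous_on_mult continuous_on_const continuous_on_prod)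
  qed
  have [measurable]: "form_density \<Omega> c \<in> borel_measurable borel"
    using form_density_measurable[OF c] .
  have "(\<integral>\<^sup>+y\<in>\<psi> ` B. ennreal (form_density \<Omega> c y) \<partial>lborel) =
     (\<integral>\<^sup>+x\<in>B. ennreal (form_density \<Omega> c (\<psi> x)) * ennreal \<bar>Determinants.det (matrix (\<psi>' x))\<bar> \<partial>lborel)"
    by (rule nn_integral_differentiable_image[OF W d\<psi> inj cdet B(1) BW]) auto
  also have "\<dots> = (\<integral>\<^sup>+x\<in>B. ennreal (form_density \<Omega> \<phi> x) \<partial>lborel)"
    using dens BW by (intro nn_integral_cong) (auto simp: indicator_def ennreal_mult form_density_def)
  finally show ?th2 by (simp add: \<psi>_def image_comp)
qed

end

locale volume_form_atlas = volume_form M \<Omega>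
  for M :: "'e::euclidean_space set" and \<Omega> :: "'e \<Rightarrow> ('d::finite \<Rightarrow> 'e) \<Rightarrow> real" +
  fixes c :: "nat \<Rightarrow> real^'d \<Rightarrow> 'e" and r :: "nat \<Rightarrow> 'e \<Rightarrow> real^'d"
  assumes charts: "\<And>n. smooth_chart M (c n) (r n)" and cover: "M \<subseteq> (\<Union>n. range (c n))"

begin

text \<open>Disjointification by first occurrence: each point is assigned to the first chart that
  covers it, so sums over charts count it once. Repeated charts get empty pieces, hence an atlas may
  be enumerated with repetitions.\<close>

definition piece :: "nat \<Rightarrow> 'e set" where
  "piece n = range (c n) - (\<Union>m<n. range (c m))"

lemma piece_measurable [measurable]: "piece n \<in> sets borel"
  unfolding piece_def using range_chart_measurable[OF charts] by auto

lemma piece_subset: "piece n \<subseteq> range (c n)"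
  by (auto simp: piece_def)

lemma disjoint_piece: "disjoint_family piece"
  unfolding disjoint_family_on_def
proof (intro ballI impI)
  fix m n :: nat assume "m \<noteq> n"
  then consider "m < n" | "n < m" by linarith
  then show "piece m \<inter> piece n = {}" by cases (auto simp: piece_def)
qed

lemma UN_piece: "M = (\<Union>n. piece n)"
proof -
  have "\<exists>n. p \<in> piece n" if p: "p \<in> M" for p
  proof -
    obtain k where "p \<in> range (c k)" using cover p by blast
    define n where "n = (LEAST n. p \<in> range (c n))"
    have "p \<in> range (c n)" unfolding n_def using \<open>p \<in> range (c k)\<close> by (rule LeastI)
    moreover have "p \<notin> range (c m)" if "m < n" for m
      using not_less_Least that unfolding n_def by blast
    ultimately show ?thesis by (auto simp: piece_def)
  qed
  moreover have "piece n \<subseteq> M" for n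
    using piece_subset parametrization_subset[of UNIV "c n"] charts by (auto simp: smooth_chart_def)
  ultimately show ?thesis by blast
qed

lemma chart_parametrization: "local_parametrization M UNIV (c n)"
  using charts by (simp add: smooth_chart_def)

lemma chart_inverse [simp]: "r n (c n x) = x"
  using charts[of n] by (simp add: smooth_chart_def)

lemma piece_image_measurable:
  assumes \<phi>: "local_parametrization M V \<phi>" and B: "B \<in> sets borel" "B \<subseteq> V"
  shows "B \<inter> \<phi> -` piece n \<in> sets borel"
proof -
  have "V \<in> sets borel" using \<phi> by (simp add: local_parametrization_def)
  moreover have "\<phi> \<in> borel_measurable (restrict_space borel V)"
    using parametrization_continuous[OF \<phi>] by (rule borel_measurable_continuous_on_restrict)
  from measurable_sets[OF this piece_measurable]
  have "\<phi> -` piece n \<inter> V \<in> sets (restrict_space borel V)" by (simp add: space_restrict_space)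
  ultimately have "\<phi> -` piece n \<inter> V \<in> sets borel" by (simp add: sets_restrict_space_iff)
  then have "B \<inter> (\<phi> -` piece n \<inter> V) \<in> sets borel" using B(1) by (rule sets.Int[rotated])
  moreover have "B \<inter> (\<phi> -` piece n \<inter> V) = B \<inter> \<phi> -` piece n" using B(2) by blast
  ultimately show ?thesis by simp
qed

text \<open>The right-hand side does not mention the atlas. This is the consistency that makes
  gluing over the pieces well defined.\<close>

lemma sum_pieces:
  assumes \<phi>: "local_parametrization M V \<phi>" and B: "B \<in> sets borel" "B \<subseteq> V"
  shows "(\<Sum>n. \<integral>\<^sup>+x\<in>r n ` \<phi> ` (B \<inter> \<phi> -` piece n). ennreal (form_density \<Omega> (c n) x) \<partial>lborel)
    = (\<integral>\<^sup>+x\<in>B. ennreal (form_density \<Omega> \<phi> x) \<partial>lborel)"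
proof -
  define D where "D x = (if x \<in> V then form_density \<Omega> \<phi> x else 0)" for x
  have "V \<in> sets borel" using \<phi> by (simp add: local_parametrization_def)
  then have [measurable]: "D \<in> borel_measurable borel"
    unfolding D_def using borel_measurable_continuous_on_if[OF _ form_density_continuous[OF \<phi>], of "\<lambda>_. 0"] by simp
  have em: "(\<integral>\<^sup>+x\<in>A. ennreal (form_density \<Omega> \<phi> x) \<partial>lborel) = emeasure (density lborel D) A"
    if "A \<in> sets borel" "A \<subseteq> V" for A
  proof -
    have "emeasure (density lborel D) A = (\<integral>\<^sup>+x\<in>A. ennreal (D x) \<partial>lborel)"
      using that by (intro emeasure_density) auto
    also have "\<dots> = (\<integral>\<^sup>+x\<in>A. ennreal (form_density \<Omega> \<phi> x) \<partial>lborel)"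
      using that by (intro nn_integral_cong) (auto simp: D_def indicator_def)
    finally show ?thesis by simp
  qed
  let ?B = "\<lambda>n. B \<inter> \<phi> -` piece n"
  have "(\<integral>\<^sup>+x\<in>r n ` \<phi> ` ?B n. ennreal (form_density \<Omega> (c n) x) \<partial>lborel) = emeasure (density lborel D) (?B n)" for n
  proof -
    have m: "?B n \<in> sets borel" using piece_image_measurable[OF \<phi> B] .
    moreover have "?B n \<subseteq> V" using B by blast
    moreover have "\<phi> ` ?B n \<subseteq> range (c n)" using piece_subset by blast
    ultimately show ?thesis
      using transition(2)[OF \<phi> charts, of "?B n" n] em by simp
  qed
  moreover have "(\<Sum>n. emeasure (density lborel D) (?B n)) = emeasure (density lborel D) (\<Union>n. ?B n)"
    using disjoint_piece piece_image_measurable[OF \<phi> B]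
    by (intro suminf_emeasure) (auto simp: disjoint_family_on_def)
  moreover have "(\<Union>n. ?B n) = B"
    using UN_piece parametrization_subset[OF \<phi>] B(2) by blast
  ultimately show ?thesis using em[OF B] by simp
qed

text \<open>A form measure must be tested on every parametrization; \<open>transition\<close> and
  \<open>sum_pieces\<close> reduce this to the charts of one atlas. Existence, Haar invariance and
  the product formula for the Liouville measure are all obtained through this criterion.\<close>

lemma is_form_measureI:
  assumes \<mu>: "space \<mu> = M" "sets \<mu> = sets (restrict_space borel M)"
    and eq: "\<And>n B. B \<in> sets borel \<Longrightarrow>
      emeasure \<mu> (c n ` B) = (\<integral>\<^sup>+x\<in>B. ennreal (form_density \<Omega> (c n) x) \<partial>lborel)"
  shows "is_form_measure M \<Omega> \<mu>"
  unfolding is_form_measure_def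
proof (intro conjI allI impI ballI \<mu>)
  fix V and \<phi> :: "real^'d \<Rightarrow> 'e" and B
  assume \<phi>: "local_parametrization M V \<phi>" and B: "B \<in> sets borel" "B \<subseteq> V"
  let ?B = "\<lambda>n. B \<inter> \<phi> -` piece n"
  have mB: "?B n \<in> sets borel" for n using piece_image_measurable[OF \<phi> B] .
  have sub: "?B n \<subseteq> V" "\<phi> ` ?B n \<subseteq> range (c n)" for n
    using B piece_subset by blast+
  have "emeasure \<mu> (\<phi> ` ?B n) = (\<integral>\<^sup>+x\<in>r n ` \<phi> ` ?B n. ennreal (form_density \<Omega> (c n) x) \<partial>lborel)" for n
  proof -
    have "c n ` r n ` \<phi> ` ?B n = \<phi> ` ?B n"
    proof -
      have "c n (r n y) = y" if "y \<in> \<phi> ` ?B n" for y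
      proof -
        have "y \<in> range (c n)" using sub that by blast
        then show ?thesis by auto
      qed
      then show ?thesis by (simp add: image_comp)
    qed
    moreover have "emeasure \<mu> (c n ` r n ` \<phi> ` ?B n) = (\<integral>\<^sup>+x\<in>r n ` \<phi> ` ?B n. ennreal (form_density \<Omega> (c n) x) \<partial>lborel)"
      by (rule eq[OF transition(1)[OF \<phi> charts mB sub]])
    ultimately show ?thesis by simp
  qed
  then have "(\<Sum>n. emeasure \<mu> (\<phi> ` ?B n)) = (\<integral>\<^sup>+x\<in>B. ennreal (form_density \<Omega> \<phi> x) \<partial>lborel)"
    using sum_pieces[OF \<phi> B] by simp
  moreover have "disjoint_family (\<lambda>n. \<phi> ` ?B n)"
    unfolding disjoint_family_on_def
  proof (intro ballI impI)
    fix m n :: nat assume "m \<noteq> n"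
    then have "piece m \<inter> piece n = {}" using disjoint_piece by (simp add: disjoint_family_on_def)
    moreover have "\<phi> ` ?B k \<subseteq> piece k" for k by auto
    ultimately show "\<phi> ` ?B m \<inter> \<phi> ` ?B n = {}" by (metis Int_mono subset_empty)
  qed
  then have "(\<Sum>n. emeasure \<mu> (\<phi> ` ?B n)) = emeasure \<mu> (\<Union>n. \<phi> ` ?B n)"
    using parametrization_image_measurable[OF \<phi> mB sub(1)] unfolding \<mu>(2)[symmetric]
    by (intro suminf_emeasure) auto
  moreover have "(\<Union>n. \<phi> ` ?B n) = \<phi> ` B"
    using UN_piece parametrization_subset[OF \<phi>] B(2) by blast
  ultimately show "emeasure \<mu> (\<phi> ` B) =
      (\<integral>\<^sup>+x\<in>B. ennreal \<bar>\<Omega> (\<phi> x) (\<lambda>i. frechet_derivative \<phi> (at x) (axis i 1))\<bar> \<partial>lborel)"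
    by (simp add: form_density_def)
qed

lemma is_form_measure_chart:
  assumes "is_form_measure M \<Omega> \<mu>" "smooth_chart M \<phi> s" "B \<in> sets borel"
  shows "emeasure \<mu> (\<phi> ` B) = (\<integral>\<^sup>+x\<in>B. ennreal (form_density \<Omega> \<phi> x) \<partial>lborel)"
proof -
  have "local_parametrization M UNIV \<phi>" using assms(2) by (simp add: smooth_chart_def)
  then show ?thesis using assms(1,3) unfolding is_form_measure_def form_density_def by simp
qed

lemma emeasure_pieces:
  assumes \<mu>: "sets \<mu> = sets (restrict_space borel M)" and E: "E \<in> sets \<mu>"
  shows "emeasure \<mu> E = (\<Sum>n. emeasure \<mu> (c n ` (c n -` (E \<inter> piece n))))"
    and "c n -` (E \<inter> piece n) \<in> sets borel"
proof -
  have E': "E \<in> sets borel" "E \<subseteq> M" using E by (auto simp: \<mu> sets_restrict_space_iff)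
  have m: "c n -` (E \<inter> piece n) \<in> sets borel" for n
    using measurable_sets[OF borel_measurable_continuous_onI[OF parametrization_continuous[OF chart_parametrization]], of "E \<inter> piece n" n] E'
    by simp
  then show "c n -` (E \<inter> piece n) \<in> sets borel" .
  have im: "c n ` (c n -` (E \<inter> piece n)) = E \<inter> piece n" for n
    unfolding image_vimage_eq using piece_subset[of n] by blast
  have "(\<Sum>n. emeasure \<mu> (E \<inter> piece n)) = emeasure \<mu> (\<Union>n. E \<inter> piece n)"
    using disjoint_piece E' by (intro suminf_emeasure) (auto simp: disjoint_family_on_def \<mu> sets_restrict_space_iff)
  moreover have "(\<Union>n. E \<inter> piece n) = E" using UN_piece E' by blast
  ultimately show "emeasure \<mu> E = (\<Sum>n. emeasure \<mu> (c n ` (c n -` (E \<inter> piece n))))"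
    by (simp only: im)
qed

text \<open>Every measurable set is a countable disjoint union of chart images of Borel sets, and
  there the value is prescribed.\<close>

lemma is_form_measure_unique:
  assumes "is_form_measure M \<Omega> \<mu>" "is_form_measure M \<Omega> \<nu>"
  shows "\<mu> = \<nu>"
proof (rule measure_eqI)
  have s: "sets \<mu> = sets (restrict_space borel M)" "sets \<nu> = sets (restrict_space borel M)"
    using assms by (auto simp: is_form_measure_def)
  then show "sets \<mu> = sets \<nu>" by simp
  fix E assume E: "E \<in> sets \<mu>"
  then have "E \<in> sets \<nu>" using s by simp
  have "emeasure \<mu> E = (\<Sum>n. emeasure \<mu> (c n ` (c n -` (E \<inter> piece n))))"
    by (rule emeasure_pieces(1)[OF s(1) E])
  also have "\<dots> = (\<Sum>n. emeasure \<nu> (c n ` (c n -` (E \<inter> piece n))))"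
    by (simp only: is_form_measure_chart[OF assms(1) charts emeasure_pieces(2)[OF s(1) E]]
        is_form_measure_chart[OF assms(2) charts emeasure_pieces(2)[OF s(1) E]])
  also have "\<dots> = emeasure \<nu> E"
    by (rule emeasure_pieces(1)[OF s(2) \<open>E \<in> sets \<nu>\<close>, symmetric])
  finally show "emeasure \<mu> E = emeasure \<nu> E" .
qed

lemma form_measure_eqI: "is_form_measure M \<Omega> \<mu> \<Longrightarrow> form_measure M \<Omega> = \<mu>"
  unfolding form_measure_def by (rule the_equality) (auto intro: is_form_measure_unique)

text \<open>The charts are laid side by side on the product of the naturals with the coordinate
  space. On copy \<open>n\<close> the density is cut down to \<open>piece n\<close>, and the result
  is pushed forward to \<open>M\<close>.\<close>

lemma is_form_measure_exists: "\<exists>\<mu>. is_form_measure M \<Omega> \<mu>"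
proof -
  let ?N = "count_space (UNIV :: nat set) \<Otimes>\<^sub>M (lborel :: (real^'d) measure)"
  define w where "w = (\<lambda>(n, x). ennreal (form_density \<Omega> (c n) x) * indicator (piece n) (c n x))"
  define \<mu> where "\<mu> = distr (density ?N w) (restrict_space borel M) (\<lambda>(n, x). c n x)"
  have cm: "c n \<in> borel \<rightarrow>\<^sub>M restrict_space borel M" for n by (rule chart_measurable[OF charts])
  have cm' [measurable]: "c n \<in> borel \<rightarrow>\<^sub>M borel" for n
    using parametrization_continuous[OF chart_parametrization] by (rule borel_measurable_continuous_onI)
  have [measurable]: "form_density \<Omega> (c n) \<in> borel_measurable borel" for n
    by (rule form_density_measurable[OF charts])
  have mc: "(\<lambda>(n, x). c n x) \<in> ?N \<rightarrow>\<^sub>M restrict_space borel M"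
    using cm by (intro measurable_pair_measure_countable1) auto
  have [measurable]: "w \<in> borel_measurable ?N"
    unfolding w_def by (intro measurable_pair_measure_countable1) auto
  have em: "emeasure \<mu> E = (\<Sum>n. \<integral>\<^sup>+x. ennreal (form_density \<Omega> (c n) x) * indicator (E \<inter> piece n) (c n x) \<partial>lborel)"
    if E: "E \<in> sets (restrict_space borel M)" for E
  proof -
    have [measurable]: "E \<in> sets borel" using E by (simp add: sets_restrict_space_iff)
    have m: "(\<lambda>(n, x). c n x) -` E \<inter> space ?N \<in> sets ?N"
      by (rule measurable_sets[OF mc E])
    have "emeasure \<mu> E = (\<integral>\<^sup>+z. w z * indicator ((\<lambda>(n, x). c n x) -` E \<inter> space ?N) z \<partial>?N)"
      unfolding \<mu>_def using mc E m by (simp add: emeasure_distr emeasure_density)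
    also have "\<dots> = (\<integral>\<^sup>+n. \<integral>\<^sup>+x. w (n, x) * indicator ((\<lambda>(n, x). c n x) -` E \<inter> space ?N) (n, x) \<partial>lborel \<partial>count_space UNIV)"
      using m by (subst lborel.nn_integral_fst[symmetric]) auto
    also have "\<dots> = (\<Sum>n. \<integral>\<^sup>+x. w (n, x) * indicator ((\<lambda>(n, x). c n x) -` E \<inter> space ?N) (n, x) \<partial>lborel)"
      by (rule nn_integral_count_space_nat)
    also have "\<dots> = (\<Sum>n. \<integral>\<^sup>+x. ennreal (form_density \<Omega> (c n) x) * indicator (E \<inter> piece n) (c n x) \<partial>lborel)"
      by (intro suminf_cong nn_integral_cong) (auto simp: w_def indicator_def space_pair_measure)
    finally show ?thesis .
  qed
  have "is_form_measure M \<Omega> \<mu>"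
  proof (rule is_form_measureI)
    show "space \<mu> = M" by (simp add: \<mu>_def space_restrict_space)
    show "sets \<mu> = sets (restrict_space borel M)" by (simp add: \<mu>_def)
    fix m and B :: "(real^'d) set" assume B: "B \<in> sets borel"
    have "(\<integral>\<^sup>+x. ennreal (form_density \<Omega> (c n) x) * indicator (c m ` B \<inter> piece n) (c n x) \<partial>lborel)
      = (\<integral>\<^sup>+x\<in>r n ` c m ` (B \<inter> c m -` piece n). ennreal (form_density \<Omega> (c n) x) \<partial>lborel)" for n
    proof (intro nn_integral_cong)
      fix x
      have "c n x \<in> c m ` B \<inter> piece n \<longleftrightarrow> x \<in> r n ` c m ` (B \<inter> c m -` piece n)"
      proof
        assume "c n x \<in> c m ` B \<inter> piece n"
        then obtain y where "y \<in> B" "c n x = c m y" "c m y \<in> piece n" by auto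
        then show "x \<in> r n ` c m ` (B \<inter> c m -` piece n)"
          using chart_inverse[of n x] by (intro image_eqI[of _ _ "c m y"]) auto
      next
        assume "x \<in> r n ` c m ` (B \<inter> c m -` piece n)"
        then obtain y where y: "y \<in> B" "c m y \<in> piece n" "x = r n (c m y)" by auto
        then obtain z where "c m y = c n z" using piece_subset[of n] by (auto simp: subset_iff)
        then have "c n x = c m y" using y by simp
        then show "c n x \<in> c m ` B \<inter> piece n" using y by simp
      qed
      then show "ennreal (form_density \<Omega> (c n) x) * indicator (c m ` B \<inter> piece n) (c n x)
        = ennreal (form_density \<Omega> (c n) x) * indicator (r n ` c m ` (B \<inter> c m -` piece n)) x"
        by (simp add: indicator_def)
    qed
    then show "emeasure \<mu> (c m ` B) = (\<integral>\<^sup>+x\<in>B. ennreal (form_density \<Omega> (c m) x) \<partial>lborel)"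
      using em[OF parametrization_image_measurable[OF chart_parametrization B subset_UNIV]]
        sum_pieces[OF chart_parametrization B subset_UNIV] by simp
  qed
  then show ?thesis by blast
qed

end

section \<open>Hermitian matrices in coordinates\<close>

type_synonym 'n cmat = "((complex, 'n) Finite_Cartesian_Product.vec, 'n) Finite_Cartesian_Product.vec"
type_synonym 'n hcoord = "(real, 'n \<times> 'n) Finite_Cartesian_Product.vec"

lemma vec_eqI: "(\<And>i. x $ i = y $ i) \<Longrightarrow> x = y"
  by (simp add: Finite_Cartesian_Product.vec_eq_iff)

lemma matrix_eqI: "(\<And>i j. A $ i $ j = B $ i $ j) \<Longrightarrow> A = B"
  by (simp add: Finite_Cartesian_Product.vec_eq_iff)

lemma bounded_bilinear_matrix_mult:
  "bounded_bilinear ((**) :: complex^'n^'m \<Rightarrow> complex^'p^'n \<Rightarrow> complex^'p^'m)"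
proof -
  have "bilinear ((**) :: complex^'n^'m \<Rightarrow> complex^'p^'n \<Rightarrow> complex^'p^'m)"
    unfolding bilinear_def
    by (intro conjI allI linearI matrix_eqI)
      (simp_all add: matrix_matrix_mult_def sum.distrib distrib_left distrib_right scaleR_sum_right)
  then show ?thesis by (rule bilinear_conv_bounded_bilinear[THEN iffD1])
qed

interpretation matrix_mult: bounded_bilinear "(**) :: complex^'n^'m \<Rightarrow> complex^'p^'n \<Rightarrow> complex^'p^'m"
  by (rule bounded_bilinear_matrix_mult)

lemmas has_derivative_matrix_mult [derivative_intros] = matrix_mult.FDERIV
lemmas continuous_on_matrix_mult [continuous_intros] = matrix_mult.continuous_on

lemma adjoint_matrix_nth [simp]: "adjoint_matrix A $ i $ j = cnj (A $ j $ i)"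
  by (simp add: adjoint_matrix_def)

lemma adjoint_adjoint_matrix [simp]: "adjoint_matrix (adjoint_matrix A) = A"
  by (intro matrix_eqI) simp

lemma adjoint_matrix_mult: "adjoint_matrix (A ** B) = adjoint_matrix B ** adjoint_matrix A"
  by (intro matrix_eqI) (simp add: matrix_matrix_mult_def mult.commute)

lemma linear_adjoint_matrix: "linear adjoint_matrix"
  by (intro linearI matrix_eqI) simp_all

lemma bounded_linear_adjoint_matrix: "bounded_linear adjoint_matrix"
  using linear_adjoint_matrix by (rule linear_conv_bounded_linear[THEN iffD1])

lemmas adjoint_matrix_add = linear_add[OF linear_adjoint_matrix]
  and adjoint_matrix_diff = linear_diff[OF linear_adjoint_matrix]
  and adjoint_matrix_scaleR = linear_scale[OF linear_adjoint_matrix]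

lemma adjoint_mat: "adjoint_matrix (mat c) = mat (cnj c)"
  by (intro matrix_eqI) (simp add: Finite_Cartesian_Product.mat_def)

lemma mat_mult_commute: "mat c ** A = A ** mat (c :: complex)"
  by (intro matrix_eqI)
    (simp add: matrix_matrix_mult_def Finite_Cartesian_Product.mat_def if_distrib if_distribR mult.commute cong: if_cong)

lemma mat_mult_nth: "(mat c ** A) $ i $ j = (c :: complex) * A $ i $ j"
  by (simp add: matrix_matrix_mult_def Finite_Cartesian_Product.mat_def if_distrib if_distribR cong: if_cong)

lemma mat_mult_mat: "mat c ** mat d = mat (c * d :: complex)"
  by (intro matrix_eqI) (simp add: mat_mult_nth, simp add: Finite_Cartesian_Product.mat_def)

text \<open>For i < j the position (i, j) holds the real part and (j, i) the imaginary part of the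
  upper entry, both multiplied by sqrt 2. With this factor \<open>hm\<close> is an isometry onto the
  Hermitian matrices with the Frobenius norm. The index pairs are those over which the top-degree
  form in \<open>liouville_measure\<close> is indexed.\<close>

definition hm :: "real^('n::{finite,wellorder} \<times> 'n::_) \<Rightarrow> complex^'n::_^'n::_" where
  "hm x = (\<chi> i j. if i = j then complex_of_real (x $ (i, i))
     else if i < j then Complex (x $ (i, j)) (x $ (j, i)) / sqrt 2
     else Complex (x $ (j, i)) (- x $ (i, j)) / sqrt 2)"

definition hermitian_coords :: "complex^'n::{finite,wellorder}^'n::_ \<Rightarrow> real^('n::_ \<times> 'n::_)" where
  "hermitian_coords A = (\<chi> p. case p of (i, j) \<Rightarrow>
     if i = j then Re (A $ i $ i) else if i < j then sqrt 2 * Re (A $ i $ j) else sqrt 2 * Im (A $ j $ i))"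

lemma linear_hm: "linear hm"
  by (intro linearI matrix_eqI) (simp_all add: hm_def complex_eq_iff add_divide_distrib diff_divide_distrib)

lemma bounded_linear_hm: "bounded_linear hm"
  using linear_hm by (rule linear_conv_bounded_linear[THEN iffD1])

lemmas hm_add = linear_add[OF linear_hm]
  and hm_neg = linear_neg[OF linear_hm]
  and hm_scaleR = linear_scale[OF linear_hm]

lemma linear_hermitian_coords: "linear hermitian_coords"
  by (intro linearI vec_eqI) (auto simp: hermitian_coords_def algebra_simps split: prod.splits)

lemma bounded_linear_hermitian_coords: "bounded_linear hermitian_coords"
  using linear_hermitian_coords by (rule linear_conv_bounded_linear[THEN iffD1])

lemma adjoint_hm [simp]: "adjoint_matrix (hm x) = hm x"
  by (intro matrix_eqI) (auto simp: hm_def complex_eq_iff)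

lemma hm_hermitian: "hm x \<in> hermitian_matrices"
  by (simp add: hermitian_matrices_def)

lemma hermitian_coords_hm [simp]: "hermitian_coords (hm x) = x"
proof (rule vec_eqI)
  fix p :: "'a \<times> 'a"
  obtain i j where p: "p = (i, j)" by force
  consider "i = j" | "i < j" | "j < i" by fastforce
  then show "hermitian_coords (hm x) $ p = x $ p"
    by cases (simp_all add: p hermitian_coords_def hm_def)
qed

lemma hm_hermitian_coords:
  fixes A :: "complex^'a::{finite,wellorder}^'a::_"
  assumes "A \<in> hermitian_matrices" shows "hm (hermitian_coords A) = A"
proof (rule matrix_eqI)
  fix i j :: 'a
  have *: "A $ i $ j = cnj (A $ j $ i)"
    using assms unfolding hermitian_matrices_def by (metis (mono_tags) adjoint_matrix_nth mem_Collect_eq)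
  consider "i = j" | "i < j" | "j < i" by fastforce
  then show "hm (hermitian_coords A) $ i $ j = A $ i $ j"
  proof cases
    case 1
    then have "Im (A $ i $ i) = 0" using * by (simp add: complex_eq_iff)
    with 1 show ?thesis by (simp add: hermitian_coords_def hm_def complex_eq_iff)
  next
    case 2
    then show ?thesis by (simp add: hermitian_coords_def hm_def complex_eq_iff less_imp_neq dual_order.asym not_sym[OF less_imp_neq])
  next
    case 3
    then show ?thesis using *
      by (simp add: hermitian_coords_def hm_def complex_eq_iff less_imp_neq dual_order.asym not_sym[OF less_imp_neq])
  qed
qed

lemma inj_hm: "inj hm"
  by (rule inj_on_inverseI[of _ hermitian_coords]) simp

lemma norm_matrix_power2: "(norm (A :: complex^'n^'m))\<^sup>2 = (\<Sum>i\<in>UNIV. \<Sum>j\<in>UNIV. (cmod (A $ i $ j))\<^sup>2)"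
  by (simp add: norm_vec_def L2_set_def sum_nonneg)

lemma norm_hm [simp]:
  fixes x :: "real^('n::{finite,wellorder} \<times> 'n::_)"
  shows "norm (hm x) = norm x"
proof -
  have e: "(cmod (hm x $ i $ j))\<^sup>2 = ((x $ (i, j))\<^sup>2 + (x $ (j, i))\<^sup>2) / 2" for i j
    by (auto simp: hm_def norm_divide power_divide cmod_power2)
  have "(norm (hm x))\<^sup>2 = (\<Sum>i\<in>UNIV. \<Sum>j\<in>UNIV. ((x $ (i, j))\<^sup>2 + (x $ (j, i))\<^sup>2) / 2)"
    by (simp add: norm_matrix_power2 e)
  also have "\<dots> = ((\<Sum>i\<in>UNIV. \<Sum>j\<in>UNIV. (x $ (i, j))\<^sup>2) + (\<Sum>i\<in>UNIV. \<Sum>j\<in>UNIV. (x $ (j, i))\<^sup>2)) / 2"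
    by (simp add: sum.distrib flip: sum_divide_distrib)
  also have "(\<Sum>i\<in>UNIV. \<Sum>j\<in>UNIV. (x $ (j, i))\<^sup>2) = (\<Sum>i\<in>UNIV. \<Sum>j\<in>UNIV. (x $ (i, j))\<^sup>2)"
    by (rule sum.swap)
  also have "(\<Sum>i\<in>UNIV. \<Sum>j\<in>UNIV. (x $ (i, j))\<^sup>2) = (\<Sum>p\<in>UNIV. (x $ p)\<^sup>2)"
    by (simp add: sum.cartesian_product)
  finally have "(norm (hm x))\<^sup>2 = (norm x)\<^sup>2"
    by (simp add: norm_vec_def L2_set_def sum_nonneg)
  then show ?thesis by (simp add: power2_eq_iff_nonneg)
qed

lemma trace_matrix_mult_commute: "trace (A ** B) = trace (B ** (A :: complex^'n^'n))"
  by (simp add: trace_def matrix_matrix_mult_def) (subst sum.swap, simp add: mult.commute)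

lemma norm_power2_eq_trace: "complex_of_real ((norm A)\<^sup>2) = trace (adjoint_matrix A ** (A :: complex^'n^'n))"
  unfolding norm_matrix_power2 trace_def matrix_matrix_mult_def of_real_sum complex_norm_square
  by (simp add: mult.commute) (rule sum.swap)

text \<open>Polarization of the isometry property. It later provides the duality between base and
  fibre frames in the Darboux computation.\<close>

lemma trace_hm_mult:
  fixes x y :: "real^('a::{finite,wellorder} \<times> 'a::_)"
  shows "trace (hm x ** hm y) = complex_of_real (x \<bullet> y)"
proof -
  have q: "trace (hm z ** hm z) = complex_of_real (z \<bullet> z)" for z :: "real^('a \<times> 'a)"
    using norm_power2_eq_trace[of "hm z"] by (simp add: power2_norm_eq_inner)
  have "trace (hm (x + y) ** hm (x + y)) = trace (hm x ** hm x) + trace (hm y ** hm y) + 2 * trace (hm x ** hm y)"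
    using trace_matrix_mult_commute[of "hm x" "hm y"]
    by (simp add: hm_add matrix_mult.add_left matrix_mult.add_right trace_add)
  then have "2 * trace (hm x ** hm y) = complex_of_real ((x + y) \<bullet> (x + y) - x \<bullet> x - y \<bullet> y)"
    unfolding q by simp
  also have "\<dots> = 2 * complex_of_real (x \<bullet> y)"
    by (simp add: inner_add_left inner_add_right inner_commute)
  finally show ?thesis by simp
qed

section \<open>The derivative of matrix inversion\<close>

lemma differentiable_prod:
  fixes f :: "'i \<Rightarrow> 'a::real_normed_vector \<Rightarrow> 'b::real_normed_field"
  assumes "\<And>i. i \<in> I \<Longrightarrow> f i differentiable (at x within S)"
  shows "(\<lambda>x. \<Prod>i\<in>I. f i x) differentiable (at x within S)"
proof -
  obtain f' where "\<And>i. i \<in> I \<Longrightarrow> (f i has_derivative f' i) (at x within S)"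
    using assms unfolding differentiable_def by metis
  then show ?thesis unfolding differentiable_def using has_derivative_prod by blast
qed

lemma differentiable_det:
  fixes f :: "'a::real_normed_vector \<Rightarrow> complex^'n^'n"
  assumes "\<And>i j. (\<lambda>x. f x $ i $ j) differentiable (at x within S)"
  shows "(\<lambda>x. Determinants.det (f x)) differentiable (at x within S)"
  unfolding Determinants.det_def
  by (intro differentiable_sum differentiable_mult differentiable_prod differentiable_const assms ballI)
    (simp_all add: finite_permutations)

lemma differentiable_nth_nth: "(\<lambda>A :: complex^'n^'n. A $ i $ j) differentiable (at A within S)"
  unfolding differentiable_def
  by (rule exI, rule bounded_linear_imp_has_derivative,
      rule bounded_linear_compose[OF bounded_linear_vec_nth bounded_linear_vec_nth])

lemma open_invertible: "open {A :: complex^'n^'n. invertible A}"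
proof -
  have "continuous_on UNIV (\<lambda>A :: complex^'n^'n. Determinants.det A)"
    by (rule differentiable_imp_continuous_on)
      (simp add: differentiable_on_def differentiable_det differentiable_nth_nth)
  then have "open ((\<lambda>A :: complex^'n^'n. Determinants.det A) -` (- {0}))"
    by (intro open_vimage) auto
  then show ?thesis by (simp add: invertible_det_nz vimage_def)
qed

lemma matrix_inv_inverse:
  assumes "invertible (A :: complex^'n^'n)"
  shows "A ** matrix_inv A = mat 1" "matrix_inv A ** A = mat 1"
  using someI_ex[OF assms[unfolded invertible_def]] unfolding matrix_inv_def by simp_all

lemma matrix_inv_eqI:
  fixes A B :: "complex^'n^'n"
  assumes "A ** B = mat 1" "B ** A = mat 1"
  shows "matrix_inv A = B"
proof -
  have "invertible A" using assms unfolding invertible_def by blast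
  have "matrix_inv A = matrix_inv A ** (A ** B)" by (simp add: assms)
  also have "\<dots> = B" by (simp add: matrix_mul_assoc matrix_inv_inverse[OF \<open>invertible A\<close>])
  finally show ?thesis .
qed

lemma has_derivative_vec_lambda:
  fixes f :: "'n::finite \<Rightarrow> 'a::real_normed_vector \<Rightarrow> 'b::real_normed_vector"
  assumes "\<And>k. (f k has_derivative f' k) (at x within S)"
  shows "((\<lambda>x. \<chi> k. f k x) has_derivative (\<lambda>h. \<chi> k. f' k h)) (at x within S)"
proof -
  have ax: "bounded_linear (axis k :: 'b \<Rightarrow> 'b^'n)" for k
  proof (rule bounded_linear_intro[of _ 1])
    show "norm (axis k x :: 'b^'n) \<le> norm x * 1" for x
      unfolding norm_vec_def L2_set_def by (subst sum.remove[of _ k]) (auto simp: axis_def)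
  qed (auto intro!: vec_eqI simp: axis_def)
  have s: "(\<chi> k. g k) = (\<Sum>k\<in>UNIV. axis k (g k))" for g :: "'n \<Rightarrow> 'b"
    by (rule vec_eqI) (simp add: axis_def if_distrib cong: if_cong)
  show ?thesis unfolding s
    by (intro has_derivative_sum bounded_linear.has_derivative[OF ax] assms)
qed

lemma matrix_inv_cramer:
  fixes A :: "complex^'n^'n"
  assumes "invertible A"
  shows "matrix_inv A $ k $ l =
    Determinants.det (\<chi> i j. if j = k then axis l 1 $ i else A $ i $ j) / Determinants.det A"
proof -
  have "A *v (matrix_inv A *v axis l 1) = axis l 1"
    by (simp add: matrix_vector_mul_assoc matrix_inv_inverse[OF assms])
  then have "matrix_inv A *v axis l 1 = (\<chi> k. Determinants.det (\<chi> i j. if j = k then axis l 1 $ i else A $ i $ j) / Determinants.det A)"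
    using cramer[of A "matrix_inv A *v axis l 1" "axis l 1"] assms by (simp add: invertible_det_nz)
  moreover have "(matrix_inv A *v axis l 1) $ k = matrix_inv A $ k $ l"
    by (simp add: matrix_vector_mult_def axis_def if_distrib cong: if_cong)
  ultimately show ?thesis by simp
qed

text \<open>Cramer's rule shows that the inverse has some derivative; differentiating A A^-1 = 1
  then determines it.\<close>

theorem has_derivative_matrix_inv:
  fixes A :: "complex^'n^'n"
  assumes A: "invertible A"
  shows "(matrix_inv has_derivative (\<lambda>H. - (matrix_inv A ** H ** matrix_inv A))) (at A)"
proof -
  let ?c = "\<lambda>B k l. Determinants.det (\<chi> i j. if j = k then axis l 1 $ i else B $ i $ j) / Determinants.det B :: complex"
  have nz: "Determinants.det A \<noteq> 0" using A by (simp add: invertible_det_nz)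
  have "(\<lambda>B :: complex^'n^'n. ?c B k l) differentiable (at A)" for k l
  proof (intro differentiable_divide differentiable_det nz differentiable_nth_nth)
    fix i j show "(\<lambda>B :: complex^'n^'n. (\<chi> i j. if j = k then axis l 1 $ i else B $ i $ j) $ i $ j) differentiable (at A)"
      by (cases "j = k") (simp_all add: differentiable_nth_nth)
  qed
  define c' where "c' k l = frechet_derivative (\<lambda>B :: complex^'n^'n. ?c B k l) (at A)" for k l
  have c': "((\<lambda>B :: complex^'n^'n. ?c B k l) has_derivative c' k l) (at A)" for k l
    unfolding c'_def by (rule frechet_derivative_works[THEN iffD1]) fact
  have "((\<lambda>B. \<chi> k l. ?c B k l) has_derivative (\<lambda>H. \<chi> k l. c' k l H)) (at A)"
    by (intro has_derivative_vec_lambda c')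
  then have D: "(matrix_inv has_derivative (\<lambda>H. \<chi> k l. c' k l H)) (at A)" (is "(_ has_derivative ?D) _")
    by (rule has_derivative_transform_within_open[OF _ open_invertible])
      (use A in \<open>simp_all add: Finite_Cartesian_Product.vec_eq_iff matrix_inv_cramer\<close>)
  have "((\<lambda>B. B ** matrix_inv B) has_derivative (\<lambda>H. A ** ?D H + H ** matrix_inv A)) (at A)"
    by (rule has_derivative_matrix_mult[OF has_derivative_ident D])
  moreover have "((\<lambda>B. B ** matrix_inv B) has_derivative (\<lambda>H. 0)) (at A)"
    by (rule has_derivative_transform_within_open[OF has_derivative_const open_invertible])
      (use A in \<open>auto simp: matrix_inv_inverse\<close>)
  ultimately have "(\<lambda>H. A ** ?D H + H ** matrix_inv A) = (\<lambda>H. 0)"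
    by (rule has_derivative_unique)
  then have e: "A ** ?D H = - (H ** matrix_inv A)" for H by (auto simp: eq_neg_iff_add_eq_0 dest: fun_cong)
  have "?D H = - (matrix_inv A ** H ** matrix_inv A)" for H
  proof -
    have "?D H = (matrix_inv A ** A) ** ?D H" by (simp add: matrix_inv_inverse[OF A])
    also have "\<dots> = matrix_inv A ** (A ** ?D H)" by (simp only: matrix_mul_assoc)
    also have "\<dots> = - (matrix_inv A ** H ** matrix_inv A)"
      unfolding e by (simp add: matrix_mult.minus_right matrix_mul_assoc)
    finally show ?thesis .
  qed
  with D show ?thesis by simp
qed

lemma has_derivative_matrix_inv_compose:
  fixes f :: "'a::real_normed_vector \<Rightarrow> complex^'n^'n"
  assumes "(f has_derivative f') (at x within S)" "invertible (f x)"
  shows "((\<lambda>x. matrix_inv (f x)) has_derivative (\<lambda>h. - (matrix_inv (f x) ** f' h ** matrix_inv (f x)))) (at x within S)"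
  using has_derivative_compose[OF assms(1) has_derivative_matrix_inv[OF assms(2)]] by simp

lemma continuous_on_matrix_inv [continuous_intros]:
  fixes f :: "'a::topological_space \<Rightarrow> complex^'n^'n"
  assumes "continuous_on S f" "\<And>x. x \<in> S \<Longrightarrow> invertible (f x)"
  shows "continuous_on S (\<lambda>x. matrix_inv (f x))"
proof -
  have "continuous_on {A :: complex^'n^'n. invertible A} matrix_inv"
    by (rule has_derivative_continuous_on, rule has_derivative_at_withinI, rule has_derivative_matrix_inv) simp
  then show ?thesis
    by (rule continuous_on_compose2[OF _ assms(1)]) (use assms(2) in blast)
qed

text \<open>Injectivity of each \<open>c' x\<close> comes from differentiating
  \<open>r (c x) = x\<close>, which exhibits a left inverse.\<close>

lemma smooth_chartI:
  fixes c :: "real^'d::finite \<Rightarrow> 'e::euclidean_space"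
  assumes op: "openin (top_of_set M) (range c)" and rc: "\<And>x. r (c x) = x"
    and dc: "\<And>x. (c has_derivative c' x) (at x)" and cc: "\<And>h. continuous_on UNIV (\<lambda>x. c' x h)"
    and dr: "\<And>p. p \<in> range c \<Longrightarrow> (r has_derivative r' p) (at p within M)"
    and cr: "\<And>h. continuous_on (range c) (\<lambda>p. r' p h)"
  shows "smooth_chart M c r"
proof -
  have sub: "range c \<subseteq> M" using op by (rule openin_imp_subset)
  have contc: "continuous_on UNIV c"
    by (rule has_derivative_continuous_on, rule has_derivative_at_withinI, rule dc)
  have contr: "continuous_on (range c) r"
    by (rule has_derivative_continuous_on, rule has_derivative_subset, rule dr) (use sub in auto)
  have fc: "frechet_derivative c (at x) = c' x" for x
    using frechet_derivative_at[OF dc[of x]] by simp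
  have "inj (c' x)" for x
  proof -
    have "(c has_derivative c' x) (at x within UNIV)" using dc by simp
    moreover have "(r has_derivative r' (c x)) (at (c x) within range c)"
      by (rule has_derivative_subset, rule dr) (use sub in auto)
    ultimately have "(r \<circ> c has_derivative r' (c x) \<circ> c' x) (at x within UNIV)"
      by (rule diff_chain_within)
    moreover have "r \<circ> c = id" using rc by auto
    ultimately have "(id has_derivative r' (c x) \<circ> c' x) (at x)" by simp
    then have "r' (c x) \<circ> c' x = id"
      by (rule has_derivative_unique) (rule has_derivative_id)
    then show ?thesis by (metis inj_on_id inj_on_imageI2)
  qed
  then have "local_parametrization M UNIV c"
    unfolding local_parametrization_def fc
    using op cc dc contc contr rc
    by (auto simp: differentiable_def homeomorphism_def image_image intro!: exI[of _ r])
  then show ?thesis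
    unfolding smooth_chart_def using rc dr cr by blast
qed

section \<open>The Cayley transform\<close>

lemma inner_complex_Re: "x \<bullet> y = Re (cnj x * y)"
  by (simp add: inner_complex_def)

lemma inner_adjoint_matrix:
  fixes A :: "complex^'n^'n"
  shows "v \<bullet> (A *v w) = (adjoint_matrix A *v v) \<bullet> w"
  unfolding inner_vec_def inner_complex_Re matrix_vector_mult_def
  by (simp add: sum_distrib_left sum_distrib_right mult_ac Re_sum[symmetric] del: Re_sum times_complex.sel)
     (subst sum.swap, simp add: mult_ac)

definition skew :: "real^('n::{finite,wellorder} \<times> 'n::_) \<Rightarrow> complex^'n::_^'n::_" where
  "skew x = mat \<i> ** hm x"

definition resolvent :: "real^('n::{finite,wellorder} \<times> 'n::_) \<Rightarrow> complex^'n::_^'n::_" where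
  "resolvent x = matrix_inv (mat 1 - skew x)"

text \<open>Equal to (1 + S)(1 - S)^-1 for S = \<open>skew x\<close>. Written this way the variable
  enters through a single inverse, which keeps the derivative and the inverse map short.\<close>

definition cayley :: "real^('n::{finite,wellorder} \<times> 'n::_) \<Rightarrow> complex^'n::_^'n::_" where
  "cayley x = 2 *\<^sub>R resolvent x - mat 1"

lemma mat_neg: "mat (- c) ** A = - (mat (c :: complex) ** A)"
  by (intro matrix_eqI) (simp add: mat_mult_nth)

lemma adjoint_skew: "adjoint_matrix (skew x) = - skew x"
  by (simp add: skew_def adjoint_matrix_mult adjoint_mat mat_neg flip: mat_mult_commute)

text \<open>A skew-Hermitian matrix cannot have the eigenvalue 1: moving it across the real inner
  product changes the sign of \<open>v \<bullet> v\<close>.\<close>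

lemma invertible_1_minus_skew: "invertible (mat 1 - skew x)"
  unfolding invertible_left_inverse matrix_left_invertible_ker
proof (intro allI impI)
  fix v assume "(mat 1 - skew x) *v v = 0"
  then have v: "skew x *v v = v" by (simp add: matrix_vector_mult_diff_rdistrib)
  have "v \<bullet> v = v \<bullet> (skew x *v v)" by (simp add: v)
  also have "\<dots> = (adjoint_matrix (skew x) *v v) \<bullet> v" by (rule inner_adjoint_matrix)
  also have "\<dots> = - (v \<bullet> v)"
  proof -
    have "(- skew x) *v v = - (skew x *v v)"
      using matrix_vector_mult_diff_rdistrib[of 0 "skew x" v] by simp
    then show ?thesis by (simp add: adjoint_skew v)
  qed
  finally show "v = 0" by simp
qed

lemma resolvent_inverse:
  "(mat 1 - skew x) ** resolvent x = mat 1" "resolvent x ** (mat 1 - skew x) = mat 1"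
  unfolding resolvent_def by (rule matrix_inv_inverse[OF invertible_1_minus_skew])+

lemma adjoint_resolvent_inverse:
  "adjoint_matrix (resolvent x) ** (mat 1 + skew x) = mat 1"
  "(mat 1 + skew x) ** adjoint_matrix (resolvent x) = mat 1"
  using arg_cong[OF resolvent_inverse(1)[of x], of adjoint_matrix]
    arg_cong[OF resolvent_inverse(2)[of x], of adjoint_matrix]
  by (simp_all add: adjoint_matrix_mult adjoint_matrix_diff adjoint_mat adjoint_skew)

lemma cayley_eq: "cayley x = resolvent x ** (mat 1 + skew x)"
proof -
  have "mat 1 + skew x = 2 *\<^sub>R mat 1 - (mat 1 - skew x)"
    by (intro matrix_eqI) (simp add: scaleR_conv_of_real)
  then show ?thesis
    by (simp only: cayley_def matrix_mult.diff_right[of _ "2 *\<^sub>R mat 1"] matrix_mult.scaleR_right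
        resolvent_inverse matrix_mul_rid)
qed

lemma cayley_adjoint_resolvent: "cayley x ** adjoint_matrix (resolvent x) = resolvent x"
  by (simp add: cayley_eq adjoint_resolvent_inverse flip: matrix_mul_assoc)

lemma unitary_groupI: "adjoint_matrix g ** g = mat 1 \<Longrightarrow> g \<in> unitary_group"
  by (simp add: unitary_group_def matrix_left_right_inverse)

lemma unitary_groupD:
  assumes "g \<in> unitary_group"
  shows "adjoint_matrix g ** g = mat 1" "g ** adjoint_matrix g = mat 1"
  using assms by (simp_all add: unitary_group_def)

lemma unitary_group_adjoint: "g \<in> unitary_group \<Longrightarrow> adjoint_matrix g \<in> unitary_group"
  by (simp add: unitary_group_def)

lemma unitary_group_one: "mat 1 \<in> unitary_group"
  by (simp add: unitary_group_def adjoint_mat)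

lemma unitary_cancel_left [simp]:
  assumes "g \<in> unitary_group"
  shows "adjoint_matrix g ** (g ** A) = A" "g ** (adjoint_matrix g ** A) = A"
  using unitary_groupD[OF assms] by (simp_all add: matrix_mul_assoc)

lemma unitary_cancel_right [simp]:
  assumes "g \<in> unitary_group"
  shows "(A ** adjoint_matrix g) ** g = A" "(A ** g) ** adjoint_matrix g = A"
  using unitary_groupD[OF assms] by (simp_all flip: matrix_mul_assoc)

lemma unitary_group_mult: "g \<in> unitary_group \<Longrightarrow> h \<in> unitary_group \<Longrightarrow> g ** h \<in> unitary_group"
  by (rule unitary_groupI) (simp add: adjoint_matrix_mult unitary_groupD flip: matrix_mul_assoc)

lemma hm_0 [simp]: "hm 0 = 0"
  using linear_0[OF linear_hm] .

lemma skew_0 [simp]: "skew 0 = 0"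
  by (simp add: skew_def matrix_mult.zero_right)

lemma resolvent_0 [simp]: "resolvent 0 = mat 1"
  by (simp add: resolvent_def matrix_inv_eqI)

text \<open>Unitarity amounts to R' + R = 2 R' R for the resolvent R and its adjoint R'. Write R' =
  R' (1 - S) R and R = R' (1 + S) R; in the sum the terms with S cancel.\<close>

lemma cayley_unitary: "cayley x \<in> unitary_group"
proof (rule unitary_groupI)
  let ?R = "resolvent x" and ?S = "adjoint_matrix (resolvent x)"
  have a: "?S = ?S ** ?R - ?S ** skew x ** ?R"
  proof -
    have "?S = ?S ** ((mat 1 - skew x) ** ?R)" by (simp add: resolvent_inverse)
    then show ?thesis by (simp add: matrix_mult.diff_left matrix_mult.diff_right matrix_mul_assoc)
  qed
  have b: "?R = ?S ** ?R + ?S ** skew x ** ?R"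
  proof -
    have "?R = (?S ** (mat 1 + skew x)) ** ?R" by (simp add: adjoint_resolvent_inverse)
    then show ?thesis by (simp add: matrix_mult.add_left matrix_mult.add_right)
  qed
  have "?S + ?R = 2 *\<^sub>R (?S ** ?R)"
    by (subst a, subst (3) b) (simp add: scaleR_2)
  then have "?S = 2 *\<^sub>R (?S ** ?R) - ?R" by (simp only: eq_diff_eq)
  then have "2 *\<^sub>R (2 *\<^sub>R (?S ** ?R) - ?R) = 2 *\<^sub>R ?S" by simp
  then show "adjoint_matrix (cayley x) ** cayley x = mat 1"
    by (simp add: cayley_def adjoint_matrix_diff adjoint_matrix_scaleR adjoint_mat matrix_mult.diff_left
        matrix_mult.diff_right matrix_mult.scaleR_left matrix_mult.scaleR_right scaleR_diff_right)
qed

lemma cayley_0 [simp]: "cayley 0 = mat 1"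
  by (intro matrix_eqI) (simp add: cayley_def scaleR_conv_of_real)

text \<open>Coordinates of \<open>- \<i> g\<^sup>* dg\<close> for \<open>g = cayley x\<close>, in the direction \<open>h\<close>.\<close>

definition cayley_form :: "real^('n::{finite,wellorder} \<times> 'n::_) \<Rightarrow> real^('n \<times> 'n) \<Rightarrow> real^('n \<times> 'n)" where
  "cayley_form x h = 2 *\<^sub>R hermitian_coords (adjoint_matrix (resolvent x) ** hm h ** resolvent x)"

lemma hermitian_conj:
  "A \<in> hermitian_matrices \<Longrightarrow> adjoint_matrix B ** A ** B \<in> hermitian_matrices"
  by (simp add: hermitian_matrices_def adjoint_matrix_mult matrix_mul_assoc)

lemma hm_cayley_form: "hm (cayley_form x h) = 2 *\<^sub>R (adjoint_matrix (resolvent x) ** hm h ** resolvent x)"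
  by (simp add: cayley_form_def hm_scaleR hm_hermitian_coords hermitian_conj hm_hermitian)

lemma linear_cayley_form: "linear (cayley_form x)"
  by (rule linearI)
    (simp_all add: cayley_form_def hm_add hm_scaleR matrix_mult.add_left matrix_mult.add_right
      matrix_mult.scaleR_left matrix_mult.scaleR_right linear_add[OF linear_hermitian_coords]
      linear_scale[OF linear_hermitian_coords] scaleR_add_right)

lemma has_derivative_skew: "(skew has_derivative skew) (at x)"
proof -
  have "linear skew"
    by (rule linearI) (simp_all add: skew_def hm_add hm_scaleR matrix_mult.add_right matrix_mult.scaleR_right)
  from linear_conv_bounded_linear[THEN iffD1, OF this] show ?thesis
    by (rule bounded_linear_imp_has_derivative)
qed

lemma has_derivative_cayley:
  "(cayley has_derivative (\<lambda>h. cayley x ** (mat \<i> ** hm (cayley_form x h)))) (at x)"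
proof -
  have s: "((\<lambda>x. mat 1 - skew x) has_derivative (\<lambda>h. - skew h)) (at x)"
    using has_derivative_diff[OF has_derivative_const has_derivative_skew] by simp
  have "(cayley has_derivative (\<lambda>h. 2 *\<^sub>R (- (resolvent x ** (- skew h) ** resolvent x)))) (at x)"
    using has_derivative_diff[OF has_derivative_scaleR_right[OF has_derivative_matrix_inv_compose[OF s invertible_1_minus_skew]] has_derivative_const, of 2 "mat 1"]
    unfolding cayley_def resolvent_def by simp
  moreover have "2 *\<^sub>R (- (resolvent x ** (- skew h) ** resolvent x)) = cayley x ** (mat \<i> ** hm (cayley_form x h))" for h
  proof -
    \<comment> \<open>\<open>mat \<i>\<close> is central and moves past the adjoint resolvent, which
      is then absorbed into \<open>cayley x\<close> by
      \<open>cayley_adjoint_resolvent\<close>.\<close>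
    have "mat \<i> ** (adjoint_matrix (resolvent x) ** hm h ** resolvent x)
      = adjoint_matrix (resolvent x) ** (mat \<i> ** hm h) ** resolvent x"
      by (simp only: matrix_mul_assoc mat_mult_commute[of \<i> "adjoint_matrix (resolvent x)"])
    then have "cayley x ** (mat \<i> ** hm (cayley_form x h))
      = 2 *\<^sub>R ((cayley x ** adjoint_matrix (resolvent x)) ** (mat \<i> ** hm h) ** resolvent x)"
      unfolding hm_cayley_form
      by (simp add: matrix_mult.scaleR_right matrix_mul_assoc)
    then show ?thesis
      by (simp add: cayley_adjoint_resolvent skew_def matrix_mult.minus_left matrix_mult.minus_right)
  qed
  ultimately show ?thesis by simp
qed

lemma continuous_resolvent: "continuous_on S resolvent"
proof -
  have "continuous_on S skew"
    by (rule has_derivative_continuous_on, rule has_derivative_at_withinI, rule has_derivative_skew)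
  then show ?thesis
    unfolding resolvent_def[abs_def]
    by (intro continuous_intros invertible_1_minus_skew)
qed

lemma continuous_cayley: "continuous_on S cayley"
  unfolding cayley_def[abs_def] by (intro continuous_intros continuous_resolvent)

lemma continuous_adjoint_matrix: "continuous_on S f \<Longrightarrow> continuous_on S (\<lambda>x. adjoint_matrix (f x))"
  using bounded_linear.continuous_on[OF bounded_linear_adjoint_matrix] .

lemma continuous_cayley_form: "continuous_on S (\<lambda>x. cayley_form x h)"
  unfolding cayley_form_def
  by (intro continuous_intros bounded_linear.continuous_on[OF bounded_linear_hermitian_coords]
      continuous_adjoint_matrix continuous_resolvent)

text \<open>The Jacobian of the left Maurer-Cartan form in Cayley coordinates, hence the density of
  Haar measure in every left translated Cayley chart.\<close>

definition cayley_density :: "real^('n::{finite,wellorder} \<times> 'n::_) \<Rightarrow> real" where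
  "cayley_density x = \<bar>Determinants.det (matrix (cayley_form x))\<bar>"

lemma continuous_det:
  fixes f :: "'a::topological_space \<Rightarrow> real^'d^'d"
  assumes "\<And>i j. continuous_on S (\<lambda>x. f x $ i $ j)"
  shows "continuous_on S (\<lambda>x. Determinants.det (f x))"
  unfolding Determinants.det_def
  by (intro continuous_on_sum continuous_on_mult continuous_on_const continuous_on_prod assms)

lemma continuous_cayley_density: "continuous_on S cayley_density"
  unfolding cayley_density_def[abs_def] matrix_def
  by (intro continuous_on_rabs continuous_det)
    (simp add: continuous_cayley_form continuous_on_component)

lemma cayley_form_0: "cayley_form 0 h = 2 *\<^sub>R h"
  by (simp add: cayley_form_def adjoint_mat)

lemma cayley_density_0: "cayley_density (0 :: real^('n::{finite,wellorder} \<times> 'n::_)) > 0"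
proof -
  let ?A = "matrix (cayley_form (0 :: real^('n \<times> 'n)))"
  have A: "?A $ i $ j = (if i = j then 2 else 0)" for i j
    by (simp add: matrix_def cayley_form_0 axis_def)
  have "Determinants.det ?A = (\<Prod>i\<in>UNIV. ?A $ i $ i)"
    by (rule det_diagonal) (simp add: A)
  then show ?thesis by (simp add: cayley_density_def A)
qed

text \<open>This solves \<open>cayley x = g\<close>: from 1 + g = 2 (1 - S)^-1 follows S = 1 - 2 (1
  + g)^-1, and the factor \<open>- \<i>\<close> leads from S back to the Hermitian matrix.\<close>

definition inverse_cayley :: "complex^'n::{finite,wellorder}^'n::_ \<Rightarrow> real^('n::_ \<times> 'n::_)" where
  "inverse_cayley g = hermitian_coords (mat (- \<i>) ** (mat 1 - 2 *\<^sub>R matrix_inv (mat 1 + g)))"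

lemma one_plus_cayley: "mat 1 + cayley x = 2 *\<^sub>R resolvent x"
  by (simp add: cayley_def)

lemma matrix_inv_one_plus_cayley:
  "invertible (mat 1 + cayley x)" "matrix_inv (mat 1 + cayley x) = (1/2) *\<^sub>R (mat 1 - skew x)"
proof -
  have "(mat 1 + cayley x) ** ((1/2) *\<^sub>R (mat 1 - skew x)) = mat 1"
    "((1/2) *\<^sub>R (mat 1 - skew x)) ** (mat 1 + cayley x) = mat 1"
    unfolding one_plus_cayley
    by (simp_all add: matrix_mult.scaleR_left matrix_mult.scaleR_right resolvent_inverse)
  then show "invertible (mat 1 + cayley x)" "matrix_inv (mat 1 + cayley x) = (1/2) *\<^sub>R (mat 1 - skew x)"
    by (auto simp: invertible_def matrix_inv_eqI)
qed

lemma inverse_cayley_cayley [simp]: "inverse_cayley (cayley x) = x"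
  by (simp add: inverse_cayley_def matrix_inv_one_plus_cayley skew_def matrix_mul_assoc mat_mult_mat)

text \<open>The point is that K = 1 - 2 (1 + g)^-1 is skew-Hermitian, so that taking Hermitian
  coordinates loses nothing. For unitary g the adjoint of (1 + g)^-1 is (1 + g)^-1 g = 1 - (1 +
  g)^-1.\<close>

lemma cayley_inverse_cayley:
  assumes g: "g \<in> unitary_group" and inv: "invertible (mat 1 + g)"
  shows "cayley (inverse_cayley g) = g"
proof -
  let ?I = "matrix_inv (mat 1 + g)" and ?S = "adjoint_matrix g"
  let ?K = "mat 1 - 2 *\<^sub>R ?I"
  note I = matrix_inv_inverse[OF inv]
  have aI: "adjoint_matrix ?I = ?I ** g"
  proof -
    have "(mat 1 + ?S) ** (adjoint_matrix ?I) = mat 1"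
      using arg_cong[OF I(2), of adjoint_matrix]
      by (simp add: adjoint_matrix_mult adjoint_matrix_add adjoint_mat)
    then have "?S ** ((g + mat 1) ** adjoint_matrix ?I) = mat 1"
      using unitary_groupD[OF g] by (simp add: matrix_mult.add_left matrix_mult.add_right matrix_mul_assoc)
    then have "(g + mat 1) ** adjoint_matrix ?I = g"
      using g by (metis matrix_mul_rid unitary_cancel_left(2))
    then have "?I ** ((mat 1 + g) ** adjoint_matrix ?I) = ?I ** g" by (simp add: add.commute)
    then show ?thesis by (simp add: matrix_mul_assoc I)
  qed
  have "?I + ?I ** g = mat 1"
    using I(2) by (simp add: matrix_mult.add_right)
  then have "?I ** g = mat 1 - ?I" by (simp add: eq_diff_eq add.commute)
  then have "adjoint_matrix ?K = mat 1 - 2 *\<^sub>R (mat 1 - ?I)"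
    by (simp add: adjoint_matrix_diff adjoint_matrix_scaleR adjoint_mat aI)
  also have "\<dots> = - ?K" by (intro matrix_eqI) (simp add: scaleR_conv_of_real algebra_simps)
  finally have aK: "adjoint_matrix ?K = - ?K" .
  have "adjoint_matrix (mat (- \<i>) ** ?K) = adjoint_matrix ?K ** mat \<i>"
    by (simp only: adjoint_matrix_mult adjoint_mat complex_cnj_minus complex_cnj_i minus_minus)
  also have "\<dots> = - (mat \<i> ** ?K)" by (simp only: aK matrix_mult.minus_left mat_mult_commute)
  also have "\<dots> = mat (- \<i>) ** ?K" by (simp only: mat_neg)
  finally have "mat (- \<i>) ** ?K \<in> hermitian_matrices"
    unfolding hermitian_matrices_def by simp
  then have "hm (inverse_cayley g) = mat (- \<i>) ** ?K"
    unfolding inverse_cayley_def by (rule hm_hermitian_coords)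
  then have "skew (inverse_cayley g) = ?K"
    by (simp add: skew_def matrix_mul_assoc mat_mult_mat)
  then have "mat 1 - skew (inverse_cayley g) = 2 *\<^sub>R ?I" by simp
  then have "resolvent (inverse_cayley g) = (1/2) *\<^sub>R (mat 1 + g)"
    unfolding resolvent_def
    by (intro matrix_inv_eqI) (simp_all add: matrix_mult.scaleR_left matrix_mult.scaleR_right I)
  then show ?thesis by (simp add: cayley_def)
qed

section \<open>Haar measure on the unitary group\<close>

text \<open>The determinant of the left Maurer-Cartan form in Hermitian coordinates: a
  left-invariant volume form, whose measure is therefore an unnormalized Haar measure.\<close>

definition unitary_form :: "'n::{finite,wellorder} cmat \<Rightarrow> ('n \<times> 'n \<Rightarrow> 'n cmat) \<Rightarrow> real" where
  "unitary_form g v = Determinants.det (\<chi> i. hermitian_coords (mat (- \<i>) ** (adjoint_matrix g ** v i)))"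

lemma closed_unitary_group: "closed (unitary_group :: (complex^'n^'n) set)"
proof -
  have eq: "(unitary_group :: (complex^'n^'n) set) = {g. adjoint_matrix g ** g = mat 1}"
    by (auto simp: unitary_group_def matrix_left_right_inverse)
  show ?thesis
    unfolding eq by (intro closed_Collect_eq continuous_intros continuous_adjoint_matrix)
qed

interpretation unitary: volume_form
  "unitary_group :: ('n::{finite,wellorder} cmat) set" unitary_form
proof
  show "closed (unitary_group :: ('n cmat) set)" by (rule closed_unitary_group)
next
  fix g :: "'n cmat" and A :: "'n hcoord^('n \<times> 'n)" and w :: "'n \<times> 'n \<Rightarrow> 'n cmat"
  let ?f = "\<lambda>v. hermitian_coords (mat (- \<i>) ** (adjoint_matrix g ** v))"
  have l: "linear ?f"
    by (rule linearI)
      (simp_all add: matrix_mult.add_right matrix_mult.scaleR_right linear_add[OF linear_hermitian_coords]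
        linear_scale[OF linear_hermitian_coords])
  have "?f (\<Sum>k\<in>UNIV. A $ i $ k *\<^sub>R w k) = (\<Sum>k\<in>UNIV. A $ i $ k *\<^sub>R ?f (w k))" for i
    by (simp only: linear_sum[OF l] linear_scale[OF l])
  then have "(\<chi> i. ?f (\<Sum>k\<in>UNIV. A $ i $ k *\<^sub>R w k)) = A ** (\<chi> i. ?f (w i))"
    by (intro vec_eqI) (simp add: matrix_matrix_mult_def)
  then show "unitary_form g (\<lambda>i. \<Sum>k\<in>UNIV. A $ i $ k *\<^sub>R w k) = Determinants.det A * unitary_form g w"
    by (simp add: unitary_form_def det_mul)
next
  fix V :: "'n hcoord set" and f :: "'n hcoord \<Rightarrow> 'n cmat" and v :: "'n \<times> 'n \<Rightarrow> 'n hcoord \<Rightarrow> 'n cmat"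
  assume "continuous_on V f" "\<And>i. continuous_on V (v i)"
  then have "continuous_on V (\<lambda>x. hermitian_coords (mat (- \<i>) ** (adjoint_matrix (f x) ** v i x)) $ j)" for i j
    by (intro continuous_intros bounded_linear.continuous_on[OF bounded_linear_hermitian_coords]
        continuous_adjoint_matrix)
  then show "continuous_on V (\<lambda>x. unitary_form (f x) (\<lambda>i. v i x))"
    unfolding unitary_form_def by (intro continuous_det) simp
qed

definition unitary_chart ::
    "'n::{finite,wellorder} cmat \<Rightarrow> 'n hcoord \<Rightarrow> 'n cmat" where
  "unitary_chart h x = h ** cayley x"

definition unitary_chart_inv ::
    "'n::{finite,wellorder} cmat \<Rightarrow> 'n cmat \<Rightarrow> 'n hcoord" where
  "unitary_chart_inv h g = inverse_cayley (adjoint_matrix h ** g)"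

lemma unitary_chart_inv_chart [simp]:
  "h \<in> unitary_group \<Longrightarrow> unitary_chart_inv h (unitary_chart h x) = x"
  by (simp add: unitary_chart_inv_def unitary_chart_def)

lemma unitary_chart_unitary: "h \<in> unitary_group \<Longrightarrow> unitary_chart h x \<in> unitary_group"
  by (simp add: unitary_chart_def unitary_group_mult cayley_unitary)

text \<open>The chart at \<open>h\<close> misses exactly those \<open>g\<close> for which
  \<open>adjoint_matrix h ** g\<close> has the eigenvalue -1. Invertibility is an open condition,
  which gives relative openness of the range.\<close>

lemma range_unitary_chart:
  assumes h: "h \<in> unitary_group"
  shows "range (unitary_chart h) = {g \<in> unitary_group. invertible (mat 1 + adjoint_matrix h ** g)}"
proof (intro equalityI subsetI)
  fix g assume "g \<in> range (unitary_chart h)"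
  then obtain x where "g = unitary_chart h x" by blast
  then show "g \<in> {g \<in> unitary_group. invertible (mat 1 + adjoint_matrix h ** g)}"
    using unitary_chart_unitary[OF h] h matrix_inv_one_plus_cayley(1)[of x] by (simp add: unitary_chart_def)
next
  fix g assume "g \<in> {g \<in> unitary_group. invertible (mat 1 + adjoint_matrix h ** g)}"
  then have g: "g \<in> unitary_group" "invertible (mat 1 + adjoint_matrix h ** g)" by auto
  have "cayley (inverse_cayley (adjoint_matrix h ** g)) = adjoint_matrix h ** g"
    using g h by (intro cayley_inverse_cayley unitary_group_mult unitary_group_adjoint)
  then have "g = unitary_chart h (unitary_chart_inv h g)"
    using h by (simp add: unitary_chart_def unitary_chart_inv_def)
  then show "g \<in> range (unitary_chart h)" by (rule range_eqI)
qed

lemma openin_range_unitary_chart: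
  assumes h: "h \<in> unitary_group"
  shows "openin (top_of_set unitary_group) (range (unitary_chart h))"
proof -
  have "open {g. invertible (mat 1 + adjoint_matrix h ** g)}"
    using open_vimage[OF open_invertible, of "\<lambda>g. mat 1 + adjoint_matrix h ** g"]
    by (simp add: vimage_def continuous_intros)
  moreover have "range (unitary_chart h) = unitary_group \<inter> {g. invertible (mat 1 + adjoint_matrix h ** g)}"
    unfolding range_unitary_chart[OF h] by blast
  ultimately show ?thesis unfolding openin_open by blast
qed

definition unitary_chart_inv_deriv ::
    "'n::{finite,wellorder} cmat \<Rightarrow> 'n cmat \<Rightarrow> 'n cmat \<Rightarrow> 'n hcoord" where
  "unitary_chart_inv_deriv h g H = hermitian_coords (mat (- \<i>) ** (2 *\<^sub>R
     (matrix_inv (mat 1 + adjoint_matrix h ** g) ** (adjoint_matrix h ** H) ** matrix_inv (mat 1 + adjoint_matrix h ** g))))"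

lemma has_derivative_matrix_mult_const:
  fixes B :: "complex^'n^'n"
  shows "((\<lambda>x. B ** x) has_derivative (\<lambda>h. B ** h)) (at x within S)"
  by (rule bounded_linear_imp_has_derivative, rule matrix_mult.bounded_linear_right)

lemma has_derivative_unitary_chart_inv:
  assumes "invertible (mat 1 + adjoint_matrix h ** g)"
  shows "(unitary_chart_inv h has_derivative unitary_chart_inv_deriv h g) (at g within S)"
proof -
  have "((\<lambda>g. mat 1 + adjoint_matrix h ** g) has_derivative (\<lambda>H. adjoint_matrix h ** H)) (at g within S)"
    using has_derivative_add[OF has_derivative_const has_derivative_matrix_mult_const] by simp
  note 1 = has_derivative_matrix_inv_compose[OF this assms]
  note 2 = has_derivative_diff[OF has_derivative_const[of "mat 1"] has_derivative_scaleR_right[OF 1, of 2]]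
  note 3 = has_derivative_compose[OF 2 has_derivative_matrix_mult_const[of "mat (- \<i>)"]]
  note 4 = bounded_linear.has_derivative[OF bounded_linear_hermitian_coords 3]
  have e: "0 - 2 *\<^sub>R (- X) = 2 *\<^sub>R X" for X :: "'a cmat" by simp
  show ?thesis
    using 4 unfolding e
    unfolding unitary_chart_inv_def[abs_def] inverse_cayley_def unitary_chart_inv_deriv_def[abs_def] .
qed

lemma has_derivative_unitary_chart:
  "(unitary_chart h has_derivative (\<lambda>e. unitary_chart h x ** (mat \<i> ** hm (cayley_form x e)))) (at x)"
  using has_derivative_compose[OF has_derivative_cayley has_derivative_matrix_mult_const[of h]]
  unfolding unitary_chart_def[abs_def] by (simp only: matrix_mul_assoc)

lemma smooth_chart_unitary:
  assumes h: "h \<in> unitary_group"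
  shows "smooth_chart unitary_group (unitary_chart h) (unitary_chart_inv h)"
proof (rule smooth_chartI)
  show "openin (top_of_set unitary_group) (range (unitary_chart h))"
    by (rule openin_range_unitary_chart[OF h])
  show "unitary_chart_inv h (unitary_chart h x) = x" for x using h by simp
  show "(unitary_chart h has_derivative (\<lambda>e. unitary_chart h x ** (mat \<i> ** hm (cayley_form x e)))) (at x)" for x
    by (rule has_derivative_unitary_chart)
  show "continuous_on UNIV (\<lambda>x. unitary_chart h x ** (mat \<i> ** hm (cayley_form x e)))" for e
    unfolding unitary_chart_def
    by (intro continuous_intros continuous_cayley continuous_cayley_form bounded_linear.continuous_on[OF bounded_linear_hm])
  show "(unitary_chart_inv h has_derivative unitary_chart_inv_deriv h g) (at g within unitary_group)"
    if "g \<in> range (unitary_chart h)" for g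
    using that range_unitary_chart[OF h] by (intro has_derivative_unitary_chart_inv) simp
  show "continuous_on (range (unitary_chart h)) (\<lambda>g. unitary_chart_inv_deriv h g H)" for H
    unfolding unitary_chart_inv_deriv_def range_unitary_chart[OF h]
    by (intro continuous_intros bounded_linear.continuous_on[OF bounded_linear_hermitian_coords]) simp_all
qed

text \<open>The base point cancels between the adjoint of the chart value and its derivative,
  leaving only the coordinates of the Maurer-Cartan form; this is why all charts share one
  density.\<close>

lemma form_density_unitary_chart:
  assumes h: "h \<in> unitary_group"
  shows "form_density unitary_form (unitary_chart h) x = cayley_density x"
proof -
  have "mat (- \<i>) ** (mat \<i> ** A) = A" for A :: "'a cmat"
    by (simp add: matrix_mul_assoc mat_mult_mat)
  then have "(\<chi> i. hermitian_coords (mat (- \<i>) ** (adjoint_matrix (unitary_chart h x) ** (unitary_chart h x ** (mat \<i> ** hm (cayley_form x (axis i 1)))))))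
    = Finite_Cartesian_Product.transpose (matrix (cayley_form x))"
    using unitary_chart_unitary[OF h, of x]
    by (intro matrix_eqI) (simp add: Finite_Cartesian_Product.transpose_def matrix_def)
  then show ?thesis
    unfolding form_density_def frechet_derivative_at[OF has_derivative_unitary_chart, symmetric]
    by (simp add: unitary_form_def cayley_density_def det_transpose)
qed

text \<open>Every \<open>g\<close> is the centre of its own chart, and the Lindelof property
  extracts a countable subcover.\<close>

lemma unitary_atlas_exists:
  "\<exists>hs :: nat \<Rightarrow> 'n::{finite,wellorder} cmat.
     (\<forall>n. hs n \<in> unitary_group) \<and> unitary_group \<subseteq> (\<Union>n. range (unitary_chart (hs n)))"
proof -
  let ?F = "(\<lambda>h. range (unitary_chart h)) ` (unitary_group :: ('n cmat) set)"
  obtain F' where F': "F' \<subseteq> ?F" "countable F'" "\<Union>F' = \<Union>?F"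
    using Lindelof_openin[of ?F unitary_group] openin_range_unitary_chart by (metis (no_types, lifting) imageE)
  obtain H where H: "countable H" "H \<subseteq> unitary_group" "F' = (\<lambda>h. range (unitary_chart h)) ` H"
    using F'(1,2) countable_subset_image[of F' "\<lambda>h. range (unitary_chart h)" unitary_group] by blast
  have cov: "unitary_group \<subseteq> \<Union>?F"
  proof
    fix g :: "'n cmat" assume g: "g \<in> unitary_group"
    have "g = unitary_chart g 0" by (simp add: unitary_chart_def)
    then have "g \<in> range (unitary_chart g)" by (rule range_eqI)
    then show "g \<in> \<Union>?F" using g by blast
  qed
  then have "H \<noteq> {}" using F'(3) H(3) unitary_group_one by auto
  then have r: "range (from_nat_into H) = H" using H(1) by (rule range_from_nat_into)
  have "(\<Union>n. range (unitary_chart (from_nat_into H n))) = \<Union>F'"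
    unfolding H(3) by (subst r[symmetric]) (simp add: image_image)
  then have "unitary_group \<subseteq> (\<Union>n. range (unitary_chart (from_nat_into H n)))"
    using cov F'(3) by simp
  moreover have "from_nat_into H n \<in> unitary_group" for n
    using from_nat_into[OF \<open>H \<noteq> {}\<close>] H(2) by blast
  ultimately show ?thesis by blast
qed

definition atlas_point :: "nat \<Rightarrow> 'n::{finite,wellorder} cmat" where
  "atlas_point = (SOME hs. (\<forall>n. hs n \<in> unitary_group) \<and> unitary_group \<subseteq> (\<Union>n. range (unitary_chart (hs n))))"

lemma atlas_point:
  "atlas_point n \<in> unitary_group" "unitary_group \<subseteq> (\<Union>n. range (unitary_chart (atlas_point n)))"
  using someI_ex[OF unitary_atlas_exists] unfolding atlas_point_def by blast+

interpretation unitary: volume_form_atlas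
  "unitary_group :: ('n::{finite,wellorder} cmat) set" unitary_form
  "\<lambda>n. unitary_chart (atlas_point n)" "\<lambda>n. unitary_chart_inv (atlas_point n)"
  by standard (simp_all add: smooth_chart_unitary atlas_point)

definition haar :: "('n::{finite,wellorder} cmat) measure" where
  "haar = form_measure unitary_group unitary_form"

lemma is_form_measure_haar: "is_form_measure unitary_group unitary_form haar"
  unfolding haar_def using unitary.is_form_measure_exists unitary.form_measure_eqI by metis

lemma space_haar [simp]: "space haar = unitary_group"
  and sets_haar [measurable_cong]: "sets haar = sets (restrict_space borel unitary_group)"
  using is_form_measure_haar by (auto simp: is_form_measure_def)

lemma emeasure_haar_chart:
  assumes "h \<in> unitary_group" "B \<in> sets borel"
  shows "emeasure haar (unitary_chart h ` B) = (\<integral>\<^sup>+x\<in>B. ennreal (cayley_density x) \<partial>lborel)"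
  using unitary.is_form_measure_chart[OF is_form_measure_haar smooth_chart_unitary[OF assms(1)] assms(2)]
  by (simp add: form_density_unitary_chart[OF assms(1)])

lemma measurable_left_mult_haar:
  assumes "k \<in> unitary_group"
  shows "(\<lambda>g. k ** g) \<in> haar \<rightarrow>\<^sub>M haar"
proof -
  have "(\<lambda>g. k ** g) \<in> borel \<rightarrow>\<^sub>M borel"
    by (intro borel_measurable_continuous_onI continuous_intros)
  then have "(\<lambda>g. k ** g) \<in> restrict_space borel unitary_group \<rightarrow>\<^sub>M restrict_space borel unitary_group"
    using assms by (intro measurable_restrict_space3) (auto intro: unitary_group_mult)
  then show ?thesis by (simp cong: measurable_cong_sets add: sets_haar)
qed

text \<open>Translation by \<open>k\<close> carries the chart at
  \<open>adjoint_matrix k ** h\<close> to the chart at \<open>h\<close> without changing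
  coordinates, and the density does not depend on the base point. Uniqueness of the form measure
  finishes the argument.\<close>

theorem haar_left_invariant:
  assumes k: "k \<in> unitary_group"
  shows "distr haar haar (\<lambda>g. k ** g) = haar"
proof -
  have "is_form_measure unitary_group unitary_form (distr haar haar (\<lambda>g. k ** g))"
  proof (rule unitary.is_form_measureI)
    fix n and B :: "('a hcoord) set" assume B: "B \<in> sets borel"
    let ?h = "atlas_point n :: 'a cmat"
    have ad: "adjoint_matrix k ** ?h \<in> unitary_group"
      using k by (intro unitary_group_mult unitary_group_adjoint atlas_point)
    have "unitary_chart ?h ` B \<in> sets haar"
      unfolding sets_haar
      by (rule unitary.parametrization_image_measurable[OF unitary.chart_parametrization B]) simp
    then have "emeasure (distr haar haar (\<lambda>g. k ** g)) (unitary_chart ?h ` B)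
      = emeasure haar ((\<lambda>g. k ** g) -` (unitary_chart ?h ` B) \<inter> unitary_group)"
      using emeasure_distr[OF measurable_left_mult_haar[OF k]] by simp
    also have "(\<lambda>g. k ** g) -` (unitary_chart ?h ` B) \<inter> unitary_group = unitary_chart (adjoint_matrix k ** ?h) ` B"
    proof (intro equalityI subsetI)
      fix g assume "g \<in> (\<lambda>g. k ** g) -` (unitary_chart ?h ` B) \<inter> unitary_group"
      then obtain x where x: "x \<in> B" "k ** g = unitary_chart ?h x" by auto
      have "g = adjoint_matrix k ** (k ** g)" using k by simp
      also have "\<dots> = unitary_chart (adjoint_matrix k ** ?h) x"
        unfolding x(2) by (simp add: unitary_chart_def matrix_mul_assoc)
      finally show "g \<in> unitary_chart (adjoint_matrix k ** ?h) ` B" using x(1) by blast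
    next
      fix g assume "g \<in> unitary_chart (adjoint_matrix k ** ?h) ` B"
      then obtain x where x: "x \<in> B" "g = unitary_chart (adjoint_matrix k ** ?h) x" by auto
      have "k ** g = unitary_chart ?h x"
        unfolding x(2) using k by (simp add: unitary_chart_def flip: matrix_mul_assoc)
      moreover have "g \<in> unitary_group" using x(2) unitary_chart_unitary[OF ad] by simp
      ultimately show "g \<in> (\<lambda>g. k ** g) -` (unitary_chart ?h ` B) \<inter> unitary_group" using x(1) by simp
    qed
    also have "emeasure haar (unitary_chart (adjoint_matrix k ** ?h) ` B) = (\<integral>\<^sup>+x\<in>B. ennreal (cayley_density x) \<partial>lborel)"
      by (rule emeasure_haar_chart[OF ad B])
    finally show "emeasure (distr haar haar (\<lambda>g. k ** g)) (unitary_chart ?h ` B)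
      = (\<integral>\<^sup>+x\<in>B. ennreal (form_density unitary_form (unitary_chart ?h) x) \<partial>lborel)"
      by (simp add: form_density_unitary_chart atlas_point)
  qed (simp_all add: sets_haar)
  then show ?thesis using unitary.is_form_measure_unique[OF _ is_form_measure_haar] by blast
qed

lemma norm_unitary:
  fixes g :: "complex^'n^'n"
  assumes "g \<in> unitary_group"
  shows "(norm g)\<^sup>2 = real CARD('n)"
proof -
  have "complex_of_real ((norm g)\<^sup>2) = complex_of_real (real CARD('n))"
    unfolding norm_power2_eq_trace unitary_groupD(1)[OF assms]
    by (simp add: trace_def Finite_Cartesian_Product.mat_def)
  then show ?thesis by (simp only: of_real_eq_iff)
qed

lemma compact_unitary_group: "compact (unitary_group :: (complex^'n^'n) set)"
proof -
  have "norm g \<le> sqrt (real CARD('n))" if "g \<in> unitary_group" for g :: "complex^'n^'n"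
    using norm_unitary[OF that] by (simp add: real_le_rsqrt)
  then have "bounded (unitary_group :: (complex^'n^'n) set)" by (auto simp: bounded_iff)
  then show ?thesis using closed_unitary_group by (simp add: compact_eq_bounded_closed)
qed

text \<open>Compactness: finitely many chart images of the unit ball cover the group, and the
  density is bounded on the closed ball.\<close>

lemma haar_finite: "emeasure haar (unitary_group :: ('a::{finite,wellorder} cmat) set) < \<infinity>"
proof -
  let ?B = "ball (0 :: 'a hcoord) 1"
  let ?V = "\<lambda>h :: 'a cmat. unitary_chart h ` ?B"
  have op: "openin (top_of_set unitary_group) (?V h)" if "h \<in> unitary_group" for h :: "'a cmat"
  proof -
    have par: "local_parametrization unitary_group UNIV (unitary_chart h)"
      using smooth_chart_unitary[OF that] by (simp add: smooth_chart_def)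
    then obtain r where "homeomorphism UNIV (range (unitary_chart h)) (unitary_chart h) r"
      by (auto simp: local_parametrization_def)
    then have "openin (top_of_set (range (unitary_chart h))) (?V h)"
      by (rule homeomorphism_imp_open_map) simp
    then show ?thesis by (rule openin_trans[OF _ openin_range_unitary_chart[OF that]])
  qed
  have "\<exists>T. open T \<and> ?V h = unitary_group \<inter> T" if "h \<in> unitary_group" for h :: "'a cmat"
    using op[OF that] by (auto simp: openin_open)
  then obtain T where T: "\<And>h :: 'a cmat. h \<in> unitary_group \<Longrightarrow> open (T h) \<and> ?V h = unitary_group \<inter> T h"
    by metis
  have self: "h \<in> T h" if "h \<in> unitary_group" for h
  proof -
    have "h = unitary_chart h 0" by (simp add: unitary_chart_def)
    then have "h \<in> ?V h" by (rule image_eqI[of _ _ 0]) simp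
    then show ?thesis using T[OF that] by blast
  qed
  obtain D where D: "D \<subseteq> unitary_group" "finite D" "unitary_group \<subseteq> (\<Union>h\<in>D. T h)"
    using compactE_image[OF compact_unitary_group, of unitary_group T] T self by (metis UN_I subsetI)
  have fin: "emeasure haar (?V h) < \<infinity>" if "h \<in> unitary_group" for h :: "'a cmat"
  proof -
    have "compact (cayley_density ` cball (0 :: 'a hcoord) 1)"
      by (intro compact_continuous_image continuous_cayley_density compact_cball)
    then obtain C where C: "\<And>x :: 'a hcoord. x \<in> cball 0 1 \<Longrightarrow> cayley_density x \<le> C"
      using compact_imp_bounded bounded_iff by (metis (no_types, lifting) abs_le_D1 imageI real_norm_def)
    have "emeasure haar (?V h) = (\<integral>\<^sup>+x\<in>?B. ennreal (cayley_density x) \<partial>lborel)"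
      using that by (simp add: emeasure_haar_chart)
    also have "\<dots> \<le> (\<integral>\<^sup>+x. ennreal C * indicator ?B x \<partial>lborel)"
      using C by (intro nn_integral_mono) (auto simp: indicator_def intro!: ennreal_leI)
    also have "\<dots> = ennreal C * emeasure lborel ?B"
      by (simp add: nn_integral_cmult_indicator)
    also have "\<dots> < \<infinity>"
      using emeasure_bounded_finite[of ?B] by (simp add: ennreal_mult_less_top)
    finally show ?thesis .
  qed
  have mV: "?V h \<in> sets haar" if "h \<in> unitary_group" for h :: "'a cmat"
    unfolding sets_haar using smooth_chart_unitary[OF that]
    by (intro unitary.parametrization_image_measurable[of UNIV]) (auto simp: smooth_chart_def)
  have "unitary_group \<subseteq> (\<Union>h\<in>D. ?V h)"
  proof
    fix g :: "'a cmat" assume g: "g \<in> unitary_group"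
    then obtain h where "h \<in> D" "g \<in> T h" using D(3) by blast
    then show "g \<in> (\<Union>h\<in>D. ?V h)" using T[of h] D(1) g by blast
  qed
  then have "emeasure haar (unitary_group :: 'a cmat set) \<le> emeasure haar (\<Union>h\<in>D. ?V h)"
    using D mV by (intro emeasure_mono sets.finite_UN) auto
  also have "\<dots> \<le> (\<Sum>h\<in>D. emeasure haar (?V h))"
    using D mV by (intro emeasure_subadditive_finite) auto
  also have "\<dots> < \<infinity>"
    using D fin by (simp add: subset_iff)
  finally show ?thesis .
qed

text \<open>One chart suffices: near 0 the density stays above half of its positive value at
  0.\<close>

lemma haar_pos: "emeasure haar (unitary_group :: ('a::{finite,wellorder} cmat) set) > 0"
proof -
  have "cayley_density \<midarrow>(0 :: 'a hcoord)\<rightarrow> cayley_density (0 :: 'a hcoord)"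
    using continuous_cayley_density[of "UNIV :: 'a hcoord set"] by (simp add: continuous_on_eq_continuous_at isCont_def)
  from order_tendstoD(1)[OF this, of "cayley_density (0 :: 'a hcoord) / 2"] cayley_density_0
  obtain e where e: "e > 0" "\<And>x :: 'a hcoord. x \<noteq> 0 \<Longrightarrow> dist x 0 < e \<Longrightarrow> cayley_density x > cayley_density (0 :: 'a hcoord) / 2"
    unfolding eventually_at by (auto simp: dist_norm)
  let ?B = "ball (0 :: 'a hcoord) e"
  let ?c = "cayley_density (0 :: 'a hcoord) / 2"
  have "0 < ennreal ?c * emeasure lborel ?B"
  proof -
    have "emeasure lborel ?B = ennreal (measure lborel ?B)"
      using emeasure_lborel_ball_finite[of "0 :: 'a hcoord" e] by (intro emeasure_eq_ennreal_measure) auto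
    then show ?thesis
      using cayley_density_0[where 'n='a] content_ball_pos[OF e(1), of "0 :: 'a hcoord"]
      by (simp add: ennreal_zero_less_mult_iff)
  qed
  also have "\<dots> = (\<integral>\<^sup>+x. ennreal ?c * indicator ?B x \<partial>lborel)"
    by (simp add: nn_integral_cmult_indicator)
  also have "\<dots> \<le> (\<integral>\<^sup>+x\<in>?B. ennreal (cayley_density x) \<partial>lborel)"
  proof (intro nn_integral_mono)
    fix x :: "'a hcoord"
    show "ennreal ?c * indicator ?B x \<le> ennreal (cayley_density x) * indicator ?B x"
      using e(2)[of x] cayley_density_0[where 'n='a]
      by (cases "x = 0") (auto simp: indicator_def dist_commute intro!: ennreal_leI)
  qed
  also have "\<dots> = emeasure haar (unitary_chart (mat 1) ` ?B)"
    by (simp add: emeasure_haar_chart unitary_group_one)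
  also have "\<dots> \<le> emeasure haar (space (haar :: 'a cmat measure))" by (rule emeasure_space)
  finally show ?thesis by simp
qed

section \<open>Evaluation of the Liouville form\<close>

lemma linear_times_const:
  fixes f :: "'a::real_vector \<Rightarrow> real"
  shows "linear f \<Longrightarrow> linear (\<lambda>x. c * f x)"
  by (rule linearI) (simp_all add: linear_add linear_scale algebra_simps)

lemma linear_in_one_factor:
  fixes \<omega> :: "'v::real_vector \<Rightarrow> 'v \<Rightarrow> real" and v :: "'d::finite + 'd \<Rightarrow> 'v"
  assumes lin1: "\<And>v. linear (\<lambda>u. \<omega> u v)" and lin2: "\<And>u. linear (\<omega> u)"
    and \<sigma>: "\<sigma> permutes (UNIV :: ('d + 'd) set)"
  shows "linear (\<lambda>x. \<Prod>d\<in>UNIV. \<omega> ((v(i := x)) (\<sigma> (Inl d))) ((v(i := x)) (\<sigma> (Inr d))))"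
proof -
  have inj: "inj \<sigma>" using \<sigma> by (rule permutes_inj)
  obtain s where s: "\<sigma> s = i" using permutes_surj[OF \<sigma>] by (metis surjD)
  \<comment> \<open>The index \<open>i\<close> occupies exactly one slot \<open>s\<close> of the
    permuted arrangement. \<open>d0\<close> is the pair containing that slot; all other factors are
    constant in the varied vector.\<close>
  define d0 where "d0 = (case s of Inl d \<Rightarrow> d | Inr d \<Rightarrow> d)"
  have ne: "\<sigma> (Inl d) \<noteq> i" "\<sigma> (Inr d) \<noteq> i" if "d \<noteq> d0" for d
    using that s inj by (auto simp: d0_def inj_eq split: sum.splits)
  let ?f = "\<lambda>d. \<omega> (v (\<sigma> (Inl d))) (v (\<sigma> (Inr d)))"
  have "(\<lambda>x. \<Prod>d\<in>UNIV. \<omega> ((v(i := x)) (\<sigma> (Inl d))) ((v(i := x)) (\<sigma> (Inr d))))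
    = (\<lambda>x. (\<Prod>d\<in>UNIV - {d0}. ?f d) * \<omega> ((v(i := x)) (\<sigma> (Inl d0))) ((v(i := x)) (\<sigma> (Inr d0))))"
    by (subst prod.remove[of _ d0]) (auto simp: ne intro!: ext prod.cong)
  moreover have "linear (\<lambda>x. \<omega> ((v(i := x)) (\<sigma> (Inl d0))) ((v(i := x)) (\<sigma> (Inr d0))))"
  proof (cases s)
    case (Inl d)
    then have "\<sigma> (Inl d0) = i" "\<sigma> (Inr d0) \<noteq> i" using s inj by (auto simp: d0_def inj_eq)
    then show ?thesis using lin1 by simp
  next
    case (Inr d)
    then have "\<sigma> (Inr d0) = i" "\<sigma> (Inl d0) \<noteq> i" using s inj by (auto simp: d0_def inj_eq)
    then show ?thesis using lin2 by simp
  qed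
  ultimately show ?thesis by (simp only: linear_times_const)
qed

lemma alternating_multilinear_liouville_form:
  fixes \<omega> :: "'v::real_vector \<Rightarrow> 'v \<Rightarrow> real"
  assumes lin1: "\<And>v. linear (\<lambda>u. \<omega> u v)" and lin2: "\<And>u. linear (\<omega> u)"
  shows "alternating_multilinear (liouville_form \<omega> :: ('d::finite + 'd \<Rightarrow> 'v) \<Rightarrow> real)"
  unfolding alternating_multilinear_def
proof (intro conjI allI impI)
  fix v :: "'d + 'd \<Rightarrow> 'v" and i
  have "linear (\<lambda>x. (\<Sum>\<sigma> | \<sigma> permutes (UNIV :: ('d + 'd) set). of_int (sign \<sigma>) *
      (\<Prod>d\<in>UNIV. \<omega> ((v(i := x)) (\<sigma> (Inl d))) ((v(i := x)) (\<sigma> (Inr d))))))"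
    by (intro linear_compose_sum ballI linear_times_const linear_in_one_factor lin1 lin2) simp
  from linear_times_const[OF this, of "1 / 2 ^ CARD('d) / fact CARD('d)"]
  show "linear (\<lambda>x. liouville_form \<omega> (v(i := x)))"
    by (simp add: liouville_form_def field_simps)
next
  fix v :: "'d + 'd \<Rightarrow> 'v" and i j assume ij: "i \<noteq> j" "v i = v j"
  let ?P = "{\<sigma>. \<sigma> permutes (UNIV :: ('d + 'd) set)}" and ?t = "Transposition.transpose i j"
  let ?T = "\<lambda>\<sigma>. of_int (sign \<sigma>) * (\<Prod>d\<in>UNIV. \<omega> (v (\<sigma> (Inl d))) (v (\<sigma> (Inr d))))"
  have t: "?t permutes UNIV" by (rule permutes_swap_id) simp_all
  have vt: "v (?t x) = v x" for x using ij by (simp add: Transposition.transpose_def)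
  \<comment> \<open>Composition with the transposition permutes the terms and flips each sign, while
    the values stay the same because \<open>v i = v j\<close>. The sum therefore equals its own
    negative.\<close>
  have "sum ?T ?P = sum (\<lambda>\<sigma>. ?T (?t \<circ> \<sigma>)) ?P"
    by (rule sum.reindex_bij_betw[symmetric], rule bij_betwI[of _ _ _ "\<lambda>\<sigma>. ?t \<circ> \<sigma>"])
      (auto intro: permutes_compose t simp flip: comp_assoc)
  also have "\<dots> = sum (\<lambda>\<sigma>. - ?T \<sigma>) ?P"
  proof (rule sum.cong)
    fix \<sigma> assume "\<sigma> \<in> ?P"
    then have "sign (?t \<circ> \<sigma>) = - sign \<sigma>"
      using ij by (simp add: sign_compose permutation_swap_id sign_swap_id permutes_imp_permutation[of UNIV])
    then show "?T (?t \<circ> \<sigma>) = - ?T \<sigma>" by (simp add: vt)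
  qed simp
  finally have "sum ?T ?P = 0" by (simp add: sum_negf)
  then show "liouville_form \<omega> v = 0" by (simp add: liouville_form_def)
qed

text \<open>Each transposition of indices acts once on the left and once on the right summand, so
  the sign is a square.\<close>

lemma sign_map_sum_same:
  assumes "\<tau> permutes (UNIV :: 'd::finite set)"
  shows "map_sum \<tau> \<tau> permutes UNIV \<and> sign (map_sum \<tau> \<tau>) = 1"
proof -
  obtain n where "swapidseq n \<tau>"
    using permutes_imp_permutation[OF finite assms] unfolding permutation_def by blast
  then show ?thesis
  proof (induction rule: swapidseq.induct)
    case id
    have "map_sum id id = (id :: 'd + 'd \<Rightarrow> 'd + 'd)" by (rule sum.map_id0)
    then show ?case by (simp only: permutes_id sign_id simp_thms)
  next
    case (comp_Suc n p a b)
    let ?t = "Transposition.transpose (Inl a) (Inl b) \<circ> Transposition.transpose (Inr a) (Inr b) :: 'd + 'd \<Rightarrow> 'd + 'd"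
    have t: "?t permutes UNIV"
      by (intro permutes_compose permutes_swap_id) simp_all
    have "sign ?t = 1"
      using comp_Suc by (simp add: sign_compose permutation_swap_id sign_swap_id)
    moreover have "map_sum (Transposition.transpose a b \<circ> p) (Transposition.transpose a b \<circ> p) = ?t \<circ> map_sum p p"
    proof
      fix x :: "'d + 'd"
      show "map_sum (Transposition.transpose a b \<circ> p) (Transposition.transpose a b \<circ> p) x = (?t \<circ> map_sum p p) x"
        by (cases x) (auto simp: Transposition.transpose_def)
    qed
    moreover have "?t \<circ> map_sum p p permutes UNIV"
      using comp_Suc by (intro permutes_compose[OF _ t]) auto
    moreover have "sign (?t \<circ> map_sum p p) = sign ?t * sign (map_sum p p)"
      using comp_Suc t by (intro sign_compose permutes_imp_permutation[of UNIV]) auto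
    ultimately show ?case using comp_Suc by (simp only: mult_1_left simp_thms)
  qed
qed

definition swap_pairs :: "'d set \<Rightarrow> 'd + 'd \<Rightarrow> 'd + 'd" where
  "swap_pairs B x = (case x of Inl d \<Rightarrow> if d \<in> B then Inr d else Inl d | Inr d \<Rightarrow> if d \<in> B then Inl d else Inr d)"

lemma sign_swap_pairs:
  fixes B :: "'d::finite set"
  shows "swap_pairs B permutes UNIV \<and> sign (swap_pairs B) = (- 1) ^ card B"
proof (induction B rule: finite_induct[OF finite])
  case 1
  have "swap_pairs {} = (id :: 'd + 'd \<Rightarrow> _)" by (auto simp: swap_pairs_def fun_eq_iff split: sum.splits)
  then show ?case by (simp only: permutes_id sign_id card.empty power_0 simp_thms)
next
  case (2 b B)
  let ?t = "Transposition.transpose (Inl b) (Inr b) :: 'd + 'd \<Rightarrow> _"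
  have eq: "swap_pairs (insert b B) = ?t \<circ> swap_pairs B"
    using 2 by (auto simp: swap_pairs_def Transposition.transpose_def fun_eq_iff split: sum.splits)
  have t: "?t permutes UNIV"
    by (rule permutes_swap_id) simp_all
  have "?t \<circ> swap_pairs B permutes UNIV"
    using 2 by (intro permutes_compose[OF _ t]) auto
  moreover have "sign (?t \<circ> swap_pairs B) = sign ?t * sign (swap_pairs B)"
    using 2 t by (intro sign_compose permutes_imp_permutation[of UNIV]) auto
  moreover have "sign ?t * sign (swap_pairs B) = (- 1) ^ card (insert b B)"
    using 2 by (simp add: sign_swap_id)
  ultimately show ?case unfolding eq by (simp only: simp_thms)
qed

text \<open>The hyperoctahedral group: these are the permutations whose terms survive in the
  Liouville sum over a Darboux frame.\<close>

definition pairings :: "('d::finite + 'd \<Rightarrow> 'd + 'd) set" where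
  "pairings = {\<sigma>. \<sigma> permutes UNIV \<and> (\<forall>d. \<exists>e. {\<sigma> (Inl d), \<sigma> (Inr d)} = {Inl e, Inr e})}"

text \<open>
  The only surviving terms send pairs to pairs, and the sign of such a permutation is cancelled
  by the antisymmetry of \<open>\<omega>\<close> on the pairs that it flips.
\<close>

lemma liouville_form_darboux:
  fixes v :: "'d::finite + 'd \<Rightarrow> 'v"
  assumes anti: "\<And>x y. \<omega> x y = - \<omega> y x"
    and rr: "\<And>d e. \<omega> (v (Inr d)) (v (Inr e)) = 0"
    and lr: "\<And>d e. \<omega> (v (Inl d)) (v (Inr e)) = (if d = e then 1 else 0)"
  shows "liouville_form \<omega> v = real (card (pairings :: ('d + 'd \<Rightarrow> 'd + 'd) set)) / 2 ^ CARD('d) / fact CARD('d)"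
proof -
  let ?T = "\<lambda>\<sigma>. of_int (sign \<sigma>) * (\<Prod>d\<in>UNIV. \<omega> (v (\<sigma> (Inl d))) (v (\<sigma> (Inr d))))"
  have rl: "\<omega> (v (Inr d)) (v (Inl e)) = (if d = e then -1 else 0)" for d e
    using anti[of "v (Inr d)" "v (Inl e)"] lr[of e d] by auto
  have one: "?T \<sigma> = 1" if \<sigma>: "\<sigma> \<in> pairings" for \<sigma>
  proof -
    have perm: "\<sigma> permutes UNIV" using \<sigma> by (simp add: pairings_def)
    obtain \<tau> where \<tau>: "\<And>d. {\<sigma> (Inl d), \<sigma> (Inr d)} = {Inl (\<tau> d), Inr (\<tau> d)}"
      using \<sigma> unfolding pairings_def by (auto simp del: insert_iff dest!: choice)
    define B where "B = {d. \<sigma> (Inl d) = Inr (\<tau> d)}"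
    have c: "(d \<notin> B \<and> \<sigma> (Inl d) = Inl (\<tau> d) \<and> \<sigma> (Inr d) = Inr (\<tau> d)) \<or>
       (d \<in> B \<and> \<sigma> (Inl d) = Inr (\<tau> d) \<and> \<sigma> (Inr d) = Inl (\<tau> d))" for d
      using \<tau>[of d] unfolding B_def by (auto simp: doubleton_eq_iff)
    have "inj \<tau>"
    proof (rule injI)
      fix d e assume "\<tau> d = \<tau> e"
      then have "\<sigma> (Inl d) = \<sigma> (Inl e) \<or> \<sigma> (Inl d) = \<sigma> (Inr e)"
        using c[of d] c[of e] by auto
      then have "Inl d = (Inl e :: 'd + 'd) \<or> Inl d = (Inr e :: 'd + 'd)"
        using permutes_inj[OF perm] by (simp add: inj_eq)
      then show "d = e" by simp
    qed
    then have \<tau>p: "\<tau> permutes UNIV"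
      by (intro bij_imp_permutes) (auto simp: bij_betw_def finite_UNIV_inj_surj)
    \<comment> \<open>Flip the pairs in \<open>B\<close>, then move the pairs by
      \<open>\<tau>\<close>. The move is even, so the sign only counts the flips.\<close>
    have "\<sigma> = map_sum \<tau> \<tau> \<circ> swap_pairs B"
    proof (rule ext)
      fix x show "\<sigma> x = (map_sum \<tau> \<tau> \<circ> swap_pairs B) x"
        using c by (cases x) (auto simp: swap_pairs_def)
    qed
    then have "sign \<sigma> = (- 1) ^ card B"
      using sign_map_sum_same[OF \<tau>p] sign_swap_pairs[of B]
      by (simp add: sign_compose permutes_imp_permutation[of UNIV])
    moreover have "\<omega> (v (\<sigma> (Inl d))) (v (\<sigma> (Inr d))) = (if d \<in> B then -1 else 1)" for d
      using c[of d] by (auto simp: lr rl)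
    then have "(\<Prod>d\<in>UNIV. \<omega> (v (\<sigma> (Inl d))) (v (\<sigma> (Inr d)))) = (- 1) ^ card B"
      by (simp add: prod.If_cases)
    ultimately show ?thesis by (simp flip: power_mult_distrib)
  qed
  have zero: "?T \<sigma> = 0" if perm: "\<sigma> permutes UNIV" and np: "\<sigma> \<notin> pairings" for \<sigma>
  proof (rule ccontr)
    assume "?T \<sigma> \<noteq> 0"
    then have nz: "\<omega> (v (\<sigma> (Inl d))) (v (\<sigma> (Inr d))) \<noteq> 0" for d by auto
    \<comment> \<open>The form may be nonzero on two \<open>Inl\<close> vectors, and for two base
      directions of the cotangent bundle it is in general. Such terms are excluded by counting: each
      \<open>Inr e\<close> has to be paired with \<open>Inl e\<close>, and this uses up all
      pairs.\<close>
    define f :: "'d \<Rightarrow> 'd" where "f e = (case inv_into UNIV \<sigma> (Inr e) of Inl d \<Rightarrow> d | Inr d \<Rightarrow> d)" for e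
    have fe: "\<sigma> (Inl (f e)) = Inr e \<or> \<sigma> (Inr (f e)) = Inr e" for e
    proof -
      have "\<sigma> (inv_into UNIV \<sigma> (Inr e)) = Inr e" using permutes_inverses(1)[OF perm] by simp
      then show ?thesis by (cases "inv_into UNIV \<sigma> (Inr e)") (auto simp: f_def)
    qed
    have mixed: "\<sigma> (Inl (f e)) = Inr e \<and> \<sigma> (Inr (f e)) = Inl e \<or> \<sigma> (Inl (f e)) = Inl e \<and> \<sigma> (Inr (f e)) = Inr e" for e
      using fe[of e] nz[of "f e"]
      by (cases "\<sigma> (Inl (f e))"; cases "\<sigma> (Inr (f e))") (auto simp: rr lr rl split: if_splits)
    have pair: "{\<sigma> (Inl (f e)), \<sigma> (Inr (f e))} = {Inl e, Inr e}" for e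
      using mixed[of e] by (elim disjE conjE) (simp_all add: insert_commute)
    have "inj f"
    proof (rule injI)
      fix d e assume "f d = f e"
      then have "{Inl d, Inr d} = {Inl e, Inr e :: 'd + 'd}" using pair[of d] pair[of e] by (simp only:)
      then show "d = e" by (simp add: doubleton_eq_iff)
    qed
    then have "surj f" by (simp add: finite_UNIV_inj_surj)
    have "\<exists>e. {\<sigma> (Inl d), \<sigma> (Inr d)} = {Inl e, Inr e}" for d
    proof -
      obtain e where "d = f e" using \<open>surj f\<close> by (rule surjE)
      then show ?thesis using pair[of e] by blast
    qed
    then show False using np perm unfolding pairings_def by blast
  qed
  have "(\<Sum>\<sigma> | \<sigma> permutes (UNIV :: ('d + 'd) set). ?T \<sigma>) = (\<Sum>\<sigma>\<in>pairings. ?T \<sigma>)"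
    by (rule sum.mono_neutral_right) (use zero in \<open>auto simp: finite_permutations\<close>, simp add: pairings_def)
  also have "\<dots> = real (card (pairings :: ('d + 'd \<Rightarrow> 'd + 'd) set))"
    using one by simp
  finally show ?thesis by (simp add: liouville_form_def)
qed

text \<open>The identity is a pairing, so the Liouville constant below cannot vanish.\<close>

lemma card_pairings_pos: "card (pairings :: ('d::finite + 'd \<Rightarrow> 'd + 'd) set) > 0"
proof -
  have "finite (pairings :: ('d + 'd \<Rightarrow> 'd + 'd) set)"
    by (rule finite_subset[OF _ finite_permutations[of UNIV]]) (auto simp: pairings_def)
  moreover have "id \<in> (pairings :: ('d + 'd \<Rightarrow> 'd + 'd) set)"
    by (auto simp: pairings_def permutes_id)
  ultimately show ?thesis by (auto simp: card_gt_0_iff)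
qed

section \<open>The Liouville measure\<close>

definition inl_part :: "real^('a::finite + 'b::finite) \<Rightarrow> real^'a::_" where "inl_part z = (\<chi> i. z $ Inl i)"
definition inr_part :: "real^('a::finite + 'b::finite) \<Rightarrow> real^'b::_" where "inr_part z = (\<chi> i. z $ Inr i)"
definition sum_vec :: "real^'a::finite \<Rightarrow> real^'b::finite \<Rightarrow> real^('a::_ + 'b::_)" where
  "sum_vec x y = (\<chi> s. case s of Inl i \<Rightarrow> x $ i | Inr j \<Rightarrow> y $ j)"

lemma parts_sum_vec [simp]: "inl_part (sum_vec x y) = x" "inr_part (sum_vec x y) = y"
  by (simp_all add: inl_part_def inr_part_def sum_vec_def)

lemma sum_vec_parts [simp]: "sum_vec (inl_part z) (inr_part z) = z"
  by (rule vec_eqI) (auto simp: inl_part_def inr_part_def sum_vec_def split: sum.splits)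

lemma linear_parts: "linear (inl_part :: real^('a::finite + 'b::finite) \<Rightarrow> _)" "linear (inr_part :: real^('a::finite + 'b::finite) \<Rightarrow> _)"
  by (intro linearI vec_eqI; simp add: inl_part_def inr_part_def)+

lemma bounded_linear_parts:
  "bounded_linear (inl_part :: real^('a::finite + 'b::finite) \<Rightarrow> _)"
  "bounded_linear (inr_part :: real^('a::finite + 'b::finite) \<Rightarrow> _)"
  by (rule linear_conv_bounded_linear[THEN iffD1, OF linear_parts(1)],
      rule linear_conv_bounded_linear[THEN iffD1, OF linear_parts(2)])

lemma bounded_linear_sum_vec:
  "bounded_linear (\<lambda>p. sum_vec (fst p) (snd p) :: real^('a::finite + 'b::finite))"
proof (rule linear_conv_bounded_linear[THEN iffD1], rule linearI)
  show "sum_vec (fst (p + q)) (snd (p + q)) = (sum_vec (fst p) (snd p) + sum_vec (fst q) (snd q) :: real^('a + 'b))" for p q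
    by (rule vec_eqI) (auto simp: sum_vec_def split: sum.splits)
  show "sum_vec (fst (c *\<^sub>R p)) (snd (c *\<^sub>R p)) = (c *\<^sub>R sum_vec (fst p) (snd p) :: real^('a + 'b))" for c p
    by (rule vec_eqI) (auto simp: sum_vec_def split: sum.splits)
qed

lemma continuous_sum_vec: "continuous_on S (\<lambda>p. sum_vec (fst p) (snd p) :: real^('a::finite + 'b::finite))"
  by (rule linear_continuous_on[OF bounded_linear_sum_vec])

lemma measurable_sum_vec [measurable]:
  "(\<lambda>(x, y). sum_vec x y) \<in> (borel :: (real^'a::finite) measure) \<Otimes>\<^sub>M (borel :: (real^'b::finite) measure) \<rightarrow>\<^sub>M borel"
  unfolding borel_prod case_prod_beta by (intro borel_measurable_continuous_onI continuous_sum_vec)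

lemma emeasure_box_vec:
  fixes l u :: "real^'n"
  assumes "\<And>i. l $ i \<le> u $ i"
  shows "emeasure lborel (box l u) = ennreal (\<Prod>i\<in>UNIV. u $ i - l $ i)"
proof -
  have "l \<bullet> b \<le> u \<bullet> b" if "b \<in> Basis" for b
    using that assms by (auto simp: Basis_vec_def inner_axis)
  then show ?thesis using emeasure_lborel_box[of l u] by (simp add: prod_Basis_vec inner_axis)
qed

text \<open>Checked on boxes, where both sides are products over the two blocks of indices.\<close>

lemma distr_sum_vec:
  "distr (lborel \<Otimes>\<^sub>M lborel) borel (\<lambda>(x, y). sum_vec x y) = (lborel :: (real^('a::finite + 'b::finite)) measure)"
proof (rule lborel_eqI[symmetric])
  fix l u :: "real^('a + 'b)" assume le: "\<And>b. b \<in> Basis \<Longrightarrow> l \<bullet> b \<le> u \<bullet> b"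
  have le': "l $ s \<le> u $ s" for s
    using le[of "axis s 1"] by (auto simp: Basis_vec_def inner_axis)
  have pre: "(\<lambda>(x, y). sum_vec x y) -` box l u \<inter> space (lborel \<Otimes>\<^sub>M lborel)
    = box (inl_part l) (inl_part u) \<times> box (inr_part l) (inr_part u)"
    by (auto simp: box_vec_eq sum_vec_def inl_part_def inr_part_def space_pair_measure split: sum.splits)
  have "emeasure (distr (lborel \<Otimes>\<^sub>M lborel) borel (\<lambda>(x, y). sum_vec x y)) (box l u)
     = emeasure (lborel \<Otimes>\<^sub>M lborel) (box (inl_part l) (inl_part u) \<times> box (inr_part l) (inr_part u))"
    by (subst emeasure_distr) (simp_all add: pre)
  also have "\<dots> = emeasure lborel (box (inl_part l) (inl_part u)) * emeasure lborel (box (inr_part l) (inr_part u))"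
    by (rule lborel.emeasure_pair_measure_Times) simp_all
  also have "\<dots> = ennreal (\<Prod>i\<in>UNIV. u $ Inl i - l $ Inl i) * ennreal (\<Prod>i\<in>UNIV. u $ Inr i - l $ Inr i)"
    using le' by (simp add: emeasure_box_vec inl_part_def inr_part_def)
  also have "\<dots> = ennreal ((\<Prod>i\<in>UNIV. u $ Inl i - l $ Inl i) * (\<Prod>i\<in>UNIV. u $ Inr i - l $ Inr i))"
    using le' by (subst ennreal_mult) (auto intro!: prod_nonneg)
  also have "(\<Prod>i\<in>UNIV. u $ Inl i - l $ Inl i) * (\<Prod>i\<in>UNIV. u $ Inr i - l $ Inr i) = (\<Prod>s\<in>UNIV. u $ s - l $ s)"
    using prod.Plus[of "UNIV :: 'a set" "UNIV :: 'b set" "\<lambda>s. u $ s - l $ s"]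
    by (simp only: UNIV_Plus_UNIV finite_UNIV finite o_def)
  also have "\<dots> = (\<Prod>b\<in>Basis. (u - l) \<bullet> b)"
    unfolding prod_Basis_vec by (simp add: inner_axis)
  finally show "emeasure (distr (lborel \<Otimes>\<^sub>M lborel) borel (\<lambda>(x, y). sum_vec x y)) (box l u) = (\<Prod>b\<in>Basis. (u - l) \<bullet> b)" .
qed simp

lemma trace_scaleR: "trace (c *\<^sub>R A) = c *\<^sub>R trace (A :: complex^'n^'n)"
  by (simp add: trace_def scaleR_sum_right)

lemma bounded_linear_trace: "bounded_linear (trace :: complex^'n^'n \<Rightarrow> complex)"
  by (rule linear_conv_bounded_linear[THEN iffD1], rule linearI) (simp_all add: trace_add trace_scaleR)

lemma tautological_form_has_derivative:
  fixes p v :: "(complex^'n^'n) \<times> (complex^'n^'n)"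
  shows "((\<lambda>q. tautological_form q v) has_derivative
    (\<lambda>u. Im (trace (snd p ** (adjoint_matrix (fst u) ** fst v))) + Im (trace (snd u ** (adjoint_matrix (fst p) ** fst v))))) (at p)"
proof -
  have 1: "((\<lambda>q :: (complex^'n^'n) \<times> (complex^'n^'n). adjoint_matrix (fst q) ** fst v) has_derivative (\<lambda>u. adjoint_matrix (fst u) ** fst v)) (at p)"
    by (intro bounded_linear.has_derivative[OF matrix_mult.bounded_linear_left]
        bounded_linear.has_derivative[OF bounded_linear_adjoint_matrix] has_derivative_fst has_derivative_ident)
  have 2: "((\<lambda>q. snd q ** (adjoint_matrix (fst q) ** fst v)) has_derivative
    (\<lambda>u. snd p ** (adjoint_matrix (fst u) ** fst v) + snd u ** (adjoint_matrix (fst p) ** fst v))) (at p)"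
    by (rule has_derivative_matrix_mult[OF has_derivative_snd[OF has_derivative_ident] 1])
  show ?thesis
    using bounded_linear.has_derivative[OF bounded_linear_Im bounded_linear.has_derivative[OF bounded_linear_trace 2]]
    unfolding tautological_form_def trace_add plus_complex.sel .
qed

lemma canonical_form_eq:
  "canonical_form p u v =
     Im (trace (snd p ** (adjoint_matrix (fst v) ** fst u))) + Im (trace (snd v ** (adjoint_matrix (fst p) ** fst u)))
     - Im (trace (snd p ** (adjoint_matrix (fst u) ** fst v))) - Im (trace (snd u ** (adjoint_matrix (fst p) ** fst v)))"
  unfolding canonical_form_def frechet_derivative_at[OF tautological_form_has_derivative, symmetric] by simp

lemma canonical_form_antisymmetric: "canonical_form p u v = - canonical_form p v u"
  by (simp add: canonical_form_eq)

lemma linear_canonical_form: "linear (canonical_form p u)" "linear (\<lambda>u. canonical_form p u v)"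
proof -
  show *: "linear (canonical_form p u)" for u
    by (rule linearI)
      (simp_all add: canonical_form_eq adjoint_matrix_add adjoint_matrix_scaleR matrix_mult.add_left
        matrix_mult.add_right matrix_mult.scaleR_left matrix_mult.scaleR_right trace_add trace_scaleR algebra_simps)
  show "linear (\<lambda>u. canonical_form p u v)"
    unfolding canonical_form_antisymmetric[of p _ v] by (intro linear_compose_neg *)
qed

lemma continuous_canonical_form:
  assumes "continuous_on V f" "continuous_on V u" "continuous_on V v"
  shows "continuous_on V (\<lambda>x. canonical_form (f x) (u x) (v x))"
  unfolding canonical_form_eq using assms
  by (intro continuous_intros bounded_linear.continuous_on[OF bounded_linear_trace] continuous_adjoint_matrix)

abbreviation liouville_density_form ::
    "(complex^'n^'n) \<times> (complex^'n^'n) \<Rightarrow> (('n::finite \<times> 'n) + ('n \<times> 'n) \<Rightarrow> (complex^'n^'n) \<times> (complex^'n^'n)) \<Rightarrow> real" where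
  "liouville_density_form \<equiv> \<lambda>p v. liouville_form (canonical_form p) v"

lemma closed_hermitian_matrices: "closed (hermitian_matrices :: (complex^'n^'n) set)"
  unfolding hermitian_matrices_def by (intro closed_Collect_eq continuous_intros continuous_adjoint_matrix)

interpretation cotangent: volume_form
  "cotangent_unitary :: ('n::{finite,wellorder} cmat \<times> 'n cmat) set" liouville_density_form
proof
  show "closed (cotangent_unitary :: ('n cmat \<times> 'n cmat) set)"
    unfolding cotangent_unitary_def by (intro closed_Times closed_unitary_group closed_hermitian_matrices)
next
  show "liouville_density_form p (\<lambda>i. \<Sum>k\<in>UNIV. A $ i $ k *\<^sub>R w k) = Determinants.det A * liouville_density_form p w"
    for p :: "'n cmat \<times> 'n cmat" and A w
    by (rule alternating_multilinear_det[OF alternating_multilinear_liouville_form]) (rule linear_canonical_form)+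
next
  fix V :: "(real^(('n \<times> 'n) + ('n \<times> 'n))) set" and f :: "_ \<Rightarrow> 'n cmat \<times> 'n cmat"
    and v :: "('n \<times> 'n) + ('n \<times> 'n) \<Rightarrow> _ \<Rightarrow> 'n cmat \<times> 'n cmat"
  assume "continuous_on V f" "\<And>i. continuous_on V (v i)"
  then show "continuous_on V (\<lambda>x. liouville_density_form (f x) (\<lambda>i. v i x))"
    unfolding liouville_form_def
    by (intro continuous_on_divide continuous_on_sum continuous_on_mult continuous_on_const continuous_on_prod continuous_canonical_form)
      simp_all
qed

section \<open>Product charts on the cotangent bundle\<close>

definition cotangent_chart ::
    "'n::{finite,wellorder} cmat \<Rightarrow> real^(('n \<times> 'n) + ('n \<times> 'n)) \<Rightarrow> 'n cmat \<times> 'n cmat" where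
  "cotangent_chart h z = (unitary_chart h (inl_part z), hm (inr_part z))"

definition cotangent_chart_inv ::
    "'n::{finite,wellorder} cmat \<Rightarrow> 'n cmat \<times> 'n cmat \<Rightarrow> real^(('n \<times> 'n) + ('n \<times> 'n))" where
  "cotangent_chart_inv h p = sum_vec (unitary_chart_inv h (fst p)) (hermitian_coords (snd p))"

lemma range_cotangent_chart:
  fixes h :: "'n::{finite,wellorder} cmat"
  shows "range (cotangent_chart h) = range (unitary_chart h) \<times> hermitian_matrices"
proof (intro equalityI subsetI)
  fix p :: "'n cmat \<times> 'n cmat" assume "p \<in> range (unitary_chart h) \<times> hermitian_matrices"
  then obtain x where "fst p = unitary_chart h x" "snd p \<in> hermitian_matrices" by auto
  then have "p = cotangent_chart h (sum_vec x (hermitian_coords (snd p)))"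
    by (simp add: cotangent_chart_def hm_hermitian_coords prod_eq_iff)
  then show "p \<in> range (cotangent_chart h)" by (rule range_eqI)
qed (auto simp: cotangent_chart_def hm_hermitian)

lemma has_derivative_cotangent_chart:
  "(cotangent_chart h has_derivative (\<lambda>e.
     (unitary_chart h (inl_part z) ** (mat \<i> ** hm (cayley_form (inl_part z) (inl_part e))), hm (inr_part e)))) (at z)"
  unfolding cotangent_chart_def[abs_def]
  by (intro has_derivative_Pair
      has_derivative_compose[OF bounded_linear_imp_has_derivative[OF bounded_linear_parts(1)] has_derivative_unitary_chart]
      bounded_linear_imp_has_derivative bounded_linear_compose[OF bounded_linear_hm bounded_linear_parts(2)])

lemma smooth_chart_cotangent:
  assumes h: "h \<in> unitary_group"
  shows "smooth_chart cotangent_unitary (cotangent_chart h) (cotangent_chart_inv h)"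
proof (rule smooth_chartI)
  show "openin (top_of_set cotangent_unitary) (range (cotangent_chart h))"
    unfolding range_cotangent_chart cotangent_unitary_def
    by (intro openin_Times openin_range_unitary_chart h openin_subtopology_self)
  show "cotangent_chart_inv h (cotangent_chart h x) = x" for x
    using h by (simp add: cotangent_chart_def cotangent_chart_inv_def)
  show "(cotangent_chart h has_derivative (\<lambda>e.
     (unitary_chart h (inl_part z) ** (mat \<i> ** hm (cayley_form (inl_part z) (inl_part e))), hm (inr_part e)))) (at z)" for z
    by (rule has_derivative_cotangent_chart)
  show "continuous_on UNIV (\<lambda>z. (unitary_chart h (inl_part z) ** (mat \<i> ** hm (cayley_form (inl_part z) (inl_part e))), hm (inr_part e)))" for e
  proof -
    have "continuous_on UNIV (\<lambda>x. unitary_chart h x ** (mat \<i> ** hm (cayley_form x (inl_part e))))"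
      unfolding unitary_chart_def
      by (intro continuous_intros continuous_cayley continuous_cayley_form bounded_linear.continuous_on[OF bounded_linear_hm])
    from continuous_on_compose2[OF this linear_continuous_on[OF bounded_linear_parts(1), of UNIV]]
    show ?thesis by (intro continuous_on_Pair continuous_on_const) simp
  qed
  show "(cotangent_chart_inv h has_derivative (\<lambda>H. sum_vec (unitary_chart_inv_deriv h (fst p) (fst H)) (hermitian_coords (snd H)))) (at p within cotangent_unitary)"
    if "p \<in> range (cotangent_chart h)" for p
  proof -
    have inv: "invertible (mat 1 + adjoint_matrix h ** fst p)"
      using that unfolding range_cotangent_chart range_unitary_chart[OF h] by auto
    have 1: "((\<lambda>p. unitary_chart_inv h (fst p)) has_derivative (\<lambda>H. unitary_chart_inv_deriv h (fst p) (fst H))) (at p within cotangent_unitary)"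
      by (rule has_derivative_compose[OF has_derivative_fst[OF has_derivative_ident] has_derivative_unitary_chart_inv[OF inv]])
    have 2: "((\<lambda>p. hermitian_coords (snd p)) has_derivative (\<lambda>H. hermitian_coords (snd H))) (at p within cotangent_unitary)"
      by (intro bounded_linear.has_derivative[OF bounded_linear_hermitian_coords] has_derivative_snd has_derivative_ident)
    show ?thesis
      using bounded_linear.has_derivative[OF bounded_linear_sum_vec has_derivative_Pair[OF 1 2]]
      unfolding cotangent_chart_inv_def[abs_def] by simp
  qed
  show "continuous_on (range (cotangent_chart h)) (\<lambda>p. sum_vec (unitary_chart_inv_deriv h (fst p) (fst H)) (hermitian_coords (snd H)))" for H
  proof -
    have "continuous_on (range (cotangent_chart h)) (\<lambda>p. unitary_chart_inv_deriv h (fst p) (fst H))"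
      unfolding unitary_chart_inv_deriv_def range_cotangent_chart range_unitary_chart[OF h]
      by (intro continuous_intros bounded_linear.continuous_on[OF bounded_linear_hermitian_coords]) auto
    from continuous_on_compose2[OF continuous_sum_vec[of UNIV] continuous_on_Pair[OF this continuous_on_const]]
    show ?thesis by simp
  qed
qed

definition liouville_constant :: "'d::finite itself \<Rightarrow> real" where
  "liouville_constant _ = real (card (pairings :: ('d + 'd \<Rightarrow> 'd + 'd) set)) / 2 ^ CARD('d) / fact CARD('d)"

lemma liouville_constant_pos: "liouville_constant TYPE('d::finite) > 0"
  using card_pairings_pos[where 'd='d] by (simp add: liouville_constant_def)

text \<open>The base derivatives are combinations of the left-invariant frame \<open>W\<close>, with
  coefficient matrix given by \<open>cayley_form\<close>; its determinant can be pulled out. What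
  remains is the form on the frame \<open>W\<close> and the fibre frame \<open>R\<close>, and these
  satisfy the Darboux relations because the trace pairing is Euclidean in the chosen
  coordinates.\<close>

lemma form_density_cotangent_chart:
  fixes h :: "'n::{finite,wellorder} cmat"
  assumes h: "h \<in> unitary_group"
  shows "form_density liouville_density_form (cotangent_chart h) z
    = liouville_constant TYPE('n \<times> 'n) * cayley_density (inl_part z)"
proof -
  let ?x = "inl_part z" and ?p = "cotangent_chart h z"
  let ?g = "unitary_chart h ?x"
  define W where "W = (\<lambda>e :: 'n hcoord. (?g ** (mat \<i> ** hm e), 0 :: 'n cmat))"
  define R where "R = (\<lambda>j :: 'n \<times> 'n. (0 :: 'n cmat, hm (axis j 1)))"
  \<comment> \<open>With the fibre slots frozen at \<open>R\<close>, the alternating functional sees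
    the base slots only, and the determinant law extracts exactly the determinant of
    \<open>cayley_form\<close>.\<close>
  define F where "F = (\<lambda>u :: 'n \<times> 'n \<Rightarrow> _. liouville_form (canonical_form ?p) (case_sum u R))"
  have g: "?g \<in> unitary_group" using h by (rule unitary_chart_unitary)
  have lf: "alternating_multilinear (liouville_form (canonical_form ?p) :: (('n \<times> 'n) + ('n \<times> 'n) \<Rightarrow> _) \<Rightarrow> real)"
    by (rule alternating_multilinear_liouville_form) (rule linear_canonical_form)+
  have alt: "alternating_multilinear F"
    unfolding alternating_multilinear_def
  proof (intro conjI allI impI)
    fix u :: "'n \<times> 'n \<Rightarrow> 'n cmat \<times> 'n cmat" and i
    have "case_sum (u(i := x)) R = (case_sum u R)(Inl i := x)" for x
      by (auto simp: fun_eq_iff split: sum.splits)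
    then show "linear (\<lambda>x. F (u(i := x)))"
      using lf unfolding F_def alternating_multilinear_def by simp
  next
    fix u :: "'n \<times> 'n \<Rightarrow> 'n cmat \<times> 'n cmat" and i j assume "i \<noteq> j" "u i = u j"
    then show "F u = 0"
      unfolding F_def by (intro alternating_multilinear_eq_0[OF lf, of "Inl i" "Inl j"]) simp_all
  qed
  have linW: "linear W"
    by (rule linearI) (simp_all add: W_def hm_add hm_scaleR matrix_mult.add_right matrix_mult.scaleR_right)
  let ?A = "Finite_Cartesian_Product.transpose (matrix (cayley_form ?x))"
  have "frechet_derivative (cotangent_chart h) (at z) (axis s 1) =
     case_sum (\<lambda>i. \<Sum>k\<in>UNIV. ?A $ i $ k *\<^sub>R W (axis k 1)) R s" for s
  proof (cases s)
    case (Inl i)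
    have i: "inl_part (axis (Inl i) 1 :: real^(('n \<times> 'n) + ('n \<times> 'n))) = axis i 1"
      "inr_part (axis (Inl i) 1 :: real^(('n \<times> 'n) + ('n \<times> 'n))) = 0"
      by (auto intro!: vec_eqI simp: inl_part_def inr_part_def axis_def)
    have "W (cayley_form ?x (axis i 1)) = (\<Sum>k\<in>UNIV. cayley_form ?x (axis i 1) $ k *\<^sub>R W (axis k 1))"
      by (rule linear_eq_sum_axis[OF linW])
    then show ?thesis
      unfolding Inl frechet_derivative_at[OF has_derivative_cotangent_chart, symmetric]
      by (simp add: W_def i matrix_def Finite_Cartesian_Product.transpose_def)
  next
    case (Inr j)
    have j: "inr_part (axis (Inr j) 1 :: real^(('n \<times> 'n) + ('n \<times> 'n))) = axis j 1"
      "inl_part (axis (Inr j) 1 :: real^(('n \<times> 'n) + ('n \<times> 'n))) = 0"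
      by (auto intro!: vec_eqI simp: inl_part_def inr_part_def axis_def)
    then show ?thesis
      unfolding Inr frechet_derivative_at[OF has_derivative_cotangent_chart, symmetric]
      by (simp add: R_def linear_0[OF linear_cayley_form] matrix_mult.zero_right)
  qed
  then have "form_density liouville_density_form (cotangent_chart h) z = \<bar>F (\<lambda>i. \<Sum>k\<in>UNIV. ?A $ i $ k *\<^sub>R W (axis k 1))\<bar>"
    by (simp add: form_density_def F_def)
  also have "\<dots> = cayley_density ?x * \<bar>F (\<lambda>k. W (axis k 1))\<bar>"
    unfolding alternating_multilinear_det[OF alt] det_transpose by (simp add: cayley_density_def abs_mult)
  also have "F (\<lambda>k. W (axis k 1)) = liouville_constant TYPE('n \<times> 'n)"
    unfolding F_def liouville_constant_def
  proof (rule liouville_form_darboux)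
    show "canonical_form ?p u v = - canonical_form ?p v u" for u v by (rule canonical_form_antisymmetric)
    have z: "adjoint_matrix 0 = (0 :: 'n cmat)" by (intro matrix_eqI) simp
    have tz: "trace (0 :: 'n cmat) = 0" by (simp add: trace_def)
    show "canonical_form ?p (case_sum (\<lambda>k. W (axis k 1)) R (Inr d)) (case_sum (\<lambda>k. W (axis k 1)) R (Inr e)) = 0" for d e
      by (simp add: canonical_form_eq R_def z tz matrix_mult.zero_left matrix_mult.zero_right)
    show "canonical_form ?p (case_sum (\<lambda>k. W (axis k 1)) R (Inl d)) (case_sum (\<lambda>k. W (axis k 1)) R (Inr e)) = (if d = e then 1 else 0)" for d e
    proof -
      \<comment> \<open>A fibre vector has no base component, so a single one of the four terms of
        the canonical form survives. In it \<open>adjoint_matrix ?g\<close> cancels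
        \<open>?g\<close>, and the trace becomes the inner product of coordinates.\<close>
      have "trace (hm (axis e 1) ** (adjoint_matrix ?g ** (?g ** (mat \<i> ** hm (axis d 1))))) = \<i> * trace (hm (axis e 1 :: 'n hcoord) ** hm (axis d 1))"
      proof -
        have "hm (axis e 1 :: 'n hcoord) ** (mat \<i> ** hm (axis d 1)) = mat \<i> ** (hm (axis e 1) ** hm (axis d 1))"
          by (simp only: matrix_mul_assoc mat_mult_commute[of \<i> "hm (axis e 1)"])
        moreover have "trace (mat \<i> ** B) = \<i> * trace B" for B :: "'n cmat"
          by (simp add: trace_def mat_mult_nth sum_distrib_left)
        ultimately show ?thesis using g by simp
      qed
      then have "canonical_form ?p (case_sum (\<lambda>k. W (axis k 1)) R (Inl d)) (case_sum (\<lambda>k. W (axis k 1)) R (Inr e))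
        = Im (\<i> * trace (hm (axis e 1 :: 'n hcoord) ** hm (axis d 1)))"
        by (simp add: canonical_form_eq W_def R_def z tz cotangent_chart_def matrix_mult.zero_left matrix_mult.zero_right)
      also have "\<dots> = (axis e 1 :: 'n hcoord) \<bullet> axis d 1" by (simp add: trace_hm_mult)
      also have "\<dots> = (if d = e then 1 else 0)" by (simp add: inner_axis_axis)
      finally show ?thesis .
    qed
  qed
  finally show ?thesis using liouville_constant_pos[where 'd="'n \<times> 'n"] by simp
qed

interpretation cotangent: volume_form_atlas
  "cotangent_unitary :: ('n::{finite,wellorder} cmat \<times> 'n cmat) set" liouville_density_form
  "\<lambda>n. cotangent_chart (atlas_point n)" "\<lambda>n. cotangent_chart_inv (atlas_point n)"
proof
  show "smooth_chart cotangent_unitary (cotangent_chart (atlas_point n)) (cotangent_chart_inv (atlas_point n))" for n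
    by (rule smooth_chart_cotangent[OF atlas_point(1)])
  show "(cotangent_unitary :: ('n cmat \<times> 'n cmat) set) \<subseteq> (\<Union>n. range (cotangent_chart (atlas_point n)))"
    unfolding range_cotangent_chart cotangent_unitary_def using atlas_point(2) by blast
qed

interpretation haar: finite_measure "haar :: ('n::{finite,wellorder} cmat) measure"
  by (rule finite_measureI) (use haar_finite[where 'a='n] in auto)

interpretation haar_lborel: pair_sigma_finite
  "haar :: ('n::{finite,wellorder} cmat) measure" "lborel :: 'n hcoord measure" ..

lemma measurable_haar_borel [measurable]:
  "(\<lambda>g. g) \<in> haar \<rightarrow>\<^sub>M borel"
  by (simp add: measurable_restrict_space1 cong: measurable_cong_sets[OF sets_haar refl])

lemma measurable_hm [measurable]: "hm \<in> borel \<rightarrow>\<^sub>M borel"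
  by (intro borel_measurable_continuous_onI linear_continuous_on bounded_linear_hm)

lemma measurable_Pair_hm:
  "(\<lambda>(g, x). (g, hm x)) \<in> haar \<Otimes>\<^sub>M lborel \<rightarrow>\<^sub>M restrict_space borel cotangent_unitary"
proof (rule measurable_restrict_space2)
  have "(\<lambda>p. (fst p, hm (snd p))) \<in> haar \<Otimes>\<^sub>M (lborel :: 'a hcoord measure) \<rightarrow>\<^sub>M borel \<Otimes>\<^sub>M borel"
    by (intro measurable_Pair measurable_compose[OF measurable_fst measurable_haar_borel]
        measurable_compose[OF measurable_snd]) simp
  then show "(\<lambda>(g, x). (g, hm x)) \<in> haar \<Otimes>\<^sub>M (lborel :: 'a hcoord measure) \<rightarrow>\<^sub>M borel"
    by (simp add: borel_prod case_prod_beta)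
qed (auto simp: space_pair_measure cotangent_unitary_def hm_hermitian)

text \<open>In each atlas chart the Liouville density is a constant times the Haar density of the
  base coordinate and is independent of the fibre coordinate, which is precisely the density of the
  scaled product.\<close>

theorem liouville_measure_eq:
  "(liouville_measure :: ('n::{finite,wellorder} cmat \<times> 'n cmat) measure) =
     scale_measure (ennreal (liouville_constant TYPE('n \<times> 'n)))
       (distr (haar \<Otimes>\<^sub>M lborel) (restrict_space borel cotangent_unitary) (\<lambda>(g, x). (g, hm x)))"
    (is "_ = scale_measure ?\<kappa> ?D")
  unfolding liouville_measure_def
proof (rule cotangent.form_measure_eqI, rule cotangent.is_form_measureI)
  show "space (scale_measure ?\<kappa> ?D) = cotangent_unitary" by (simp add: space_scale_measure space_restrict_space)
  show "sets (scale_measure ?\<kappa> ?D) = sets (restrict_space borel cotangent_unitary)" by simp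
  fix n and B :: "(real^(('n \<times> 'n) + ('n \<times> 'n))) set" assume B [measurable]: "B \<in> sets borel"
  let ?h = "atlas_point n :: 'n cmat"
  have h: "?h \<in> unitary_group" by (rule atlas_point)
  have cB: "cotangent_chart ?h ` B \<in> sets (restrict_space borel cotangent_unitary)"
    by (rule cotangent.parametrization_image_measurable[OF cotangent.chart_parametrization B]) simp
  let ?Q = "(\<lambda>(g, x). (g, hm x)) -` (cotangent_chart ?h ` B) \<inter> space (haar \<Otimes>\<^sub>M (lborel :: 'n hcoord measure))"
  have Q: "?Q \<in> sets (haar \<Otimes>\<^sub>M lborel)" by (rule measurable_sets[OF measurable_Pair_hm cB])
  \<comment> \<open>For a fixed fibre coordinate the slice of a chart image is a unitary chart
    image, whose Haar measure is known; hence Tonelli with the fibre as the outer variable.\<close>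
  have sec: "(\<lambda>g. (g, x)) -` ?Q = unitary_chart ?h ` {y. sum_vec y x \<in> B}" for x
  proof (intro equalityI subsetI)
    fix g assume "g \<in> (\<lambda>g. (g, x)) -` ?Q"
    then obtain z where z: "z \<in> B" "g = unitary_chart ?h (inl_part z)" "hm x = hm (inr_part z)"
      by (auto simp: cotangent_chart_def)
    have "x = inr_part z" by (rule injD[OF inj_hm z(3)])
    then have "sum_vec (inl_part z) x \<in> B" using z(1) by simp
    then show "g \<in> unitary_chart ?h ` {y. sum_vec y x \<in> B}" using z(2) by blast
  next
    fix g assume "g \<in> unitary_chart ?h ` {y. sum_vec y x \<in> B}"
    then obtain y where y: "sum_vec y x \<in> B" "g = unitary_chart ?h y" by blast
    then have "(g, hm x) = cotangent_chart ?h (sum_vec y x)" by (simp add: cotangent_chart_def)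
    then have "(g, hm x) \<in> cotangent_chart ?h ` B" using y(1) by (rule image_eqI)
    then show "g \<in> (\<lambda>g. (g, x)) -` ?Q"
      using unitary_chart_unitary[OF h, of y] y(2) by (simp add: space_pair_measure)
  qed
  have [measurable]: "cayley_density \<in> borel_measurable (borel :: 'n hcoord measure)"
    by (intro borel_measurable_continuous_onI continuous_cayley_density)
  have [measurable]: "inl_part \<in> borel_measurable (borel :: (real^(('n \<times> 'n) + ('n \<times> 'n))) measure)"
    by (intro borel_measurable_continuous_onI linear_continuous_on bounded_linear_parts)
  have sv: "(\<lambda>y. sum_vec y x) \<in> borel \<rightarrow>\<^sub>M (borel :: (real^(('n \<times> 'n) + ('n \<times> 'n))) measure)" for x :: "'n hcoord"
    using continuous_on_compose2[OF continuous_sum_vec[of UNIV] continuous_on_Pair[OF continuous_on_id continuous_on_const[of UNIV x]]]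
    by (intro borel_measurable_continuous_onI) simp
  have sv2 [measurable]: "(\<lambda>p. sum_vec (fst p) (snd p)) \<in> (borel :: 'n hcoord measure) \<Otimes>\<^sub>M (borel :: 'n hcoord measure) \<rightarrow>\<^sub>M borel"
    using measurable_sum_vec[where 'a="'n \<times> 'n" and 'b="'n \<times> 'n"] by (simp add: case_prod_beta)
  have ml: "(\<lambda>p. ennreal (cayley_density (fst p)) * indicator B (sum_vec (fst p) (snd p)))
    \<in> borel_measurable ((lborel :: 'n hcoord measure) \<Otimes>\<^sub>M (lborel :: 'n hcoord measure))"
    by measurable
  have "emeasure ?D (cotangent_chart ?h ` B) = emeasure (haar \<Otimes>\<^sub>M lborel) ?Q"
    by (rule emeasure_distr[OF measurable_Pair_hm cB])
  also have "\<dots> = (\<integral>\<^sup>+x. emeasure haar ((\<lambda>g. (g, x)) -` ?Q) \<partial>lborel)"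
    by (rule haar_lborel.emeasure_pair_measure_alt2[OF Q])
  also have "\<dots> = (\<integral>\<^sup>+x. (\<integral>\<^sup>+y. ennreal (cayley_density y) * indicator B (sum_vec y x) \<partial>lborel) \<partial>lborel)"
  proof (rule nn_integral_cong)
    fix x :: "'n hcoord"
    have "{y. sum_vec y x \<in> B} \<in> sets borel"
      using measurable_sets_borel[OF sv B] by (simp add: vimage_def)
    from emeasure_haar_chart[OF h this] show "emeasure haar ((\<lambda>g. (g, x)) -` ?Q) = (\<integral>\<^sup>+y. ennreal (cayley_density y) * indicator B (sum_vec y x) \<partial>lborel)"
      unfolding sec by (simp add: indicator_def)
  qed
  also have "\<dots> = (\<integral>\<^sup>+p. ennreal (cayley_density (fst p)) * indicator B (sum_vec (fst p) (snd p)) \<partial>(lborel \<Otimes>\<^sub>M lborel))"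
    using lborel_pair.nn_integral_snd[OF ml] by simp
  also have "\<dots> = (\<integral>\<^sup>+z. ennreal (cayley_density (inl_part z)) * indicator B z \<partial>distr (lborel \<Otimes>\<^sub>M lborel) borel (\<lambda>(x, y). sum_vec x y))"
    by (subst nn_integral_distr) (auto simp: case_prod_beta)
  also have "\<dots> = (\<integral>\<^sup>+z\<in>B. ennreal (cayley_density (inl_part z)) \<partial>lborel)"
    by (simp only: distr_sum_vec)
  finally have "emeasure (scale_measure ?\<kappa> ?D) (cotangent_chart ?h ` B) = ?\<kappa> * (\<integral>\<^sup>+z\<in>B. ennreal (cayley_density (inl_part z)) \<partial>lborel)"
    by simp
  also have "\<dots> = (\<integral>\<^sup>+z. ?\<kappa> * (ennreal (cayley_density (inl_part z)) * indicator B z) \<partial>lborel)"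
    by (rule nn_integral_cmult[symmetric]) simp
  also have "\<dots> = (\<integral>\<^sup>+z\<in>B. ennreal (form_density liouville_density_form (cotangent_chart ?h) z) \<partial>lborel)"
    unfolding form_density_cotangent_chart[OF h]
    using liouville_constant_pos[where 'd="'n \<times> 'n"]
    by (intro nn_integral_cong) (simp add: ennreal_mult cayley_density_def mult.assoc)
  finally show "emeasure (scale_measure ?\<kappa> ?D) (cotangent_chart ?h ` B) =
    (\<integral>\<^sup>+z\<in>B. ennreal (form_density liouville_density_form (cotangent_chart ?h) z) \<partial>lborel)" .
qed

section \<open>Interlacing of the leading principal minors\<close>

text \<open>The matrix is a function of two naturals, so that blocks of all sizes come from one
  \<open>f\<close> and a recursion on the size involves no change of index type.\<close>

definition leading_block :: "nat \<Rightarrow> (nat \<Rightarrow> nat \<Rightarrow> complex) \<Rightarrow> complex Matrix.mat" where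
  "leading_block k f = Matrix.mat k k (\<lambda>(i, j). f i j)"

definition block_poly :: "nat \<Rightarrow> (nat \<Rightarrow> nat \<Rightarrow> complex) \<Rightarrow> complex poly" where
  "block_poly k f = char_poly (leading_block k f)"

definition shifted_block :: "nat \<Rightarrow> (nat \<Rightarrow> nat \<Rightarrow> complex) \<Rightarrow> complex \<Rightarrow> complex Matrix.mat" where
  "shifted_block k f x = Matrix.mat k k (\<lambda>(i, j). (if i = j then x else 0) - f i j)"

lemma leading_block_carrier [simp]: "leading_block k f \<in> carrier_mat k k"
  by (simp add: leading_block_def)

lemma shifted_block_carrier [simp]: "shifted_block k f x \<in> carrier_mat k k"
  by (simp add: shifted_block_def)

lemma poly_block_poly: "poly (block_poly k f) x = Determinant.det (shifted_block k f x)"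
proof -
  have "- (char_matrix (leading_block k f) x) = shifted_block k f x"
    by (rule eq_matI) (auto simp: char_matrix_def leading_block_def shifted_block_def)
  then show ?thesis
    unfolding block_poly_def by (simp add: char_poly_matrix[OF leading_block_carrier])
qed

lemma block_poly_monic: "degree (block_poly k f) = k" "coeff (block_poly k f) k = 1"
  using degree_monic_char_poly[OF leading_block_carrier] by (simp_all add: block_poly_def)

lemma block_poly_0 [simp]: "block_poly 0 f = 1"
  using block_poly_monic[of 0 f] by (metis degree_0_id one_pCons)

lemma block_poly_cong:
  assumes "\<And>i j. i < k \<Longrightarrow> j < k \<Longrightarrow> f i j = g i j"
  shows "block_poly k f = block_poly k g"
  unfolding block_poly_def leading_block_def
  by (rule arg_cong[of _ _ char_poly]) (auto intro!: eq_matI simp: assms)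

text \<open>The explicit expansion yields both the behaviour under complex conjugation and joint
  continuity in the matrix and the argument.\<close>

lemma poly_block_poly_sum:
  "poly (block_poly k f) x = (\<Sum>p | p permutes {0..<k}. signof p * (\<Prod>i = 0..<k. (if i = p i then x else 0) - f i (p i)))"
proof -
  have "(\<Prod>i = 0..<k. shifted_block k f x $$ (i, p i)) = (\<Prod>i = 0..<k. (if i = p i then x else 0) - f i (p i))"
    if "p permutes {0..<k}" for p
    using permutes_in_image[OF that] by (intro prod.cong) (auto simp: shifted_block_def)
  then show ?thesis
    unfolding poly_block_poly Determinant.det_def by (simp add: shifted_block_def)
qed

text \<open>Conjugating the entries of a Hermitian block transposes it, and the characteristic
  polynomial is invariant under transposition.\<close>

lemma poly_block_poly_real:
  assumes herm: "\<And>i j. cnj (f i j) = f j i"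
  shows "Im (poly (block_poly k f) (complex_of_real x)) = 0"
proof -
  have "cnj (poly (block_poly k f) x) = (\<Sum>p | p permutes {0..<k}. signof p * (\<Prod>i = 0..<k. (if i = p i then complex_of_real x else 0) - f (p i) i))"
  proof -
    have t: "cnj ((if i = j then complex_of_real x else 0) - f i j) = (if i = j then complex_of_real x else 0) - f j i" for i j
      by (simp add: herm)
    have sg: "cnj (signof p) = signof p" for p :: "nat \<Rightarrow> nat"
      by (simp add: sign_def)
    show ?thesis unfolding poly_block_poly_sum cnj_sum complex_cnj_mult cnj_prod t sg ..
  qed
  also have "\<dots> = poly (block_poly k (\<lambda>i j. f j i)) x"
    unfolding poly_block_poly_sum ..
  also have "block_poly k (\<lambda>i j. f j i) = block_poly k f"
  proof -
    have "leading_block k (\<lambda>i j. f j i) = transpose_mat (leading_block k f)"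
      by (rule eq_matI) (auto simp: leading_block_def)
    then show ?thesis
      unfolding block_poly_def by (simp add: char_poly_transpose_mat[OF leading_block_carrier])
  qed
  finally have "cnj (poly (block_poly k f) x) = poly (block_poly k f) x" .
  then show ?thesis by (simp add: complex_eq_iff)
qed

text \<open>
  If \<open>u\<close> spans the kernel of \<open>x - B\<close> for the block \<open>B\<close> of size \<open>k + 1\<close> and its last entry is \<open>1\<close>,
  replacing column and row \<open>k\<close> by the combinations with coefficients \<open>u\<close> leaves a single
  non-zero entry in each.
\<close>

lemma block_poly_sturm:
  assumes herm: "\<And>i j. cnj (f i j) = f j i" and uk: "u k = 1"
    and u: "\<And>i. i \<le> k \<Longrightarrow> (\<Sum>j\<le>k. f i j * u j) = complex_of_real x * u i"
  shows "poly (block_poly (k + 2) f) x =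
    - complex_of_real ((cmod (\<Sum>j\<le>k. f (k + 1) j * u j))\<^sup>2) * poly (block_poly k f) x"
proof -
  let ?x = "complex_of_real x"
  define M where "M = shifted_block (k + 2) f ?x"
  define s where "s = (\<Sum>j\<le>k. f (k + 1) j * u j)"
  have M: "M \<in> carrier_mat (k + 2) (k + 2)" by (simp add: M_def)
  \<comment> \<open>\<open>u\<close> is extended by zero. Rows 0 to k of \<open>M\<close> annihilate
    \<open>w\<close>, and row k + 1 yields \<open>- s\<close>.\<close>
  define w where "w = Matrix.vec (k + 2) (\<lambda>i. if i \<le> k then u i else 0)"
  have w: "w \<in> carrier_vec (k + 2)" by (simp add: w_def)
  have Mw: "vec_index (M *\<^sub>v w) i = (if i \<le> k then 0 else - s)" if "i < k + 2" for i
  proof -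
    have "vec_index (M *\<^sub>v w) i = (\<Sum>j<k + 2. ((if i = j then ?x else 0) - f i j) * (if j \<le> k then u j else 0))"
      using that by (simp add: M_def shifted_block_def w_def scalar_prod_def atLeast0LessThan)
    also have "\<dots> = (\<Sum>j\<le>k. ((if i = j then ?x else 0) - f i j) * u j)"
      by (rule sum.mono_neutral_cong_right) auto
    also have "\<dots> = (\<Sum>j\<le>k. (if i = j then ?x * u j else 0) - f i j * u j)"
      by (intro sum.cong) (auto simp: left_diff_distrib)
    also have "\<dots> = (\<Sum>j\<le>k. (if i = j then ?x * u j else 0)) - (\<Sum>j\<le>k. f i j * u j)"
      by (rule sum_subtractf)
    also have "\<dots> = (if i \<le> k then 0 else - s)"
    proof (cases "i \<le> k")
      case False
      with that have "i = k + 1" by simp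
      then show ?thesis by (simp add: s_def)
    qed (simp add: u)
    finally show ?thesis .
  qed
  \<comment> \<open>By Cramer's lemma, replacing column k by the image of \<open>w\<close>
    multiplies the determinant by entry k of \<open>w\<close>, which is 1.\<close>
  define M' where "M' = replace_col M (M *\<^sub>v w) k"
  have M': "M' \<in> carrier_mat (k + 2) (k + 2)" using M by (simp add: M'_def replace_col_def)
  have detM': "Determinant.det M' = Determinant.det M"
    unfolding M'_def using cramer_lemma_mat[OF M w, of k] by (simp add: w_def uk)
  have M'col: "M' $$ (i, k) = (if i \<le> k then 0 else - s)" if "i < k + 2" for i
    using that M Mw[OF that] by (simp add: M'_def replace_col_def)
  have "Determinant.det M' = (\<Sum>i<k + 2. M' $$ (i, k) * cofactor M' i k)"
    by (rule laplace_expansion_column[OF M']) simp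
  also have "\<dots> = (\<Sum>i\<in>{k + 1}. M' $$ (i, k) * cofactor M' i k)"
    by (rule sum.mono_neutral_right) (auto simp: M'col)
  also have "\<dots> = s * Determinant.det (mat_delete M' (k + 1) k)"
    by (simp add: M'col cofactor_def)
  finally have 1: "Determinant.det M' = s * Determinant.det (mat_delete M' (k + 1) k)" .
  \<comment> \<open>This is the transpose of the remaining minor, so that the second reduction, with
    the conjugate vector, is again a column replacement. Its last row is the part of column k + 1
    that survives.\<close>
  define R where "R = Matrix.mat (k + 1) (k + 1) (\<lambda>(j, i). if j < k then (if i = j then ?x else 0) - f i j else - f i (k + 1))"
  have R: "R \<in> carrier_mat (k + 1) (k + 1)" by (simp add: R_def)
  have "mat_delete M' (k + 1) k = transpose_mat R"
    by (rule eq_matI)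
      (use M M' in \<open>auto simp: mat_delete_def R_def M'_def replace_col_def M_def shifted_block_def not_less_less_Suc_eq\<close>)
  then have 2: "Determinant.det (mat_delete M' (k + 1) k) = Determinant.det R"
    using Determinant.det_transpose[OF R] by simp
  define v where "v = Matrix.vec (k + 1) (\<lambda>i. cnj (u i))"
  have v: "v \<in> carrier_vec (k + 1)" by (simp add: v_def)
  have Rv: "vec_index (R *\<^sub>v v) j = (if j < k then 0 else - cnj s)" if "j < k + 1" for j
  proof (cases "j < k")
    case True
    have "vec_index (R *\<^sub>v v) j = (\<Sum>i\<le>k. ((if i = j then ?x else 0) - f i j) * cnj (u i))"
      using True by (simp add: R_def v_def scalar_prod_def atLeast0LessThan lessThan_Suc_atMost)
    also have "\<dots> = (\<Sum>i\<le>k. (if i = j then ?x * cnj (u i) else 0) - f i j * cnj (u i))"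
      by (intro sum.cong) (auto simp: left_diff_distrib)
    also have "\<dots> = (\<Sum>i\<le>k. (if i = j then ?x * cnj (u i) else 0)) - (\<Sum>i\<le>k. f i j * cnj (u i))"
      by (rule sum_subtractf)
    also have "(\<Sum>i\<le>k. f i j * cnj (u i)) = cnj (\<Sum>i\<le>k. f j i * u i)"
      by (simp add: herm)
    also have "\<dots> = ?x * cnj (u j)" using True by (simp add: u)
    finally show ?thesis using True by simp
  next
    case False
    with that have "j = k" by simp
    then have "vec_index (R *\<^sub>v v) j = (\<Sum>i\<le>k. - f i (k + 1) * cnj (u i))"
      by (simp add: R_def v_def scalar_prod_def atLeast0LessThan lessThan_Suc_atMost)
    also have "\<dots> = - cnj s" by (simp add: s_def herm sum_negf)
    finally show ?thesis using \<open>j = k\<close> by simp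
  qed
  define R' where "R' = replace_col R (R *\<^sub>v v) k"
  have R': "R' \<in> carrier_mat (k + 1) (k + 1)" using R by (simp add: R'_def replace_col_def)
  have detR': "Determinant.det R' = Determinant.det R"
    unfolding R'_def using cramer_lemma_mat[OF R v, of k] by (simp add: v_def uk)
  have R'col: "R' $$ (i, k) = (if i < k then 0 else - cnj s)" if "i < k + 1" for i
    using that R Rv[OF that] by (simp add: R'_def replace_col_def)
  have "Determinant.det R' = (\<Sum>i<k + 1. R' $$ (i, k) * cofactor R' i k)"
    by (rule laplace_expansion_column[OF R']) simp
  also have "\<dots> = (\<Sum>i\<in>{k}. R' $$ (i, k) * cofactor R' i k)"
    by (rule sum.mono_neutral_right) (auto simp: R'col)
  also have "\<dots> = - cnj s * Determinant.det (mat_delete R' k k)"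
    by (simp add: R'col cofactor_def flip: mult_2)
  also have "mat_delete R' k k = transpose_mat (shifted_block k f ?x)"
    by (rule eq_matI)
      (use R R' in \<open>auto simp: mat_delete_def R_def R'_def replace_col_def shifted_block_def\<close>)
  finally have 3: "Determinant.det R' = - cnj s * poly (block_poly k f) ?x"
    by (simp add: poly_block_poly Determinant.det_transpose[OF shifted_block_carrier])
  have "poly (block_poly (k + 2) f) ?x = Determinant.det M" by (simp add: poly_block_poly M_def)
  also have "\<dots> = s * (- cnj s * poly (block_poly k f) ?x)" using detM' 1 2 detR' 3 by simp
  also have "\<dots> = - complex_of_real ((cmod s)\<^sup>2) * poly (block_poly k f) ?x"
    by (simp only: complex_norm_square) (simp add: mult_ac)
  finally show ?thesis by (simp add: s_def)
qed

text \<open>If the last entry of an eigenvector vanished, its truncation would be an eigenvector of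
  the smaller block for the same \<open>x\<close>, against \<open>nroot\<close>. So the last entry
  can be normalized to 1.\<close>

lemma block_eigenvector:
  assumes root: "poly (block_poly (k + 1) f) x = 0" and nroot: "poly (block_poly k f) x \<noteq> 0"
  obtains u where "u k = 1" "\<And>i. i \<le> k \<Longrightarrow> (\<Sum>j\<le>k. f i j * u j) = x * u i"
proof -
  have "eigenvalue (leading_block (k + 1) f) x"
    using root eigenvalue_root_char_poly[OF leading_block_carrier] by (simp add: block_poly_def)
  then obtain v where v: "v \<in> carrier_vec (k + 1)" "v \<noteq> 0\<^sub>v (k + 1)"
    "leading_block (k + 1) f *\<^sub>v v = x \<cdot>\<^sub>v v"
    by (auto simp: eigenvalue_def eigenvector_def leading_block_def)
  have e: "(\<Sum>j\<le>k. f i j * vec_index v j) = x * vec_index v i" if "i \<le> k" for i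
    using arg_cong[OF v(3), of "\<lambda>w. vec_index w i"] v(1) that
    by (simp add: leading_block_def scalar_prod_def atLeast0LessThan lessThan_Suc_atMost)
  have "vec_index v k \<noteq> 0"
  proof
    assume 0: "vec_index v k = 0"
    define w where "w = Matrix.vec k (vec_index v)"
    have "leading_block k f *\<^sub>v w = x \<cdot>\<^sub>v w"
    proof (rule eq_vecI)
      fix i assume "i < dim_vec (x \<cdot>\<^sub>v w)"
      then have i: "i < k" by (simp add: w_def)
      have "vec_index (leading_block k f *\<^sub>v w) i = (\<Sum>j<k. f i j * vec_index v j)"
        using i by (simp add: leading_block_def w_def scalar_prod_def atLeast0LessThan)
      also have "\<dots> = (\<Sum>j\<le>k. f i j * vec_index v j)"
        by (simp add: lessThan_Suc_atMost[symmetric] 0)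
      finally show "vec_index (leading_block k f *\<^sub>v w) i = vec_index (x \<cdot>\<^sub>v w) i"
        using i e[of i] by (simp add: w_def)
    qed (simp add: w_def leading_block_def)
    moreover have "w \<noteq> 0\<^sub>v k"
    proof
      assume w0: "w = 0\<^sub>v k"
      have "v = 0\<^sub>v (k + 1)"
      proof (rule eq_vecI)
        fix i assume "i < dim_vec (0\<^sub>v (k + 1) :: complex Matrix.vec)"
        then consider "i = k" | "i < k" by fastforce
        then show "vec_index v i = vec_index (0\<^sub>v (k + 1)) i"
        proof cases
          case 2
          then have "vec_index v i = vec_index w i" by (simp add: w_def)
          with 2 w0 show ?thesis by simp
        qed (simp add: 0)
      qed (use v in simp)
      with v show False by simp
    qed
    ultimately have "eigenvalue (leading_block k f) x"
      unfolding eigenvalue_def eigenvector_def by (intro exI[of _ w]) (simp add: w_def leading_block_def)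
    then show False
      using nroot eigenvalue_root_char_poly[OF leading_block_carrier] by (simp add: block_poly_def)
  qed
  then show ?thesis
    using e by (intro that[of "\<lambda>j. vec_index v j / vec_index v k"]) (simp_all flip: sum_divide_distrib)
qed

section \<open>Real roots located by sign changes\<close>

lemma monic_poly_eq_prod:
  fixes p :: "complex poly"
  assumes "degree p = m" "coeff p m = 1" "inj_on \<mu> {..<m}" "\<And>j. j < m \<Longrightarrow> poly p (complex_of_real (\<mu> j)) = 0"
  shows "p = (\<Prod>j<m. [:- complex_of_real (\<mu> j), 1:])"
proof (rule poly_eqI_degree_lead_coeff[where n = m and A = "(\<lambda>j. complex_of_real (\<mu> j)) ` {..<m}"])
  let ?q = "\<Prod>j<m. [:- complex_of_real (\<mu> j), 1:]"
  have d: "degree ?q = m" by (subst degree_prod_eq_sum_degree) auto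
  have "lead_coeff ?q = 1" by (simp add: lead_coeff_prod)
  then show "coeff p m = coeff ?q m" using assms d by simp
  show "degree ?q \<le> m" using d by simp
  show "card ((\<lambda>j. complex_of_real (\<mu> j)) ` {..<m}) \<ge> m"
    using assms(3) by (subst card_image) (auto simp: inj_on_def)
  show "poly p z = poly ?q z" if "z \<in> (\<lambda>j. complex_of_real (\<mu> j)) ` {..<m}" for z
    using that assms(4) by (auto simp: poly_prod intro!: prod_zero)
qed (use assms in simp)

text \<open>The intermediate value theorem gives one root in each of the m gaps; by the degree these
  are all the roots, so they are real and simple.\<close>

lemma roots_from_sign_changes:
  fixes p :: "complex poly"
  assumes p: "degree p = m" "coeff p m = 1" and real: "\<And>x. Im (poly p (complex_of_real x)) = 0"
    and dec: "\<And>j. j < m \<Longrightarrow> s (Suc j) < s j"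
    and sgn: "\<And>j. j \<le> m \<Longrightarrow> (- 1) ^ j * Re (poly p (complex_of_real (s j))) > 0"
  obtains \<mu> where "\<And>j. j < m \<Longrightarrow> s (Suc j) < \<mu> j \<and> \<mu> j < s j"
    "p = (\<Prod>j<m. [:- complex_of_real (\<mu> j), 1:])"
proof -
  let ?r = "\<lambda>x. Re (poly p (complex_of_real x))"
  have "\<exists>y. s (Suc j) < y \<and> y < s j \<and> ?r y = 0" if j: "j < m" for j
  proof -
    let ?g = "\<lambda>x. (- 1) ^ j * ?r x"
    have "?g (s (Suc j)) < 0" "?g (s j) > 0"
      using sgn[of j] sgn[of "Suc j"] j by auto
    moreover have "continuous_on {s (Suc j)..s j} ?g" by (intro continuous_intros)
    ultimately obtain y where y: "s (Suc j) \<le> y" "y \<le> s j" "?g y = 0"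
      using IVT'[of ?g "s (Suc j)" 0 "s j"] dec[OF j] by auto
    then have "y \<noteq> s j" "y \<noteq> s (Suc j)" using \<open>?g (s (Suc j)) < 0\<close> \<open>?g (s j) > 0\<close> by auto
    then show ?thesis using y by (intro exI[of _ y]) auto
  qed
  then have "\<forall>j. \<exists>y. j < m \<longrightarrow> s (Suc j) < y \<and> y < s j \<and> ?r y = 0" by blast
  from choice[OF this] obtain \<mu> where \<mu>: "\<And>j. j < m \<Longrightarrow> s (Suc j) < \<mu> j \<and> \<mu> j < s j \<and> ?r (\<mu> j) = 0"
    by blast
  have smono: "s b \<le> s a" if "a \<le> b" "b \<le> m" for a b
    using that
  proof (induction b rule: dec_induct)
    case (step b)
    then show ?case using dec[of b] by simp
  qed simp
  have lt: "\<mu> j < \<mu> i" if "i < j" "j < m" for i j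
    using \<mu>[of i] \<mu>[of j] smono[of "Suc i" j] that by force
  have "inj_on \<mu> {..<m}"
  proof (rule inj_onI)
    fix i j assume "i \<in> {..<m}" "j \<in> {..<m}" "\<mu> i = \<mu> j"
    then show "i = j" using lt[of i j] lt[of j i] by (cases i j rule: linorder_cases) auto
  qed
  then have "p = (\<Prod>j<m. [:- complex_of_real (\<mu> j), 1:])"
    using \<mu> real by (intro monic_poly_eq_prod p) (auto simp: complex_eq_iff)
  then show ?thesis using \<mu> by (intro that[of \<mu>]) auto
qed

lemma poly_map_Re: "poly (map_poly Re p) x = Re (poly p (complex_of_real x))"
  by (induction p) (simp_all add: map_poly_pCons)

text \<open>The sign at minus infinity is read off at plus infinity from the reflected polynomial,
  made monic by the factor (-1)^m.\<close>

lemma monic_sign_at_infinity: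
  fixes p :: "complex poly"
  assumes p: "degree p = m" "coeff p m = 1"
  obtains b where "\<And>x. x \<ge> b \<Longrightarrow> Re (poly p (complex_of_real x)) > 0"
    "\<And>x. x \<le> - b \<Longrightarrow> (- 1) ^ m * Re (poly p (complex_of_real x)) > 0"
proof -
  let ?r = "map_poly Re p"
  have c: "coeff ?r m = 1" by (simp add: coeff_map_poly p)
  have d: "degree ?r = m"
    using degree_map_poly_le[of Re p] le_degree[of ?r m] c p by simp
  obtain b1 where b1: "\<And>x. x \<ge> b1 \<Longrightarrow> poly ?r x \<ge> 1"
    using poly_pinfty_gt_lc[of ?r] c d by auto
  let ?q = "Polynomial.smult ((- 1) ^ m) (pcompose ?r [:0, -1:])"
  have "lead_coeff (pcompose ?r [:0, -1:]) = (- 1) ^ m"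
    using lead_coeff_comp[of "[:0, -1:]" ?r] c d by simp
  then have "lead_coeff ?q = (- 1) ^ m * (- 1) ^ m" by (simp only: lead_coeff_smult)
  then have "lead_coeff ?q = 1" by (simp flip: power_mult_distrib)
  then obtain b2 where b2: "\<And>x. x \<ge> b2 \<Longrightarrow> poly ?q x \<ge> 1"
    using poly_pinfty_gt_lc[of ?q] by auto
  show ?thesis
  proof (rule that[of "max b1 b2"])
    fix x assume "max b1 b2 \<le> x"
    then show "Re (poly p (complex_of_real x)) > 0" using b1[of x] by (simp add: poly_map_Re)
  next
    fix x assume "x \<le> - max b1 b2"
    then have "poly ?q (- x) \<ge> 1" by (intro b2) auto
    then show "(- 1) ^ m * Re (poly p (complex_of_real x)) > 0" by (simp add: poly_pcompose poly_map_Re)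
  qed
qed

text \<open>For Hermitian matrices this is equivalent to strict interlacing. It speaks of
  polynomials only, with no ordering of eigenvalues, which is the form suited to the null set
  argument. Real \<open>x\<close> are enough, because Hermitian blocks have real spectrum.\<close>

definition blocks_coprime :: "nat \<Rightarrow> (nat \<Rightarrow> nat \<Rightarrow> complex) \<Rightarrow> bool" where
  "blocks_coprime n f \<longleftrightarrow> (\<forall>k x. 1 \<le> k \<longrightarrow> k < n \<longrightarrow>
     \<not> (poly (block_poly k f) (complex_of_real x) = 0 \<and> poly (block_poly (k + 1) f) (complex_of_real x) = 0))"

text \<open>A Sturm sequence argument. If P_(k-1) alternates in sign along the roots of P_k, then by
  \<open>block_poly_sturm\<close> P_(k+1) alternates there with the opposite signs. Together with
  the signs at both infinities this separates k + 1 roots of P_(k+1), and P_k alternates along them.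
  That all roots are real comes out of the same induction.\<close>

lemma block_roots_interlace:
  assumes herm: "\<And>i j. cnj (f i j) = f j i" and cop: "blocks_coprime n f"
  obtains \<mu> where
    "\<And>k. k \<le> n \<Longrightarrow> block_poly k f = (\<Prod>j<k. [:- complex_of_real (\<mu> k j), 1:])"
    "\<And>k j. k < n \<Longrightarrow> j < k \<Longrightarrow> \<mu> (k + 1) j > \<mu> k j \<and> \<mu> k j > \<mu> (k + 1) (j + 1)"
    "\<And>k i j. k \<le> n \<Longrightarrow> i < j \<Longrightarrow> j < k \<Longrightarrow> \<mu> k j < \<mu> k i"
proof -
  let ?P = "\<lambda>k x. Re (poly (block_poly k f) (complex_of_real x))"
  have im: "Im (poly (block_poly k f) (complex_of_real x)) = 0" for k x
    by (rule poly_block_poly_real[OF herm])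
  \<comment> \<open>The last clause is the invariant: the signs of the previous polynomial at the
    current roots. At k = 0 the truncated \<open>k - 1\<close> is harmless, as there are no
    roots.\<close>
  define good where "good k \<mu> \<longleftrightarrow> block_poly k f = (\<Prod>j<k. [:- complex_of_real (\<mu> j), 1:]) \<and>
      (\<forall>i j. i < j \<longrightarrow> j < k \<longrightarrow> \<mu> j < \<mu> i) \<and> (\<forall>j<k. (- 1) ^ j * ?P (k - 1) (\<mu> j) > 0)" for k \<mu>
  have step: "\<exists>\<nu>. good (Suc k) \<nu> \<and> (\<forall>j<k. \<nu> j > \<mu> j \<and> \<mu> j > \<nu> (j + 1))" if k: "k < n" and g: "good k \<mu>" for k \<mu>
  proof -
    obtain b where b: "\<And>x. x \<ge> b \<Longrightarrow> ?P (Suc k) x > 0" "\<And>x. x \<le> - b \<Longrightarrow> (- 1) ^ Suc k * ?P (Suc k) x > 0"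
      using monic_sign_at_infinity[OF block_poly_monic] by blast
    have dec\<mu>: "\<mu> j < \<mu> i" if "i < j" "j < k" for i j using g that by (simp add: good_def)
    have le\<mu>: "\<mu> j \<le> \<mu> i" if "i \<le> j" "j < k" for i j
      using dec\<mu>[of i j] that by (cases "i = j") auto
    \<comment> \<open>Chosen so that \<open>top\<close> and \<open>- top\<close> lie beyond all old
      roots and in the range where the next polynomial already has its sign at infinity.\<close>
    define top where "top = max \<bar>b\<bar> (Max (insert 0 ((\<lambda>j. \<bar>\<mu> j\<bar>) ` {..<k}))) + 1"
    have topb: "b \<le> top" "- top \<le> - b" "top > 0" by (auto simp: top_def)
    have top\<mu>: "\<bar>\<mu> j\<bar> < top" if "j < k" for j
    proof -
      have "\<bar>\<mu> j\<bar> \<le> Max (insert 0 ((\<lambda>j. \<bar>\<mu> j\<bar>) ` {..<k}))" using that by (intro Max_ge) auto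
      then show ?thesis by (simp add: top_def)
    qed
    \<comment> \<open>Sample points in decreasing order: \<open>top\<close>, the k old roots with
      index shifted by one, then \<open>- top\<close>.\<close>
    define s where "s j = (if j = 0 then top else if j \<le> k then \<mu> (j - 1) else - top)" for j
    have dec: "s (Suc j) < s j" if "j < Suc k" for j
      using that top\<mu>[of j] top\<mu>[of "j - 1"] dec\<mu>[of "j - 1" j] topb by (cases j) (auto simp: s_def)
    have sgn: "(- 1) ^ j * ?P (Suc k) (s j) > 0" if j: "j \<le> Suc k" for j
    proof -
      consider "j = 0" | "j = Suc k" "j \<noteq> 0" | i where "j = Suc i" "i < k" using j by (cases j) fastforce+
      then show ?thesis
      proof cases
        case 1
        then show ?thesis using b(1) topb by (simp add: s_def)
      next
        case 2
        then show ?thesis using b(2)[of "- top"] topb by (simp add: s_def)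
      next
        case 3
        then obtain l where l: "k = Suc l" by (cases k) auto
        have "poly (block_poly k f) (complex_of_real (\<mu> i)) = 0"
          using g 3(2) by (auto simp: good_def poly_prod)
        then have root: "poly (block_poly (l + 1) f) (complex_of_real (\<mu> i)) = 0" using l by simp
        have s1: "(- 1) ^ i * ?P l (\<mu> i) > 0" using g 3(2) l by (auto simp: good_def)
        then have nroot: "poly (block_poly l f) (complex_of_real (\<mu> i)) \<noteq> 0" by auto
        obtain u where "u l = 1" "\<And>i'. i' \<le> l \<Longrightarrow> (\<Sum>j\<le>l. f i' j * u j) = complex_of_real (\<mu> i) * u i'"
          using block_eigenvector[OF root nroot] by blast
        from block_poly_sturm[OF herm this]
        obtain c where c: "poly (block_poly (l + 2) f) (complex_of_real (\<mu> i)) = - complex_of_real c * poly (block_poly l f) (complex_of_real (\<mu> i))" "c \<ge> 0"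
          by (metis zero_le_power2)
        \<comment> \<open>This is where coprimality enters: the Sturm coefficient is a squared
          modulus, and it vanishes exactly when the old root is also a root of the next
          polynomial.\<close>
        have "poly (block_poly (l + 2) f) (complex_of_real (\<mu> i)) \<noteq> 0"
          using cop root k l unfolding blocks_coprime_def by (auto simp: numeral_2_eq_2)
        then have "c > 0" using c by (cases "c = 0") auto
        have "?P (l + 2) (\<mu> i) = - c * ?P l (\<mu> i)" using c(1) by simp
        then have "(- 1) ^ Suc i * ?P (l + 2) (\<mu> i) = c * ((- 1) ^ i * ?P l (\<mu> i))" by simp
        also have "\<dots> > 0" using s1 \<open>c > 0\<close> by simp
        finally show ?thesis using 3 l by (simp add: s_def numeral_2_eq_2)
      qed
    qed
    obtain \<nu> where \<nu>: "\<And>j. j < Suc k \<Longrightarrow> s (Suc j) < \<nu> j \<and> \<nu> j < s j"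
      "block_poly (Suc k) f = (\<Prod>j<Suc k. [:- complex_of_real (\<nu> j), 1:])"
      using roots_from_sign_changes[OF block_poly_monic im dec sgn] by blast
    have inter: "\<nu> j > \<mu> j \<and> \<mu> j > \<nu> (j + 1)" if "j < k" for j
      using \<nu>(1)[of j] \<nu>(1)[of "Suc j"] that by (auto simp: s_def)
    have dec\<nu>: "\<nu> j < \<nu> i" if "i < j" "j < Suc k" for i j
    proof -
      have "\<nu> j < \<mu> (j - 1)" using inter[of "j - 1"] that by simp
      also have "\<mu> (j - 1) \<le> \<mu> i" using that by (intro le\<mu>) auto
      also have "\<mu> i < \<nu> i" using inter[of i] that by simp
      finally show ?thesis .
    qed
    have "(- 1) ^ j * ?P k (\<nu> j) > 0" if j: "j < Suc k" for j
    proof -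
      have "poly (block_poly k f) (complex_of_real (\<nu> j)) = complex_of_real (\<Prod>i<k. \<nu> j - \<mu> i)"
        using g by (simp add: good_def poly_prod)
      then have "?P k (\<nu> j) = (\<Prod>i<k. \<nu> j - \<mu> i)" by (simp only: Re_complex_of_real)
      also have "{..<k} = {..<j} \<union> {j..<k}" using j by auto
      also have "(\<Prod>i\<in>{..<j} \<union> {j..<k}. \<nu> j - \<mu> i) = (\<Prod>i<j. \<nu> j - \<mu> i) * (\<Prod>i=j..<k. \<nu> j - \<mu> i)"
        by (rule prod.union_disjoint) auto
      also have "(\<Prod>i<j. \<nu> j - \<mu> i) = (- 1) ^ j * (\<Prod>i<j. \<mu> i - \<nu> j)"
        using prod.distrib[of "\<lambda>_. - 1" "\<lambda>i. \<mu> i - \<nu> j" "{..<j}"] by simp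
      finally have "(- 1) ^ j * ?P k (\<nu> j) = ((- 1) ^ j * (- 1) ^ j) * ((\<Prod>i<j. \<mu> i - \<nu> j) * (\<Prod>i=j..<k. \<nu> j - \<mu> i))"
        by (simp only: mult_ac)
      also have "\<dots> = (\<Prod>i<j. \<mu> i - \<nu> j) * (\<Prod>i=j..<k. \<nu> j - \<mu> i)"
        by (simp flip: power_mult_distrib)
      also have "\<dots> > 0"
      proof (intro mult_pos_pos prod_pos)
        fix i assume "i \<in> {..<j}"
        then have i: "i < j" by simp
        have "\<nu> j < \<mu> (j - 1)" using inter[of "j - 1"] i j by simp
        also have "\<mu> (j - 1) \<le> \<mu> i" using i j by (intro le\<mu>) auto
        finally show "0 < \<mu> i - \<nu> j" by simp
      next
        fix i assume "i \<in> {j..<k}"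
        then have i: "j \<le> i" "i < k" by auto
        have "\<mu> i \<le> \<mu> j" using i by (intro le\<mu>) auto
        also have "\<mu> j < \<nu> j" using inter[of j] i by simp
        finally show "0 < \<nu> j - \<mu> i" by simp
      qed
      finally show ?thesis .
    qed
    then show ?thesis using inter dec\<nu> \<nu>(2) unfolding good_def by (intro exI[of _ \<nu>]) simp
  qed
  \<comment> \<open>The rows are chosen recursively, because the interlacing clause ties each row to
    the particular row chosen before it.\<close>
  define \<mu> where "\<mu> = rec_nat (\<lambda>_. 0) (\<lambda>k m. SOME \<nu>. good (Suc k) \<nu> \<and> (\<forall>j<k. \<nu> j > m j \<and> m j > \<nu> (j + 1)))"
  have \<mu>Suc: "\<mu> (Suc k) = (SOME \<nu>. good (Suc k) \<nu> \<and> (\<forall>j<k. \<nu> j > \<mu> k j \<and> \<mu> k j > \<nu> (j + 1)))" for k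
    by (simp add: \<mu>_def)
  have G: "good k (\<mu> k)" if "k \<le> n" for k
    using that
  proof (induction k)
    case 0
    then show ?case by (simp add: good_def)
  next
    case (Suc k)
    then have "k < n" "good k (\<mu> k)" by auto
    from someI_ex[OF step[OF this]] show ?case unfolding \<mu>Suc by blast
  qed
  have I: "\<mu> (Suc k) j > \<mu> k j \<and> \<mu> k j > \<mu> (Suc k) (j + 1)" if "k < n" "j < k" for k j
    using someI_ex[OF step[OF that(1) G]] that unfolding \<mu>Suc by auto
  show ?thesis
    by (rule that[of \<mu>]) (use G I in \<open>auto simp: good_def\<close>)
qed

lemma eigenvalues_decreasing_prod:
  assumes "char_poly A = (\<Prod>j<m. [:- complex_of_real (\<mu> j), 1:])"
    and dec: "\<And>i j. i < j \<Longrightarrow> j < m \<Longrightarrow> \<mu> j < (\<mu> i :: real)"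
  shows "eigenvalues_decreasing A = map \<mu> [0..<m]"
proof -
  have "proots (char_poly A) = (\<Sum>j<m. {#complex_of_real (\<mu> j)#})"
    unfolding assms(1) by (subst proots_prod) auto
  moreover have "image_mset Re (\<Sum>j<m. {#complex_of_real (\<mu> j)#}) = mset (map \<mu> [0..<m])"
    by (induction m) (simp_all add: lessThan_Suc)
  ultimately have "image_mset Re (proots (char_poly A)) = mset (rev (map \<mu> [0..<m]))" by simp
  then have "sorted_list_of_multiset (image_mset Re (proots (char_poly A))) = sort (rev (map \<mu> [0..<m]))"
    by (simp only: sorted_list_of_multiset_mset)
  also have "\<dots> = rev (map \<mu> [0..<m])"
  proof (rule sort_key_id_if_sorted)
    have "\<mu> (m - Suc i) \<le> \<mu> (m - Suc j)" if "i \<le> j" "j < m" for i j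
    proof (cases "i = j")
      case False
      then have "m - Suc j < m - Suc i" "m - Suc i < m" using that by linarith+
      then show ?thesis by (intro less_imp_le dec)
    qed simp
    then show "sorted (map (\<lambda>x. x) (rev (map \<mu> [0..<m])))"
      by (simp add: sorted_iff_nth_mono rev_nth)
  qed
  finally show ?thesis by (simp add: eigenvalues_decreasing_def)
qed

lemma eigenvalues_decreasing_length: "length (eigenvalues_decreasing A) = degree (char_poly A)"
proof -
  have "length (sorted_list_of_multiset M) = size M" for M :: "real multiset"
    by (metis mset_sorted_list_of_multiset size_mset)
  then show ?thesis by (simp add: eigenvalues_decreasing_def size_proots_complex)
qed

lemma eigenvalues_decreasing_root:
  assumes "poly (char_poly A) (complex_of_real x) = 0" "char_poly A \<noteq> 0"
  shows "x \<in> set (eigenvalues_decreasing A)"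
proof -
  have "complex_of_real x \<in> set_mset (proots (char_poly A))" using assms by simp
  then have "Re (complex_of_real x) \<in> Re ` set_mset (proots (char_poly A))" by (rule imageI)
  then show ?thesis by (simp add: eigenvalues_decreasing_def set_sorted_list_of_multiset)
qed

lemma eigenvalues_decreasing_antimono:
  "i \<le> j \<Longrightarrow> j < length (eigenvalues_decreasing A) \<Longrightarrow> eigenvalues_decreasing A ! j \<le> eigenvalues_decreasing A ! i"
  unfolding eigenvalues_decreasing_def
  by (simp add: rev_nth sorted_nth_mono)

section \<open>Gelfand--Zeitlin rows of Hermitian matrices\<close>

lemma index_of_less:
  assumes "j < k" "k < CARD('n::{finite,wellorder})"
  shows "(index_of j :: 'n) < index_of k"
proof -
  have s: "sorted_wrt (<) (sorted_list_of_set (UNIV :: 'n set))"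
    by (rule sorted_list_of_set.strict_sorted_key_list_of_set)
  show ?thesis
    using sorted_wrt_nth_less[OF s, of j k] assms by (simp add: index_of_def)
qed

lemma bij_index_of: "bij_betw (index_of :: nat \<Rightarrow> 'n::{finite,wellorder}) {..<CARD('n)} UNIV"
proof -
  let ?L = "sorted_list_of_set (UNIV :: 'n set)"
  have "bij_betw (\<lambda>i. ?L ! i) {..<length ?L} (set ?L)"
    by (rule bij_betw_nth) simp_all
  then show ?thesis by (simp add: index_of_def[abs_def])
qed

lemma index_of_eq_iff:
  "j < CARD('n::{finite,wellorder}) \<Longrightarrow> k < CARD('n) \<Longrightarrow> (index_of j :: 'n) = index_of k \<longleftrightarrow> j = k"
  using bij_index_of[where 'n='n] by (auto simp: bij_betw_def dest: inj_onD)

lemma index_of_less_iff: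
  assumes "j < CARD('n::{finite,wellorder})" "k < CARD('n)"
  shows "(index_of j :: 'n) < index_of k \<longleftrightarrow> j < k"
  using index_of_less[of j k, where 'n='n] index_of_less[of k j, where 'n='n] assms
  by (cases j k rule: linorder_cases) auto

lemma rank_of_index_of:
  assumes "k < CARD('n::{finite,wellorder})"
  shows "rank_of (index_of k :: 'n) = k"
proof -
  have "{j :: 'n. j < index_of k} = index_of ` {..<k}"
  proof (intro equalityI subsetI)
    fix j :: 'n assume j: "j \<in> {j. j < index_of k}"
    obtain l where l: "l < CARD('n)" "j = index_of l"
      using bij_index_of[where 'n='n] by (metis UNIV_I bij_betw_iff_bijections lessThan_iff)
    then show "j \<in> index_of ` {..<k}" using j index_of_less_iff[OF l(1) assms] by auto
  qed (use index_of_less assms in auto)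
  moreover have "inj_on (index_of :: nat \<Rightarrow> 'n) {..<k}"
    using bij_index_of[where 'n='n] assms by (auto simp: bij_betw_def inj_on_def)
  ultimately show ?thesis by (simp add: rank_of_def card_image)
qed

lemma
  fixes i :: "'n::{finite,wellorder}"
  shows index_of_rank_of: "index_of (rank_of i) = i" and rank_of_less: "rank_of i < CARD('n)"
proof -
  obtain l where l: "l < CARD('n)" "i = index_of l"
    using bij_index_of[where 'n='n] by (metis UNIV_I bij_betw_iff_bijections lessThan_iff)
  then show "index_of (rank_of i) = i" "rank_of i < CARD('n)" by (simp_all add: rank_of_index_of)
qed

lemma rank_of_less_iff: "rank_of i < rank_of j \<longleftrightarrow> i < (j :: 'n::{finite,wellorder})"
  using index_of_less_iff[OF rank_of_less rank_of_less, of i j] by (simp add: index_of_rank_of)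

definition entries :: "'n::{finite,wellorder} cmat \<Rightarrow> nat \<Rightarrow> nat \<Rightarrow> complex" where
  "entries A i j = A $ index_of i $ index_of j"

lemma gz_row_eq: "gz_row k A = eigenvalues_decreasing (leading_block k (entries A))"
  by (simp add: gz_row_def upper_left_block_def leading_block_def entries_def)

lemma char_poly_leading_block: "char_poly (leading_block k f) = block_poly k f"
  by (simp add: block_poly_def)

lemma entries_hermitian:
  assumes "A \<in> hermitian_matrices" shows "cnj (entries A i j) = entries A j i"
proof -
  have "adjoint_matrix A = A" using assms by (simp add: hermitian_matrices_def)
  then have "adjoint_matrix A $ index_of j $ index_of i = A $ index_of j $ index_of i" by simp
  then show ?thesis by (simp add: entries_def)
qed

lemma coprime_imp_interlacing:
  fixes A :: "'n::{finite,wellorder} cmat"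
  assumes A: "A \<in> hermitian_matrices" and cop: "blocks_coprime CARD('n) (entries A)"
  shows "gz_strictly_interlacing A" "gz_top_row A \<in> open_chamber"
    "block_poly CARD('n) (entries A) = (\<Prod>j<CARD('n). [:- complex_of_real (gz_top_row A $ index_of j), 1:])"
proof -
  obtain \<mu> where \<mu>:
    "\<And>k. k \<le> CARD('n) \<Longrightarrow> block_poly k (entries A) = (\<Prod>j<k. [:- complex_of_real (\<mu> k j), 1:])"
    "\<And>k j. k < CARD('n) \<Longrightarrow> j < k \<Longrightarrow> \<mu> (k + 1) j > \<mu> k j \<and> \<mu> k j > \<mu> (k + 1) (j + 1)"
    "\<And>k i j. k \<le> CARD('n) \<Longrightarrow> i < j \<Longrightarrow> j < k \<Longrightarrow> \<mu> k j < \<mu> k i"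
    using block_roots_interlace[OF entries_hermitian[OF A] cop] by blast
  have row: "gz_row k A = map (\<mu> k) [0..<k]" if "k \<le> CARD('n)" for k
    unfolding gz_row_eq
    by (rule eigenvalues_decreasing_prod) (use \<mu> that in \<open>simp_all add: char_poly_leading_block\<close>)
  show "gz_strictly_interlacing A"
    unfolding gz_strictly_interlacing_def
  proof (intro allI impI)
    fix k i assume "1 \<le> k \<and> k < CARD('n)" "i < k"
    then show "gz_row (k + 1) A ! i > gz_row k A ! i \<and> gz_row k A ! i > gz_row (k + 1) A ! (i + 1)"
      using \<mu>(2)[of k i] row[of k] row[of "k + 1"] by (simp del: upt_Suc)
  qed
  have top: "gz_top_row A $ i = \<mu> CARD('n) (rank_of i)" for i
    using row[of "CARD('n)"] rank_of_less[of i] by (simp add: gz_top_row_def)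
  show "gz_top_row A \<in> open_chamber"
    unfolding open_chamber_def by (auto simp: top intro!: \<mu>(3) rank_of_less simp: rank_of_less_iff)
  show "block_poly CARD('n) (entries A) = (\<Prod>j<CARD('n). [:- complex_of_real (gz_top_row A $ index_of j), 1:])"
    unfolding \<mu>(1)[OF order_refl] by (intro prod.cong) (simp_all add: top rank_of_index_of)
qed

text \<open>If x is entry i of row k, strictness puts x properly between the adjacent entries i and
  i + 1 of row k + 1, so x cannot occur in that ordered row.\<close>

lemma interlacing_imp_coprime:
  fixes A :: "'n::{finite,wellorder} cmat"
  assumes I: "gz_strictly_interlacing A"
  shows "blocks_coprime CARD('n) (entries A)"
  unfolding blocks_coprime_def
proof (intro allI impI notI)
  fix k x assume k: "1 \<le> k" "k < CARD('n)"
    and r: "poly (block_poly k (entries A)) (complex_of_real x) = 0 \<and> poly (block_poly (k + 1) (entries A)) (complex_of_real x) = 0"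
  have len: "length (gz_row l A) = l" for l
    by (simp add: gz_row_eq eigenvalues_decreasing_length char_poly_leading_block block_poly_monic)
  have "block_poly l (entries A) \<noteq> 0" for l
    using block_poly_monic(2)[of l "entries A"] by auto
  then have "x \<in> set (gz_row k A)" "x \<in> set (gz_row (k + 1) A)"
    using r by (auto simp: gz_row_eq char_poly_leading_block intro!: eigenvalues_decreasing_root)
  then obtain i j where ij: "i < k" "gz_row k A ! i = x" "j < k + 1" "gz_row (k + 1) A ! j = x"
    by (auto simp: in_set_conv_nth len)
  have lt: "gz_row (k + 1) A ! i > x" "x > gz_row (k + 1) A ! (i + 1)"
    using I k ij unfolding gz_strictly_interlacing_def by auto
  have anti: "gz_row (k + 1) A ! b \<le> gz_row (k + 1) A ! a" if "a \<le> b" "b < k + 1" for a b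
    using that len[of "k + 1"] unfolding gz_row_eq by (intro eigenvalues_decreasing_antimono) simp_all
  show False
  proof (cases "j \<le> i")
    case True
    then show False using anti[of j i] ij lt by simp
  next
    case False
    then show False using anti[of "i + 1" j] ij lt by simp
  qed
qed

lemma sum_index_of: "(\<Sum>j<CARD('n::{finite,wellorder}). g (index_of j :: 'n)) = (\<Sum>l\<in>UNIV. g l)"
  by (rule sum.reindex_bij_betw[OF bij_index_of])

text \<open>Eigenvectors for n distinct eigenvalues account for all roots of the characteristic
  polynomial. Only eigenvector equations have to be carried from one matrix type to the
  other.\<close>

lemma spectrum_from_eigenvectors:
  fixes A :: "'n::{finite,wellorder} cmat"
  assumes a: "a \<in> open_chamber" and nz: "\<And>i. v i \<noteq> 0"
    and ev: "\<And>i l. (A *v v i) $ l = complex_of_real (a $ i) * v i $ l"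
  shows "gz_top_row A = a"
proof -
  have dec: "a $ index_of j < a $ index_of i" if "i < j" "j < CARD('n)" for i j
    using a index_of_less[OF that] by (auto simp: open_chamber_def)
  have "block_poly CARD('n) (entries A) = (\<Prod>j<CARD('n). [:- complex_of_real (a $ index_of j), 1:])"
  proof (rule monic_poly_eq_prod[OF block_poly_monic])
    show "inj_on (\<lambda>j. a $ index_of j) {..<CARD('n)}"
    proof (rule inj_onI)
      fix i j assume "i \<in> {..<CARD('n)}" "j \<in> {..<CARD('n)}" "a $ index_of i = a $ index_of j"
      then show "i = j" using dec[of i j] dec[of j i] by (cases i j rule: linorder_cases) auto
    qed
    fix j assume "j < CARD('n)"
    let ?i = "index_of j :: 'n"
    define w where "w = Matrix.vec CARD('n) (\<lambda>l. v ?i $ index_of l)"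
    have "leading_block CARD('n) (entries A) *\<^sub>v w = complex_of_real (a $ ?i) \<cdot>\<^sub>v w"
    proof (rule eq_vecI)
      fix l assume "l < dim_vec (complex_of_real (a $ ?i) \<cdot>\<^sub>v w)"
      then have l: "l < CARD('n)" by (simp add: w_def)
      have "vec_index (leading_block CARD('n) (entries A) *\<^sub>v w) l = (\<Sum>m<CARD('n). A $ index_of l $ index_of m * v ?i $ index_of m)"
        using l by (simp add: leading_block_def w_def scalar_prod_def entries_def atLeast0LessThan)
      also have "\<dots> = (\<Sum>m\<in>UNIV. A $ index_of l $ m * v ?i $ m)"
        by (rule sum_index_of[of "\<lambda>m. A $ index_of l $ m * v ?i $ m"])
      also have "\<dots> = (A *v v ?i) $ index_of l" by (simp add: matrix_vector_mult_def)
      finally show "vec_index (leading_block CARD('n) (entries A) *\<^sub>v w) l = vec_index (complex_of_real (a $ ?i) \<cdot>\<^sub>v w) l"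
        using l by (simp add: ev w_def)
    qed (simp add: w_def leading_block_def)
    moreover have "w \<noteq> 0\<^sub>v CARD('n)"
    proof
      assume w0: "w = 0\<^sub>v CARD('n)"
      have "v ?i $ l = 0" for l
      proof -
        have "v ?i $ l = vec_index w (rank_of l)" by (simp add: w_def rank_of_less index_of_rank_of)
        then show ?thesis by (simp add: w0 rank_of_less)
      qed
      then have "v ?i = 0" by (intro vec_eqI) simp
      with nz show False by blast
    qed
    ultimately have "eigenvalue (leading_block CARD('n) (entries A)) (complex_of_real (a $ ?i))"
      unfolding eigenvalue_def eigenvector_def by (intro exI[of _ w]) (simp add: w_def leading_block_def)
    then show "poly (block_poly CARD('n) (entries A)) (complex_of_real (a $ ?i)) = 0"
      using eigenvalue_root_char_poly[OF leading_block_carrier] by (simp add: block_poly_def)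
  qed
  then have "gz_row CARD('n) A = map (\<lambda>j. a $ index_of j) [0..<CARD('n)]"
    unfolding gz_row_eq using dec by (intro eigenvalues_decreasing_prod) (simp_all add: char_poly_leading_block)
  then show ?thesis
    by (intro vec_eqI) (simp add: gz_top_row_def rank_of_less index_of_rank_of)
qed

section \<open>Diagonalization of Hermitian matrices with simple spectrum\<close>

definition diagonal_matrix :: "real^'n::finite \<Rightarrow> complex^'n::_^'n::_" where
  "diagonal_matrix a = (\<chi> i j. if i = j then complex_of_real (a $ i) else 0)"

lemma matrix_mult_diagonal: "(B ** diagonal_matrix a) $ i $ j = B $ i $ j * complex_of_real (a $ j)"
  by (simp add: matrix_matrix_mult_def diagonal_matrix_def if_distrib cong: if_cong)

lemma diagonal_matrix_mult: "(diagonal_matrix a ** B) $ i $ j = complex_of_real (a $ i) * B $ i $ j"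
  by (simp add: matrix_matrix_mult_def diagonal_matrix_def if_distrib if_distribR cong: if_cong)

lemma hermitian_conj_unitary:
  "A \<in> hermitian_matrices \<Longrightarrow> g ** A ** adjoint_matrix g \<in> hermitian_matrices"
  using hermitian_conj[of A "adjoint_matrix g"] by simp

lemma gz_top_row_conj_diagonal:
  fixes g :: "'n::{finite,wellorder} cmat"
  assumes g: "g \<in> unitary_group" and a: "a \<in> open_chamber"
  shows "gz_top_row (g ** diagonal_matrix a ** adjoint_matrix g) = a"
proof (rule spectrum_from_eigenvectors[OF a, where v = "\<lambda>i. \<chi> l. g $ l $ i"])
  fix i l
  have "g ** diagonal_matrix a ** adjoint_matrix g ** g = g ** diagonal_matrix a" using g by simp
  then have "((g ** diagonal_matrix a ** adjoint_matrix g) ** g) $ l $ i = complex_of_real (a $ i) * g $ l $ i"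
    by (simp add: matrix_mult_diagonal)
  then show "((g ** diagonal_matrix a ** adjoint_matrix g) *v (\<chi> l. g $ l $ i)) $ l = complex_of_real (a $ i) * (\<chi> l. g $ l $ i) $ l"
    by (simp add: matrix_vector_mult_def matrix_matrix_mult_def)
next
  fix i
  have "(adjoint_matrix g ** g) $ i $ i = 1"
    using unitary_groupD(1)[OF g] by (simp add: Finite_Cartesian_Product.mat_def)
  moreover have "(adjoint_matrix g ** g) $ i $ i = 0" if "\<forall>l. g $ l $ i = 0"
    using that by (simp add: matrix_matrix_mult_def)
  ultimately have "\<not> (\<forall>l. g $ l $ i = 0)" by force
  then show "(\<chi> l. g $ l $ i) \<noteq> 0" by (simp add: Finite_Cartesian_Product.vec_eq_iff)
qed

text \<open>The spectrum is simple, so eigenvectors for different eigenvalues are automatically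
  orthogonal, and normalizing them produces the columns of a unitary matrix.\<close>

lemma hermitian_diagonalization:
  fixes A :: "'n::{finite,wellorder} cmat"
  assumes A: "A \<in> hermitian_matrices" and cop: "blocks_coprime CARD('n) (entries A)"
  obtains g where "g \<in> unitary_group" "A = g ** diagonal_matrix (gz_top_row A) ** adjoint_matrix g"
proof -
  define a where "a = gz_top_row A"
  have a: "a \<in> open_chamber" unfolding a_def by (rule coprime_imp_interlacing(2)[OF A cop])
  have "\<exists>v. v \<noteq> 0 \<and> (\<forall>l. (A *v v) $ l = complex_of_real (a $ i) * v $ l)" for i
  proof -
    have "poly (block_poly CARD('n) (entries A)) (complex_of_real (a $ i)) = 0"
      unfolding coprime_imp_interlacing(3)[OF A cop]
      using rank_of_less[of i] index_of_rank_of[of i] by (auto simp: poly_prod a_def intro!: bexI[of _ "rank_of i"])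
    then have "eigenvalue (leading_block CARD('n) (entries A)) (complex_of_real (a $ i))"
      using eigenvalue_root_char_poly[OF leading_block_carrier] by (simp add: block_poly_def)
    then obtain w where w: "w \<in> carrier_vec CARD('n)" "w \<noteq> 0\<^sub>v CARD('n)"
      "leading_block CARD('n) (entries A) *\<^sub>v w = complex_of_real (a $ i) \<cdot>\<^sub>v w"
      by (auto simp: eigenvalue_def eigenvector_def leading_block_def)
    define v :: "(complex, 'n) Finite_Cartesian_Product.vec" where "v = (\<chi> l. vec_index w (rank_of l))"
    have "v \<noteq> 0"
    proof
      assume "v = 0"
      then have v0: "v $ index_of l = 0" for l by simp
      have "w = 0\<^sub>v CARD('n)"
      proof (rule eq_vecI)
        fix l assume "l < dim_vec (0\<^sub>v CARD('n) :: complex Matrix.vec)"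
        then show "vec_index w l = vec_index (0\<^sub>v CARD('n)) l"
          using v0[of l] by (simp add: v_def rank_of_index_of)
      qed (use w in simp)
      with w(2) show False by simp
    qed
    moreover have "(A *v v) $ l = complex_of_real (a $ i) * v $ l" for l
    proof -
      have "(A *v v) $ l = (\<Sum>m<CARD('n). A $ l $ index_of m * v $ index_of m)"
        unfolding matrix_vector_mult_def vec_lambda_beta by (rule sum_index_of[of "\<lambda>m. A $ l $ m * v $ m", symmetric])
      also have "\<dots> = (\<Sum>m<CARD('n). entries A (rank_of l) m * vec_index w m)"
        by (intro sum.cong) (simp_all add: v_def rank_of_index_of entries_def index_of_rank_of)
      also have "\<dots> = vec_index (leading_block CARD('n) (entries A) *\<^sub>v w) (rank_of l)"
        using w(1) rank_of_less[of l] by (simp add: leading_block_def scalar_prod_def atLeast0LessThan)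
      also have "\<dots> = complex_of_real (a $ i) * v $ l"
        using w(1) rank_of_less[of l] by (simp add: w(3) v_def)
      finally show ?thesis .
    qed
    ultimately show ?thesis by blast
  qed
  then have "\<forall>i. \<exists>v. v \<noteq> 0 \<and> (\<forall>l. (A *v v) $ l = complex_of_real (a $ i) * v $ l)" by blast
  from choice[OF this] obtain v where v: "\<And>i. v i \<noteq> 0" "\<And>i l. (A *v v i) $ l = complex_of_real (a $ i) * v i $ l"
    by blast
  define ip where "ip x y = (\<Sum>l\<in>UNIV. cnj (x $ l) * y $ l)" for x y :: "(complex, 'n) Finite_Cartesian_Product.vec"
  have ipA: "ip x (A *v y) = ip (A *v x) y" for x y
  proof -
    have h: "cnj (A $ m $ l) = A $ l $ m" for m l
    proof -
      have "adjoint_matrix A $ l $ m = A $ l $ m" using A by (simp add: hermitian_matrices_def)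
      then show ?thesis by simp
    qed
    have "ip x (A *v y) = (\<Sum>l\<in>UNIV. \<Sum>m\<in>UNIV. cnj (x $ l) * (A $ l $ m * y $ m))"
      by (simp add: ip_def matrix_vector_mult_def sum_distrib_left)
    also have "\<dots> = (\<Sum>m\<in>UNIV. \<Sum>l\<in>UNIV. cnj (x $ l) * (A $ l $ m * y $ m))" by (rule sum.swap)
    also have "\<dots> = ip (A *v x) y"
      unfolding ip_def matrix_vector_mult_def by (simp add: sum_distrib_left h mult_ac)
    finally show ?thesis .
  qed
  have orth: "ip (v i) (v j) = 0" if "i \<noteq> j" for i j
  proof -
    have e1: "ip (v i) (A *v v j) = complex_of_real (a $ j) * ip (v i) (v j)"
      by (simp add: ip_def v(2) sum_distrib_left mult_ac)
    have e2: "ip (A *v v i) (v j) = complex_of_real (a $ i) * ip (v i) (v j)"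
      by (simp add: ip_def v(2) sum_distrib_left mult_ac)
    have "ip (v i) (v j) = 0 \<or> a $ j = a $ i"
      using e1[symmetric, unfolded ipA e2] by auto
    moreover have "a $ j \<noteq> a $ i"
      using a that by (cases i j rule: linorder_cases) (force simp: open_chamber_def)+
    ultimately show ?thesis by simp
  qed
  have ipn: "ip (v i) (v i) = complex_of_real ((norm (v i))\<^sup>2)" for i
    by (simp add: ip_def norm_vec_def L2_set_def sum_nonneg complex_norm_square mult.commute del: of_real_power)
  define g :: "'n cmat" where "g = (\<chi> l i. v i $ l / complex_of_real (norm (v i)))"
  have "(adjoint_matrix g ** g) $ i $ j = (mat 1 :: 'n cmat) $ i $ j" for i j
  proof -
    have "(adjoint_matrix g ** g) $ i $ j = ip (v i) (v j) / complex_of_real (norm (v i) * norm (v j))"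
      by (simp add: matrix_matrix_mult_def g_def ip_def sum_divide_distrib)
    then show ?thesis
      using v(1) orth[of i j] ipn[of i]
      by (cases "i = j") (simp_all add: Finite_Cartesian_Product.mat_def power2_eq_square)
  qed
  then have g: "g \<in> unitary_group" by (intro unitary_groupI matrix_eqI)
  have "A ** g = g ** diagonal_matrix a"
  proof (rule matrix_eqI)
    fix l i
    have "(A ** g) $ l $ i = (A *v v i) $ l / complex_of_real (norm (v i))"
      by (simp add: matrix_matrix_mult_def matrix_vector_mult_def g_def sum_divide_distrib)
    then show "(A ** g) $ l $ i = (g ** diagonal_matrix a) $ l $ i"
      by (simp add: v(2) matrix_mult_diagonal g_def)
  qed
  then have "A = g ** diagonal_matrix a ** adjoint_matrix g"
    using g by (metis unitary_cancel_right(2))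
  then show ?thesis using g by (intro that) (simp_all add: a_def)
qed

section \<open>Generic Hermitian matrices\<close>

text \<open>Tonelli along the direction \<open>e\<close>, with translation invariance in place of
  adapted coordinates: every translate of \<open>N\<close> has the same measure, and after the
  exchange of integrals each line contributes zero.\<close>

lemma null_if_lines_finite:
  fixes N :: "'a::euclidean_space set"
  assumes N: "N \<in> sets borel" and fin: "\<And>x. finite {t. x + t *\<^sub>R e \<in> N}"
  shows "emeasure lborel N = 0"
proof -
  have meas: "(\<lambda>(t, x). indicator {0..1} t * indicator N (x + t *\<^sub>R e) :: ennreal) \<in> borel_measurable (lborel \<Otimes>\<^sub>M lborel)"
    using N by measurable
  \<comment> \<open>The factor \<open>indicator {0..1}\<close> has integral 1; it averages over the
    translations by \<open>t *\<^sub>R e\<close>.\<close>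
  have "emeasure lborel N = (\<integral>\<^sup>+t. indicator {0..1::real} t * emeasure lborel N \<partial>lborel)"
    by (simp add: nn_integral_multc)
  also have "\<dots> = (\<integral>\<^sup>+t. (\<integral>\<^sup>+x. indicator {0..1} t * indicator N (x + t *\<^sub>R e) \<partial>lborel) \<partial>lborel)"
  proof (rule nn_integral_cong)
    fix t :: real
    have "emeasure lborel N = (\<integral>\<^sup>+x. indicator N x \<partial>distr lborel borel ((+) (t *\<^sub>R e)))"
      using N by (simp add: lborel_distr_plus)
    also have "\<dots> = (\<integral>\<^sup>+x. indicator N (x + t *\<^sub>R e) \<partial>lborel)"
      using N by (subst nn_integral_distr) (simp_all add: add.commute)
    finally show "indicator {0..1} t * emeasure lborel N = (\<integral>\<^sup>+x. indicator {0..1} t * indicator N (x + t *\<^sub>R e) \<partial>lborel)"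
      using N by (subst nn_integral_cmult) simp_all
  qed
  also have "\<dots> = (\<integral>\<^sup>+x. (\<integral>\<^sup>+t. indicator {0..1} t * indicator N (x + t *\<^sub>R e) \<partial>lborel) \<partial>lborel)"
    by (rule lborel_pair.Fubini'[OF meas, symmetric])
  also have "\<dots> = (\<integral>\<^sup>+x. 0 \<partial>(lborel :: 'a measure))"
  proof (rule nn_integral_cong)
    fix x :: 'a
    have "AE t in lborel. t \<notin> {t. x + t *\<^sub>R e \<in> N}"
      by (rule AE_not_in) (rule finite_imp_null_set_lborel[OF fin])
    then have "AE t in lborel. indicator {0..1} t * indicator N (x + t *\<^sub>R e) = (0 :: ennreal)"
      by eventually_elim simp
    then have "(\<integral>\<^sup>+t. indicator {0..1} t * indicator N (x + t *\<^sub>R e) \<partial>lborel) = (\<integral>\<^sup>+t. 0 \<partial>(lborel :: real measure))"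
      by (rule nn_integral_cong_AE)
    then show "(\<integral>\<^sup>+t. indicator {0..1} t * indicator N (x + t *\<^sub>R e) \<partial>lborel) = 0" by simp
  qed
  finally show ?thesis by simp
qed

definition hm_block_poly :: "nat \<Rightarrow> 'n::{finite,wellorder} hcoord \<Rightarrow> real \<Rightarrow> complex" where
  "hm_block_poly k x t = poly (block_poly k (entries (hm x))) (complex_of_real t)"

lemma continuous_entries_hm:
  fixes f :: "'a::topological_space \<Rightarrow> 'n::{finite,wellorder} hcoord"
  assumes "continuous_on S f"
  shows "continuous_on S (\<lambda>x. entries (hm (f x)) i j)"
  unfolding entries_def
  by (intro continuous_on_component bounded_linear.continuous_on[OF bounded_linear_hm] assms)

lemma continuous_hm_block_poly:
  fixes f :: "'a::topological_space \<Rightarrow> 'n::{finite,wellorder} hcoord"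
  assumes "continuous_on S f" "continuous_on S g"
  shows "continuous_on S (\<lambda>x. hm_block_poly k (f x) (g x))"
proof -
  have "continuous_on S (\<lambda>x. (if b then complex_of_real (g x) else 0) - entries (hm (f x)) i j)" for b i j
    by (cases b) (auto intro!: continuous_intros continuous_entries_hm assms)
  then show ?thesis
    unfolding hm_block_poly_def poly_block_poly_sum
    by (intro continuous_on_sum continuous_on_mult continuous_on_const continuous_on_prod)
qed

definition common_root_set :: "nat \<Rightarrow> ('n::{finite,wellorder} hcoord) set" where
  "common_root_set k = {x. \<exists>t. hm_block_poly k x t = 0 \<and> hm_block_poly (k + 1) x t = 0}"

definition generic :: "('n::{finite,wellorder} hcoord) set" where
  "generic = {x. blocks_coprime CARD('n) (entries (hm x))}"

lemma common_root_set_0 [simp]: "common_root_set 0 = {}"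
  by (simp add: common_root_set_def hm_block_poly_def)

text \<open>The projection of a Borel set need not be Borel. Here the set is a countable union of
  projections of closed sets along compact intervals of t, and those projections are closed.\<close>

lemma borel_common_root_set: "common_root_set k \<in> sets borel"
proof -
  let ?T = "{p :: real \<times> 'a hcoord. hm_block_poly k (snd p) (fst p) = 0 \<and> hm_block_poly (k + 1) (snd p) (fst p) = 0}"
  have "closed ?T"
    by (intro closed_Collect_conj closed_Collect_eq continuous_hm_block_poly continuous_intros)
  then have "closed {x. \<exists>t. t \<in> {- real R..real R} \<and> (t, x) \<in> ?T}" for R
    by (intro closed_compact_projection) simp_all
  then have "(\<Union>R. {x. \<exists>t. t \<in> {- real R..real R} \<and> (t, x) \<in> ?T}) \<in> sets borel"
    by (intro sets.countable_UN image_subsetI) (auto intro: borel_closed)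
  also have "(\<Union>R. {x. \<exists>t. t \<in> {- real R..real R} \<and> (t, x) \<in> ?T}) = common_root_set k"
  proof (intro equalityI subsetI)
    fix x :: "'a hcoord" assume "x \<in> common_root_set k"
    then obtain t where t: "hm_block_poly k x t = 0" "hm_block_poly (k + 1) x t = 0"
      by (auto simp: common_root_set_def)
    obtain R where "\<bar>t\<bar> \<le> real R" using real_arch_simple by blast
    then show "x \<in> (\<Union>R. {x. \<exists>t. t \<in> {- real R..real R} \<and> (t, x) \<in> ?T})"
      using t by (auto intro!: exI[of _ R] exI[of _ t])
  qed (auto simp: common_root_set_def)
  finally show ?thesis .
qed

lemma entries_hm_line:
  assumes "a < CARD('n::{finite,wellorder})" "b < CARD('n)" "m + 1 < CARD('n)"
  shows "entries (hm (x + s *\<^sub>R axis (index_of m, index_of (m + 1)) 1 :: 'n hcoord)) a b =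
    entries (hm x) a b + (if {a, b} = {m, m + 1} then complex_of_real (s / sqrt 2) else 0)"
proof -
  have e: "hm (axis (index_of m, index_of (m + 1)) 1 :: 'n hcoord) $ index_of a $ index_of b =
      (if {a, b} = {m, m + 1} then complex_of_real (1 / sqrt 2) else 0)"
    using assms by (auto simp: hm_def axis_def index_of_eq_iff index_of_less_iff complex_eq_iff doubleton_eq_iff)
  show ?thesis
    unfolding entries_def hm_add hm_scaleR vector_add_component vector_scaleR_component e
    by (simp add: scaleR_conv_of_real)
qed

text \<open>The line varies the real part of the entry (m, m + 1). Leading blocks up to size m + 1
  stay fixed along it, so only the finitely many roots t of P_(m+1) can become common roots. Where
  P_m(t) is nonzero, the Sturm identity makes P_(m+2)(t) a nonzero multiple of the squared modulus
  of a constant plus s / sqrt 2, which vanishes for at most one s. Removing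
  \<open>common_root_set m\<close> guarantees that P_m(t) is nonzero.\<close>

lemma common_root_line_finite:
  fixes x :: "'n::{finite,wellorder} hcoord"
  assumes m: "m + 1 < CARD('n)"
  shows "finite {s. x + s *\<^sub>R axis (index_of m, index_of (m + 1)) 1 \<in> common_root_set (m + 1) - common_root_set m}"
proof -
  define y where "y s = x + s *\<^sub>R axis (index_of m, index_of (m + 1)) 1" for s :: real
  let ?f = "\<lambda>s. entries (hm (y s))"
  let ?R = "{t. hm_block_poly (m + 1) x t = 0}"
  have ent: "?f s a b = entries (hm x) a b + (if {a, b} = {m, m + 1} then complex_of_real (s / sqrt 2) else 0)"
    if "a \<le> m + 1" "b \<le> m + 1" for s a b
    unfolding y_def by (rule entries_hm_line) (use that m in simp_all)
  have indep: "hm_block_poly k (y s) t = hm_block_poly k x t" if "k \<le> m + 1" for k s t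
    unfolding hm_block_poly_def
    by (intro arg_cong2[where f = poly] block_poly_cong) (use that in \<open>auto simp: ent doubleton_eq_iff\<close>)
  have finR: "finite ?R"
  proof -
    have "block_poly (m + 1) (entries (hm x)) \<noteq> 0"
      using block_poly_monic(2)[of "m + 1" "entries (hm x)"] by auto
    then have "finite {z. poly (block_poly (m + 1) (entries (hm x))) z = 0}" by (rule poly_roots_finite)
    then have "finite (complex_of_real -` {z. poly (block_poly (m + 1) (entries (hm x))) z = 0})"
      by (rule finite_vimageI) (simp add: inj_on_def)
    then show ?thesis by (simp add: hm_block_poly_def vimage_def)
  qed
  have one: "finite {s. hm_block_poly (m + 2) (y s) t = 0}" if t: "t \<in> ?R" "hm_block_poly m x t \<noteq> 0" for t
  proof -
    obtain u where u: "u m = 1" "\<And>i. i \<le> m \<Longrightarrow> (\<Sum>j\<le>m. entries (hm x) i j * u j) = complex_of_real t * u i"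
      using block_eigenvector[of m "entries (hm x)" "complex_of_real t"] t by (auto simp: hm_block_poly_def)
    define \<sigma> where "\<sigma> = (\<Sum>j\<le>m. entries (hm x) (m + 1) j * u j)"
    have "s = - sqrt 2 * Re \<sigma>" if s: "hm_block_poly (m + 2) (y s) t = 0" for s
    proof -
      have "(\<Sum>j\<le>m. ?f s i j * u j) = complex_of_real t * u i" if "i \<le> m" for i
      proof -
        have "(\<Sum>j\<le>m. ?f s i j * u j) = (\<Sum>j\<le>m. entries (hm x) i j * u j)"
          by (intro sum.cong) (use that in \<open>auto simp: ent doubleton_eq_iff\<close>)
        then show ?thesis using u(2)[OF that] by simp
      qed
      from block_poly_sturm[OF entries_hermitian[OF hm_hermitian] u(1) this]
      have "complex_of_real ((cmod (\<Sum>j\<le>m. ?f s (m + 1) j * u j))\<^sup>2) * hm_block_poly m (y s) t = 0"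
        using s by (simp add: hm_block_poly_def)
      then have "(\<Sum>j\<le>m. ?f s (m + 1) j * u j) = 0"
        using t(2) by (simp add: indep)
      also have "(\<Sum>j\<le>m. ?f s (m + 1) j * u j) =
          (\<Sum>j\<le>m. entries (hm x) (m + 1) j * u j + (if j = m then complex_of_real (s / sqrt 2) * u m else 0))"
        by (intro sum.cong) (auto simp: ent doubleton_eq_iff distrib_right)
      also have "\<dots> = \<sigma> + complex_of_real (s / sqrt 2)"
        by (simp add: sum.distrib \<sigma>_def u(1))
      finally have "Re \<sigma> + s / sqrt 2 = 0" by (metis Re_complex_of_real plus_complex.simps(1) zero_complex.simps(1))
      then show ?thesis by (simp add: field_simps)
    qed
    then have "{s. hm_block_poly (m + 2) (y s) t = 0} \<subseteq> {- sqrt 2 * Re \<sigma>}" by auto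
    then show ?thesis by (rule finite_subset) simp
  qed
  have "{s. x + s *\<^sub>R axis (index_of m, index_of (m + 1)) 1 \<in> common_root_set (m + 1) - common_root_set m} = {s. y s \<in> common_root_set (m + 1) - common_root_set m}"
    by (simp add: y_def)
  also have "\<dots> \<subseteq> (\<Union>t\<in>{t \<in> ?R. hm_block_poly m x t \<noteq> 0}. {s. hm_block_poly (m + 2) (y s) t = 0})"
    by (auto simp: common_root_set_def indep)
  finally have sub: "{s. x + s *\<^sub>R axis (index_of m, index_of (m + 1)) 1 \<in> common_root_set (m + 1) - common_root_set m}
      \<subseteq> (\<Union>t\<in>{t \<in> ?R. hm_block_poly m x t \<noteq> 0}. {s. hm_block_poly (m + 2) (y s) t = 0})" .
  have "finite (\<Union>t\<in>{t \<in> ?R. hm_block_poly m x t \<noteq> 0}. {s. hm_block_poly (m + 2) (y s) t = 0})"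
    using finR one by (intro finite_UN_I) auto
  with sub show ?thesis by (rule finite_subset)
qed

text \<open>Exceptional matrices are sorted by the first size at which a common root appears;
  \<open>common_root_set 0\<close> is empty, so such a first size exists. Each difference set is one
  to which the finiteness on lines applies.\<close>

lemma generic_eq:
  "generic = UNIV - (\<Union>m\<in>{m. m + 1 < CARD('n)}. common_root_set (m + 1) - (common_root_set m :: ('n::{finite,wellorder} hcoord) set))"
proof -
  have *: "x \<in> generic \<longleftrightarrow> (\<forall>k. 1 \<le> k \<longrightarrow> k < CARD('n) \<longrightarrow> x \<notin> common_root_set k)" for x :: "'n hcoord"
    by (auto simp: generic_def blocks_coprime_def common_root_set_def hm_block_poly_def)
  have imp: "x \<in> generic" if x: "\<forall>m. m + 1 < CARD('n) \<longrightarrow> x \<in> common_root_set m \<or> x \<notin> common_root_set (m + 1)" for x :: "'n hcoord"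
  proof -
    have "k < CARD('n) \<longrightarrow> x \<notin> common_root_set k" for k
      by (induction k) (use x in auto)
    then show ?thesis by (simp add: *)
  qed
  show ?thesis
  proof (intro equalityI subsetI)
    fix x :: "'n hcoord" assume "x \<in> generic"
    then show "x \<in> UNIV - (\<Union>m\<in>{m. m + 1 < CARD('n)}. common_root_set (m + 1) - common_root_set m)"
      unfolding * by auto
  next
    fix x :: "'n hcoord"
    assume "x \<in> UNIV - (\<Union>m\<in>{m. m + 1 < CARD('n)}. common_root_set (m + 1) - common_root_set m)"
    then show "x \<in> generic" by (intro imp) blast
  qed
qed

lemma borel_generic [measurable]: "(generic :: ('n::{finite,wellorder} hcoord) set) \<in> sets borel"
  unfolding generic_eq using borel_common_root_set
  by (intro sets.Diff sets.countable_UN' ) auto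

lemma AE_generic: "AE x in lborel. x \<in> (generic :: ('n::{finite,wellorder} hcoord) set)"
proof -
  let ?N = "\<Union>m\<in>{m. m + 1 < CARD('n)}. common_root_set (m + 1) - (common_root_set m :: ('n hcoord) set)"
  have "?N \<in> null_sets lborel"
  proof (rule null_sets_UN')
    fix m assume m: "m \<in> {m. m + 1 < CARD('n)}"
    have b: "common_root_set (m + 1) - (common_root_set m :: ('n hcoord) set) \<in> sets borel"
      by (intro sets.Diff borel_common_root_set)
    then have "emeasure lborel (common_root_set (m + 1) - (common_root_set m :: ('n hcoord) set)) = 0"
      by (rule null_if_lines_finite[OF _ common_root_line_finite]) (use m in simp)
    then show "common_root_set (m + 1) - (common_root_set m :: ('n hcoord) set) \<in> null_sets lborel"
      using b by (intro null_setsI) simp_all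
  qed simp
  then have "AE x in lborel. x \<notin> ?N" by (rule AE_not_in)
  then show ?thesis by (simp add: generic_eq)
qed

lemma generic_iff_interlacing: "gz_strictly_interlacing (hm x) \<longleftrightarrow> x \<in> generic"
  using coprime_imp_interlacing(1)[OF hm_hermitian] interlacing_imp_coprime by (auto simp: generic_def)

lemma generic_top_row: "x \<in> generic \<Longrightarrow> gz_top_row (hm x) \<in> open_chamber"
  using coprime_imp_interlacing(2)[OF hm_hermitian] by (auto simp: generic_def)

text \<open>This makes the spectrum measurable. The roots are controlled by the signs of the
  characteristic polynomial at n + 1 separating points. These signs are an open condition, and the
  same points separate the roots of every matrix in the neighbourhood.\<close>

lemma gz_top_row_lower_semicontinuous:
  fixes x :: "'n::{finite,wellorder} hcoord"
  assumes x: "x \<in> generic" and c: "c < gz_top_row (hm x) $ i"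
  obtains U where "open U" "x \<in> U" "\<And>y. y \<in> U \<Longrightarrow> y \<in> generic \<Longrightarrow> c < gz_top_row (hm y) $ i"
proof -
  let ?n = "CARD('n)" and ?p = "\<lambda>y. block_poly CARD('n) (entries (hm y))"
  define \<mu> where "\<mu> j = gz_top_row (hm x) $ index_of j" for j
  have dec: "\<mu> j < \<mu> l" if "l < j" "j < ?n" for l j
    using generic_top_row[OF x] index_of_less[OF that] by (auto simp: open_chamber_def \<mu>_def)
  \<comment> \<open>The point \<open>s j\<close> separates \<open>\<mu> j\<close> from
    \<open>\<mu> (j - 1)\<close>, and it is taken at least \<open>c\<close> whenever the upper root
    exceeds \<open>c\<close>. The corresponding root of a nearby matrix lies above
    \<open>s j\<close>, hence above \<open>c\<close>.\<close>
  have "\<exists>s. (0 < j \<longrightarrow> s < \<mu> (j - 1) \<and> (c < \<mu> (j - 1) \<longrightarrow> c \<le> s)) \<and> (j < ?n \<longrightarrow> \<mu> j < s)" if j: "j \<le> ?n" for j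
  proof (cases "j = 0")
    case True
    then show ?thesis by (auto intro: exI[of _ "\<mu> 0 + 1"])
  next
    case False
    define L where "L = max (if c < \<mu> (j - 1) then c else \<mu> (j - 1) - 1) (if j < ?n then \<mu> j else \<mu> (j - 1) - 1)"
    have "L < \<mu> (j - 1)" using dec[of "j - 1" j] False by (auto simp: L_def)
    then obtain s where "L < s" "s < \<mu> (j - 1)" using dense by blast
    then show ?thesis by (intro exI[of _ s]) (auto simp: L_def split: if_splits)
  qed
  then have "\<forall>j. \<exists>s. j \<le> ?n \<longrightarrow> (0 < j \<longrightarrow> s < \<mu> (j - 1) \<and> (c < \<mu> (j - 1) \<longrightarrow> c \<le> s)) \<and> (j < ?n \<longrightarrow> \<mu> j < s)" by blast
  from choice[OF this] obtain s where s:
    "\<And>j. j \<le> ?n \<Longrightarrow> (0 < j \<longrightarrow> s j < \<mu> (j - 1) \<and> (c < \<mu> (j - 1) \<longrightarrow> c \<le> s j)) \<and> (j < ?n \<longrightarrow> \<mu> j < s j)"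
    by blast
  define U where "U = {y :: 'n hcoord. \<forall>j\<le>?n. 0 < (- 1) ^ j * Re (hm_block_poly ?n y (s j))}"
  show ?thesis
  proof (rule that)
    have "U = (\<Inter>j\<le>?n. {y. 0 < (- 1) ^ j * Re (hm_block_poly ?n y (s j))})" by (auto simp: U_def)
    then show "open U"
      by (auto intro!: open_INT open_Collect_less continuous_intros continuous_hm_block_poly)
    show "x \<in> U"
      unfolding U_def
    proof (intro CollectI allI impI)
      fix j assume j: "j \<le> ?n"
      have "?p x = (\<Prod>l<?n. [:- complex_of_real (\<mu> l), 1:])"
        using coprime_imp_interlacing(3)[OF hm_hermitian, of x] x by (simp add: generic_def \<mu>_def)
      then have h: "hm_block_poly ?n x (s j) = complex_of_real (\<Prod>l<?n. s j - \<mu> l)"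
        by (simp add: hm_block_poly_def poly_prod)
      have "(\<Prod>l<?n. s j - \<mu> l) = (\<Prod>l<j. s j - \<mu> l) * (\<Prod>l=j..<?n. s j - \<mu> l)"
        using prod.atLeastLessThan_concat[of 0 j ?n "\<lambda>l. s j - \<mu> l"] j by (simp add: atLeast0LessThan)
      also have "(\<Prod>l<j. s j - \<mu> l) = (\<Prod>l<j. (- 1) * (\<mu> l - s j))" by simp
      also have "\<dots> = (- 1) ^ j * (\<Prod>l<j. \<mu> l - s j)"
        unfolding prod.distrib by simp
      finally have "(- 1) ^ j * (\<Prod>l<?n. s j - \<mu> l) = ((- 1) ^ j * (- 1) ^ j) * ((\<Prod>l<j. \<mu> l - s j) * (\<Prod>l=j..<?n. s j - \<mu> l))"
        by (simp only: mult_ac)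
      then have e: "(- 1) ^ j * Re (hm_block_poly ?n x (s j)) = (\<Prod>l<j. \<mu> l - s j) * (\<Prod>l=j..<?n. s j - \<mu> l)"
        unfolding h Re_complex_of_real by (simp flip: power_mult_distrib)
      have "(\<Prod>l<j. \<mu> l - s j) > 0"
      proof (rule prod_pos)
        fix l assume "l \<in> {..<j}"
        then have "s j < \<mu> (j - 1)" "l = j - 1 \<or> l < j - 1 \<and> j - 1 < ?n" using s[OF j] j by auto
        then show "0 < \<mu> l - s j" using dec[of l "j - 1"] by auto
      qed
      moreover have "(\<Prod>l=j..<?n. s j - \<mu> l) > 0"
      proof (rule prod_pos)
        fix l assume "l \<in> {j..<?n}"
        then show "0 < s j - \<mu> l" using s[OF j] dec[of j l] by (cases "l = j") auto
      qed
      ultimately show "0 < (- 1) ^ j * Re (hm_block_poly ?n x (s j))" by (simp add: e)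
    qed
    fix y assume y: "y \<in> U" "y \<in> generic"
    have sdec: "s (Suc j) < s j" if "j < ?n" for j
      using s[of "Suc j"] s[of j] that by auto
    obtain \<nu> where \<nu>: "\<And>j. j < ?n \<Longrightarrow> s (Suc j) < \<nu> j \<and> \<nu> j < s j"
      "?p y = (\<Prod>j<?n. [:- complex_of_real (\<nu> j), 1:])"
    proof (rule roots_from_sign_changes[of "?p y" ?n s])
      show "Im (poly (?p y) (complex_of_real t)) = 0" for t
        by (intro poly_block_poly_real entries_hermitian hm_hermitian)
    qed (use y sdec block_poly_monic in \<open>auto simp: U_def hm_block_poly_def\<close>)
    have \<nu>dec: "\<nu> j < \<nu> l" if "l < j" "j < ?n" for l j
      using that
    proof (induction j)
      case (Suc j)
      have "\<nu> (Suc j) < \<nu> j" using \<nu>(1)[of j] \<nu>(1)[of "Suc j"] Suc.prems by auto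
      then show ?case using Suc by (cases "l = j") auto
    qed simp
    have "gz_row ?n (hm y) = map \<nu> [0..<?n]"
      unfolding gz_row_eq by (rule eigenvalues_decreasing_prod) (simp_all add: char_poly_leading_block \<nu>(2) \<nu>dec)
    then have "gz_top_row (hm y) $ i = \<nu> (rank_of i)"
      using rank_of_less[of i] by (simp add: gz_top_row_def)
    moreover have "c \<le> s (Suc (rank_of i))"
      using s[of "Suc (rank_of i)"] rank_of_less[of i] c by (simp add: \<mu>_def index_of_rank_of)
    ultimately show "c < gz_top_row (hm y) $ i" using \<nu>(1)[OF rank_of_less[of i]] by simp
  qed
qed

lemma measurable_gz_top_row_nth:
  "(\<lambda>x :: 'n::{finite,wellorder} hcoord. gz_top_row (hm x) $ i) \<in> borel_measurable (restrict_space borel generic)"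
proof (rule borel_measurableI_greater)
  fix c
  let ?F = "{U. open U \<and> (\<forall>y\<in>U \<inter> generic. c < gz_top_row (hm y) $ i)}"
  have "{x \<in> space (restrict_space borel generic). c < gz_top_row (hm x) $ i} = \<Union>?F \<inter> generic"
  proof (intro equalityI subsetI)
    fix x :: "'n hcoord" assume "x \<in> {x \<in> space (restrict_space borel generic). c < gz_top_row (hm x) $ i}"
    then have x: "x \<in> generic" "c < gz_top_row (hm x) $ i" by (simp_all add: space_restrict_space)
    then obtain U where "open U" "x \<in> U" "\<And>y. y \<in> U \<Longrightarrow> y \<in> generic \<Longrightarrow> c < gz_top_row (hm y) $ i"
      by (rule gz_top_row_lower_semicontinuous) blast
    then show "x \<in> \<Union>?F \<inter> generic" using x(1) by blast
  qed (auto simp: space_restrict_space)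
  moreover have "\<Union>?F \<in> sets borel" by (intro borel_open open_Union) auto
  ultimately show "{x \<in> space (restrict_space borel generic). c < gz_top_row (hm x) $ i} \<in> sets (restrict_space borel generic)"
    by (auto simp: sets_restrict_space)
qed

lemma measurable_gz_top_row:
  "(\<lambda>x :: 'n::{finite,wellorder} hcoord. gz_top_row (hm x)) \<in> restrict_space borel generic \<rightarrow>\<^sub>M borel"
  unfolding borel_measurable_euclidean_space[of "\<lambda>x. gz_top_row (hm x)"]
  by (auto simp: Basis_vec_def inner_axis intro: measurable_gz_top_row_nth)

section \<open>Polar coordinates on Hermitian matrices\<close>

type_synonym 'n rvec = "(real, 'n) Finite_Cartesian_Product.vec"

definition conj_coords :: "'n::{finite,wellorder} cmat \<Rightarrow> 'n hcoord \<Rightarrow> 'n hcoord" where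
  "conj_coords g x = hermitian_coords (g ** hm x ** adjoint_matrix g)"

lemma hm_conj_coords: "hm (conj_coords g x) = g ** hm x ** adjoint_matrix g"
  unfolding conj_coords_def by (intro hm_hermitian_coords hermitian_conj_unitary hm_hermitian)

lemma linear_conj_coords: "linear (conj_coords g)"
  by (intro linearI)
    (simp_all add: conj_coords_def hm_add hm_scaleR matrix_mult.add_left matrix_mult.add_right
      matrix_mult.scaleR_left matrix_mult.scaleR_right linear_add[OF linear_hermitian_coords]
      linear_scale[OF linear_hermitian_coords])

lemma conj_coords_mult: "conj_coords g (conj_coords k x) = conj_coords (g ** k) x"
  by (rule injD[OF inj_hm]) (simp add: hm_conj_coords adjoint_matrix_mult matrix_mul_assoc)

lemma conj_coords_one [simp]: "conj_coords (mat 1) x = x"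
  by (rule injD[OF inj_hm]) (simp add: hm_conj_coords adjoint_mat)

lemma conj_coords_inverse [simp]:
  assumes "g \<in> unitary_group"
  shows "conj_coords (adjoint_matrix g) (conj_coords g x) = x" "conj_coords g (conj_coords (adjoint_matrix g) x) = x"
  using unitary_groupD[OF assms] by (simp_all add: conj_coords_mult)

lemma norm_conj_coords:
  assumes g: "g \<in> unitary_group" shows "norm (conj_coords g x) = norm x"
proof -
  have "complex_of_real ((norm (conj_coords g x))\<^sup>2) = trace (adjoint_matrix (hm (conj_coords g x)) ** hm (conj_coords g x))"
    unfolding norm_power2_eq_trace[symmetric] by simp
  also have "\<dots> = trace (g ** (hm x ** hm x ** adjoint_matrix g))"
    using g by (simp add: hm_conj_coords adjoint_matrix_mult flip: matrix_mul_assoc)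
  also have "\<dots> = trace (hm x ** hm x)"
    using g by (subst trace_matrix_mult_commute) simp
  also have "\<dots> = complex_of_real ((norm x)\<^sup>2)"
    using norm_power2_eq_trace[of "hm x"] by simp
  finally have "(norm (conj_coords g x))\<^sup>2 = (norm x)\<^sup>2" unfolding of_real_eq_iff .
  then show ?thesis by simp
qed

lemma orthogonal_conj_coords: "g \<in> unitary_group \<Longrightarrow> orthogonal_transformation (conj_coords g)"
  by (simp add: orthogonal_transformation linear_conj_coords norm_conj_coords)

lemma det_conj_coords: "g \<in> unitary_group \<Longrightarrow> \<bar>Determinants.det (matrix (conj_coords g))\<bar> = 1"
  by (intro orthogonal_transformation_det orthogonal_conj_coords)

lemma continuous_conj_coords:
  "continuous_on S (\<lambda>p :: 'n::{finite,wellorder} cmat \<times> 'n hcoord. conj_coords (fst p) (snd p))"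
  unfolding conj_coords_def
  by (intro bounded_linear.continuous_on[OF bounded_linear_hermitian_coords] continuous_on_matrix_mult
      bounded_linear.continuous_on[OF bounded_linear_hm] continuous_adjoint_matrix continuous_intros)

lemma emeasure_conj_coords_image:
  assumes g: "g \<in> unitary_group" and B: "B \<in> sets borel"
  shows "emeasure lborel (conj_coords g ` B) = emeasure lborel B"
proof -
  have "bij (conj_coords g)" using orthogonal_transformation_bij[OF orthogonal_conj_coords[OF g]] .
  have img: "conj_coords g ` B \<in> sets borel"
    by (rule borel_image_of_open_injection[OF open_UNIV])
      (use B g linear_conj_coords in \<open>auto intro: linear_continuous_on linear_conv_bounded_linear[THEN iffD1]
        inj_on_subset[OF orthogonal_transformation_inj] orthogonal_conj_coords\<close>)
  have "emeasure lborel (conj_coords g ` B) = (\<integral>\<^sup>+x\<in>B. ennreal \<bar>Determinants.det (matrix (conj_coords g))\<bar> \<partial>lborel)"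
  proof (rule emeasure_differentiable_image[OF B img])
    show "(conj_coords g has_derivative conj_coords g) (at x)" for x
      using linear_conj_coords by (intro bounded_linear_imp_has_derivative linear_conv_bounded_linear[THEN iffD1])
    show "inj_on (conj_coords g) B"
      by (rule inj_on_subset[OF orthogonal_transformation_inj[OF orthogonal_conj_coords[OF g]]]) simp
  qed
  also have "\<dots> = emeasure lborel B" using B by (simp add: det_conj_coords[OF g])
  finally show ?thesis .
qed

section \<open>Diagonal and off-diagonal coordinates, the polar map and its Jacobian\<close>

definition diag_part :: "'n::finite hcoord \<Rightarrow> 'n rvec" where
  "diag_part y = (\<chi> i. y $ (i, i))"

definition offdiag_part :: "'n::finite hcoord \<Rightarrow> 'n hcoord" where
  "offdiag_part y = (\<chi> p. if fst p = snd p then 0 else y $ p)"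

definition diag_coords :: "'n::finite rvec \<Rightarrow> 'n hcoord" where
  "diag_coords a = (\<chi> p. if fst p = snd p then a $ fst p else 0)"

lemma diag_part_nth [simp]: "diag_part y $ i = y $ (i, i)"
  by (simp add: diag_part_def)

lemma offdiag_part_nth [simp]: "offdiag_part y $ (i, j) = (if i = j then 0 else y $ (i, j))"
  by (simp add: offdiag_part_def)

lemma diag_coords_nth [simp]: "diag_coords a $ (i, j) = (if i = j then a $ i else 0)"
  by (simp add: diag_coords_def)

lemma hcoord_eqI: "(\<And>i j. x $ (i, j) = y $ (i, j)) \<Longrightarrow> x = (y :: 'n::finite hcoord)"
  by (rule vec_eqI) (metis surj_pair)

lemma bounded_linear_parts_hcoord:
  "bounded_linear (diag_part :: 'n::finite hcoord \<Rightarrow> 'n rvec)"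
  "bounded_linear (offdiag_part :: 'n hcoord \<Rightarrow> 'n hcoord)"
  "bounded_linear (diag_coords :: 'n rvec \<Rightarrow> 'n hcoord)"
proof -
  show "bounded_linear (diag_part :: 'n hcoord \<Rightarrow> 'n rvec)"
    by (intro linear_conv_bounded_linear[THEN iffD1] linearI vec_eqI) simp_all
  show "bounded_linear (offdiag_part :: 'n hcoord \<Rightarrow> 'n hcoord)"
    by (intro linear_conv_bounded_linear[THEN iffD1] linearI hcoord_eqI) simp_all
  show "bounded_linear (diag_coords :: 'n rvec \<Rightarrow> 'n hcoord)"
    by (intro linear_conv_bounded_linear[THEN iffD1] linearI hcoord_eqI) simp_all
qed

lemmas linear_parts_hcoord = bounded_linear_parts_hcoord[THEN bounded_linear.linear]

lemma diag_offdiag: "diag_coords (diag_part y) + offdiag_part y = y"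
  by (rule hcoord_eqI) simp

lemma diag_part_simps [simp]:
  "diag_part (diag_coords a) = a" "diag_part (offdiag_part y) = 0"
  "offdiag_part (diag_coords a) = 0" "offdiag_part (offdiag_part y) = offdiag_part y"
  "diag_part (x + y) = diag_part x + diag_part y" "offdiag_part (x + y) = offdiag_part x + offdiag_part y"
  by (auto intro!: vec_eqI hcoord_eqI simp: diag_part_def offdiag_part_def diag_coords_def)

lemma hm_diag_coords: "hm (diag_coords a) = diagonal_matrix a"
  by (intro matrix_eqI) (auto simp: hm_def diagonal_matrix_def complex_eq_iff)

text \<open>Off-diagonal Cayley coordinates are transversal at the identity to the diagonal torus,
  which fixes diagonal matrices under conjugation. The diagonal positions are thereby free to hold
  the spectrum, and the map goes between spaces of equal dimension.\<close>

definition polar_map :: "'n::{finite,wellorder} hcoord \<Rightarrow> 'n hcoord" where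
  "polar_map y = conj_coords (cayley (offdiag_part y)) (diag_coords (diag_part y))"

lemma hm_polar_map:
  "hm (polar_map y) = cayley (offdiag_part y) ** diagonal_matrix (diag_part y) ** adjoint_matrix (cayley (offdiag_part y))"
  by (simp add: polar_map_def hm_conj_coords hm_diag_coords)

lemma top_row_polar_map:
  "diag_part y \<in> open_chamber \<Longrightarrow> gz_top_row (hm (polar_map y)) = diag_part y"
  unfolding hm_polar_map by (rule gz_top_row_conj_diagonal[OF cayley_unitary])

text \<open>At (i, j) and at (j, i) the weight is the same number: the commutator multiplies one
  complex entry by a real factor, so both of its real coordinates are scaled alike.\<close>

definition root_weight :: "'n::{finite,wellorder} rvec \<Rightarrow> 'n \<Rightarrow> 'n \<Rightarrow> real" where
  "root_weight a i j = (if i = j then 1 else if i < j then a $ j - a $ i else a $ i - a $ j)"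

definition root_scale :: "'n::{finite,wellorder} rvec \<Rightarrow> 'n hcoord \<Rightarrow> 'n hcoord" where
  "root_scale a x = (\<chi> p. root_weight a (fst p) (snd p) * x $ p)"

text \<open>The exchange of indices and the sign encode multiplication by the imaginary unit, which
  turns the coordinates (re, im) into (-im, re). On the diagonal the commutator vanishes, and the
  variation of the spectrum takes its place.\<close>

definition polar_form :: "'n::{finite,wellorder} hcoord \<Rightarrow> 'n hcoord \<Rightarrow> 'n hcoord" where
  "polar_form w h = (\<chi> p. if fst p = snd p then h $ p
     else (if fst p < snd p then -1 else 1) * cayley_form w (offdiag_part h) $ (snd p, fst p))"

lemma root_scale_nth [simp]: "root_scale a x $ (i, j) = root_weight a i j * x $ (i, j)"
  by (simp add: root_scale_def)

lemma polar_form_nth [simp]: "polar_form w h $ (i, j) = (if i = j then h $ (i, i)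
    else (if i < j then -1 else 1) * cayley_form w (offdiag_part h) $ (j, i))"
  by (simp add: polar_form_def)

lemma linear_root_scale: "linear (root_scale a)"
  by (intro linearI hcoord_eqI) (simp_all add: algebra_simps)

lemma linear_polar_form: "linear (polar_form w)"
proof -
  have "linear (\<lambda>h. cayley_form w (offdiag_part h))"
    using linear_compose[OF linear_parts_hcoord(2) linear_cayley_form] by (simp add: o_def)
  from linear_add[OF this] linear_scale[OF this] show ?thesis
    by (intro linearI hcoord_eqI) (simp_all add: algebra_simps)
qed

text \<open>
  \<open>d (U D U\<^sup>*) = U (dD + [\<Theta>, D]) U\<^sup>*\<close> with \<open>\<Theta> = U\<^sup>* dU\<close>; the commutator multiplies the entry
  \<open>(i, j)\<close> of \<open>\<Theta>\<close> by \<open>a\<^sub>j - a\<^sub>i\<close>.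
\<close>

lemma hm_root_scale_polar_form:
  "hm (root_scale a (polar_form w h)) = diagonal_matrix (diag_part h) +
     ((mat \<i> ** hm (cayley_form w (offdiag_part h))) ** diagonal_matrix a
      - diagonal_matrix a ** (mat \<i> ** hm (cayley_form w (offdiag_part h))))"
proof (rule matrix_eqI)
  fix i j
  define z where "z = cayley_form w (offdiag_part h)"
  have z: "polar_form w h $ (i, j) = (if i = j then h $ (i, i) else (if i < j then -1 else 1) * z $ (j, i))" for i j
    by (simp add: z_def)
  show "hm (root_scale a (polar_form w h)) $ i $ j = (diagonal_matrix (diag_part h) +
     ((mat \<i> ** hm (cayley_form w (offdiag_part h))) ** diagonal_matrix a
      - diagonal_matrix a ** (mat \<i> ** hm (cayley_form w (offdiag_part h))))) $ i $ j"
    unfolding z_def[symmetric] vector_add_component vector_minus_component matrix_mult_diagonal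
      diagonal_matrix_mult mat_mult_nth
    by (cases i j rule: linorder_cases)
      (simp_all add: hm_def z root_weight_def diagonal_matrix_def complex_eq_iff diff_divide_distrib[symmetric] field_simps del: polar_form_nth)
qed

definition polar_deriv :: "'n::{finite,wellorder} hcoord \<Rightarrow> 'n hcoord \<Rightarrow> 'n hcoord" where
  "polar_deriv y h = conj_coords (cayley (offdiag_part y)) (root_scale (diag_part y) (polar_form (offdiag_part y) h))"

lemma has_derivative_polar_map: "(polar_map has_derivative polar_deriv y) (at y)"
proof -
  let ?U = "\<lambda>y :: 'a hcoord. cayley (offdiag_part y)" and ?D = "\<lambda>y :: 'a hcoord. diagonal_matrix (diag_part y)"
  define \<Theta> where "\<Theta> h = mat \<i> ** hm (cayley_form (offdiag_part y) (offdiag_part h))" for h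
  have adj: "adjoint_matrix (\<Theta> h) = - \<Theta> h" for h
    by (simp add: \<Theta>_def adjoint_matrix_mult adjoint_mat flip: mat_mult_commute)
      (intro matrix_eqI, simp add: mat_mult_nth)
  have U: "(?U has_derivative (\<lambda>h. ?U y ** \<Theta> h)) (at y)"
    unfolding \<Theta>_def
    by (rule has_derivative_compose[OF bounded_linear_imp_has_derivative[OF bounded_linear_parts_hcoord(2)] has_derivative_cayley])
  have "linear ?D"
    by (intro linearI matrix_eqI) (auto simp: diagonal_matrix_def complex_eq_iff)
  then have D: "(?D has_derivative ?D) (at y)"
    by (intro bounded_linear_imp_has_derivative linear_conv_bounded_linear[THEN iffD1])
  note a = bounded_linear.has_derivative[OF bounded_linear_adjoint_matrix U]
  note 1 = bounded_linear.has_derivative[OF bounded_linear_hermitian_coords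
      has_derivative_matrix_mult[OF has_derivative_matrix_mult[OF U D] a]]
  have "polar_map = (\<lambda>y. hermitian_coords (?U y ** ?D y ** adjoint_matrix (?U y)))"
    by (simp add: fun_eq_iff polar_map_def conj_coords_def hm_diag_coords)
  moreover have "polar_deriv y = (\<lambda>h. hermitian_coords
      (?U y ** ?D y ** adjoint_matrix (?U y ** \<Theta> h) + (?U y ** ?D h + ?U y ** \<Theta> h ** ?D y) ** adjoint_matrix (?U y)))"
    by (simp add: fun_eq_iff polar_deriv_def conj_coords_def hm_root_scale_polar_form \<Theta>_def[symmetric]
        adjoint_matrix_mult adj matrix_mult.add_left matrix_mult.add_right matrix_mult.diff_left matrix_mult.diff_right
        matrix_mult.minus_left matrix_mult.minus_right matrix_mul_assoc add_diff_eq)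
  ultimately show ?thesis using 1 by simp
qed

lemma linear_polar_deriv: "linear (polar_deriv y)"
  using has_derivative_linear[OF has_derivative_polar_map] .

lemma continuous_polar_deriv:
  "continuous_on S (\<lambda>y. polar_deriv y h)"
proof -
  have bl: "continuous_on S (\<lambda>y. offdiag_part y)" for S :: "'a hcoord set"
    by (intro bounded_linear.continuous_on[OF bounded_linear_parts_hcoord(2)] continuous_intros)
  have cf: "continuous_on S (\<lambda>y. cayley_form (offdiag_part y) (offdiag_part h))"
    by (rule continuous_on_compose2[OF continuous_cayley_form[of UNIV] bl]) simp
  have "continuous_on S (\<lambda>y. root_scale (diag_part y) (polar_form (offdiag_part y) h) $ p)" for p
  proof -
    obtain i j where p: "p = (i, j)" by force
    show ?thesis
      unfolding p root_scale_nth polar_form_nth root_weight_def diag_part_nth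
      by (cases "i = j"; cases "i < j") (auto intro!: continuous_intros continuous_on_component cf)
  qed
  then have "continuous_on S (\<lambda>y. root_scale (diag_part y) (polar_form (offdiag_part y) h))"
    by (intro continuous_on_componentwise[THEN iffD2]) (auto simp: Basis_vec_def inner_axis)
  then have "continuous_on S (\<lambda>y. (cayley (offdiag_part y), root_scale (diag_part y) (polar_form (offdiag_part y) h)))"
    by (intro continuous_on_Pair continuous_on_compose2[OF continuous_cayley[of UNIV] bl]) simp_all
  from continuous_on_compose2[OF continuous_conj_coords[of UNIV] this]
  show ?thesis by (simp add: polar_deriv_def)
qed

definition polar_density :: "'n::{finite,wellorder} hcoord \<Rightarrow> real" where
  "polar_density w = \<bar>Determinants.det (matrix (polar_form w))\<bar>"

lemma continuous_polar_density: "continuous_on S polar_density"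
proof -
  have "continuous_on S (\<lambda>w. matrix (polar_form w) $ p $ q)" for p q :: "'a \<times> 'a"
  proof -
    obtain i j where p: "p = (i, j)" by force
    show ?thesis
      unfolding matrix_def vec_lambda_beta p polar_form_nth
      by (cases "i = j"; cases "i < j")
        (auto intro!: continuous_intros continuous_on_component continuous_cayley_form)
  qed
  then show ?thesis
    unfolding polar_density_def[abs_def] by (intro continuous_on_rabs continuous_det)
qed

text \<open>Each unordered pair occurs at (i, j) and at (j, i) with equal weight; this is the origin
  of the square.\<close>

lemma prod_root_weight: "(\<Prod>p\<in>UNIV. root_weight a (fst p) (snd p)) = (vandermonde a)\<^sup>2"
proof -
  let ?L = "{(i :: 'a, j). i < j}"
  have "(\<Prod>p\<in>UNIV. root_weight a (fst p) (snd p)) = (\<Prod>p\<in>?L \<union> prod.swap ` ?L. root_weight a (fst p) (snd p))"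
  proof (rule prod.mono_neutral_right)
    show "\<forall>p\<in>UNIV - (?L \<union> prod.swap ` ?L). root_weight a (fst p) (snd p) = 1"
    proof (rule ballI)
      fix p assume p: "p \<in> UNIV - (?L \<union> prod.swap ` ?L)"
      obtain i j where ij: "p = (i, j)" by force
      then have "i = j" using p by (cases i j rule: linorder_cases) force+
      then show "root_weight a (fst p) (snd p) = 1" by (simp add: ij root_weight_def)
    qed
  qed simp_all
  also have "\<dots> = (\<Prod>p\<in>?L. root_weight a (fst p) (snd p)) * (\<Prod>p\<in>prod.swap ` ?L. root_weight a (fst p) (snd p))"
    by (rule prod.union_disjoint) auto
  also have "(\<Prod>p\<in>prod.swap ` ?L. root_weight a (fst p) (snd p)) = (\<Prod>p\<in>?L. root_weight a (snd p) (fst p))"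
    by (subst prod.reindex) (auto simp: inj_on_def)
  also have "(\<Prod>p\<in>?L. root_weight a (fst p) (snd p)) * (\<Prod>p\<in>?L. root_weight a (snd p) (fst p)) =
      (\<Prod>p\<in>?L. (case p of (i, j) \<Rightarrow> a $ i - a $ j) ^ 2)"
    unfolding prod.distrib[symmetric]
    by (intro prod.cong refl) (auto simp: root_weight_def power2_eq_square algebra_simps)
  also have "\<dots> = (vandermonde a)\<^sup>2" by (simp add: vandermonde_def prod_power_distrib)
  finally show ?thesis .
qed

lemma det_root_scale: "Determinants.det (matrix (root_scale a)) = (vandermonde a)\<^sup>2"
proof -
  have m: "matrix (root_scale a) $ p $ q = (if p = q then root_weight a (fst p) (snd p) else 0)" for p q
    by (simp add: matrix_def root_scale_def axis_def)
  show ?thesis by (subst det_diagonal) (simp_all add: m prod_root_weight)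
qed

text \<open>The derivative factors into an orthogonal conjugation, the diagonal scaling by root
  weights, and a map that depends on the off-diagonal part alone. So the Jacobian separates into a
  function of the spectrum times a function of the eigenbasis.\<close>

lemma det_polar_deriv:
  "\<bar>Determinants.det (matrix (polar_deriv y))\<bar> = (vandermonde (diag_part y))\<^sup>2 * polar_density (offdiag_part y)"
proof -
  have "polar_deriv y = conj_coords (cayley (offdiag_part y)) \<circ> (root_scale (diag_part y) \<circ> polar_form (offdiag_part y))"
    by (simp add: fun_eq_iff polar_deriv_def)
  then have "matrix (polar_deriv y) = matrix (conj_coords (cayley (offdiag_part y))) ** (matrix (root_scale (diag_part y)) ** matrix (polar_form (offdiag_part y)))"
    by (simp add: matrix_compose linear_compose linear_conj_coords linear_root_scale linear_polar_form)
  then show ?thesis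
    by (simp add: Determinants.det_mul abs_mult det_conj_coords cayley_unitary det_root_scale polar_density_def)
qed

lemma open_chamber_nth_neq: "a \<in> open_chamber \<Longrightarrow> i \<noteq> j \<Longrightarrow> a $ i \<noteq> a $ j"
  by (cases i j rule: linorder_cases) (force simp: open_chamber_def)+

text \<open>At vanishing off-diagonal part \<open>cayley_form\<close> is twice the identity. What
  remains is an exchange of positions up to nonzero factors, as the differences of the entries of a
  regular \<open>a\<close> do not vanish.\<close>

lemma inj_polar_deriv_diag:
  assumes a: "a \<in> open_chamber" shows "inj (polar_deriv (diag_coords a))"
proof -
  have "h = 0" if "polar_deriv (diag_coords a) h = 0" for h
  proof (rule hcoord_eqI)
    have e: "root_scale a (polar_form 0 h) = 0" using that by (simp add: polar_deriv_def)
    have ne: "root_weight a i j \<noteq> 0" for i j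
      using open_chamber_nth_neq[OF a, of i j] by (auto simp: root_weight_def)
    fix i j
    have "root_scale a (polar_form 0 h) $ (j, i) = 0" by (simp add: e)
    then have "polar_form 0 h $ (j, i) = 0" using ne[of j i] by simp
    then show "h $ (i, j) = 0 $ (i, j)" by (auto simp: cayley_form_0 split: if_splits)
  qed
  then show ?thesis
    using linear_injective_0[OF linear_polar_deriv[of "diag_coords a"]] by blast
qed

text \<open>The criterion for local injectivity asks for continuity of the derivative in operator
  norm. That norm is bounded by the sum over basis vectors, where continuity is known.\<close>

lemma polar_map_locally_injective:
  assumes a: "a \<in> open_chamber"
  obtains r where "r > 0" "inj_on polar_map (ball (diag_coords a) r)"
proof -
  let ?y = "diag_coords a"
  obtain g' where g': "linear g'" "g' \<circ> polar_deriv ?y = id"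
    using linear_injective_left_inverse[OF linear_polar_deriv inj_polar_deriv_diag[OF a]] by blast
  have "\<exists>d>0. \<forall>x. dist ?y x < d \<longrightarrow> onorm (\<lambda>v. polar_deriv x v - polar_deriv ?y v) < e" if "e > 0" for e
  proof -
    let ?s = "\<lambda>x. \<Sum>b\<in>Basis. norm (polar_deriv x b - polar_deriv ?y b)"
    have c: "continuous_on UNIV ?s"
      by (intro continuous_intros continuous_polar_deriv)
    obtain d where d: "d > 0" "\<And>x. dist x ?y < d \<Longrightarrow> dist (?s x) (?s ?y) < e"
      using continuous_on_iff[THEN iffD1, rule_format, OF c UNIV_I[of ?y] \<open>e > 0\<close>] by blast
    have "onorm (\<lambda>v. polar_deriv x v - polar_deriv ?y v) < e" if "dist ?y x < d" for x
    proof -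
      have "onorm (\<lambda>v. polar_deriv x v - polar_deriv ?y v) \<le> ?s x"
        by (intro onorm_componentwise bounded_linear_sub has_derivative_bounded_linear[OF has_derivative_polar_map])
      also have "\<dots> < e" using d(2)[of x] that by (simp add: dist_commute)
      finally show ?thesis .
    qed
    then show ?thesis using d(1) by blast
  qed
  from has_derivative_locally_injective[OF UNIV_I open_UNIV linear_conv_bounded_linear[THEN iffD1, OF g'(1)] g'(2) has_derivative_polar_map this]
  show ?thesis using that by blast
qed

section \<open>Stabilizers of regular diagonal matrices\<close>

lemma commutes_diagonal:
  assumes a: "a \<in> open_chamber" and comm: "A ** diagonal_matrix a = diagonal_matrix a ** A"
  shows "A ** diagonal_matrix b = diagonal_matrix b ** A"
proof (rule matrix_eqI)
  fix i j
  have "A $ i $ j * complex_of_real (a $ j) = complex_of_real (a $ i) * A $ i $ j"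
    using arg_cong[OF comm, of "\<lambda>M. M $ i $ j"] by (simp add: matrix_mult_diagonal diagonal_matrix_mult)
  then have "A $ i $ j = 0 \<or> a $ i = a $ j" by auto
  moreover have "a $ i \<noteq> a $ j" if "i \<noteq> j"
    using open_chamber_nth_neq[OF a that] .
  ultimately show "(A ** diagonal_matrix b) $ i $ j = (diagonal_matrix b ** A) $ i $ j"
    by (cases "i = j") (auto simp: matrix_mult_diagonal diagonal_matrix_mult)
qed

text \<open>Equality for \<open>a\<close> means that \<open>adjoint_matrix k ** g\<close> commutes
  with diag(a). For regular \<open>a\<close> such a matrix is diagonal and hence commutes with every
  diag(b). Both the uniform radius and the averaging argument rest on this.\<close>

lemma conj_diagonal_eq_transfer:
  fixes g k :: "'n::{finite,wellorder} cmat"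
  assumes g: "g \<in> unitary_group" and k: "k \<in> unitary_group" and a: "a \<in> open_chamber"
    and eq: "conj_coords g (diag_coords a) = conj_coords k (diag_coords a)"
  shows "conj_coords g (diag_coords b) = conj_coords k (diag_coords b)"
proof -
  have iff: "conj_coords g (diag_coords c) = conj_coords k (diag_coords c) \<longleftrightarrow>
      (adjoint_matrix k ** g) ** diagonal_matrix c = diagonal_matrix c ** (adjoint_matrix k ** g)" for c
  proof
    assume "conj_coords g (diag_coords c) = conj_coords k (diag_coords c)"
    then have "g ** diagonal_matrix c ** adjoint_matrix g = k ** diagonal_matrix c ** adjoint_matrix k"
      by (metis hm_conj_coords hm_diag_coords)
    then have "adjoint_matrix k ** (g ** diagonal_matrix c ** adjoint_matrix g) ** g = adjoint_matrix k ** (k ** diagonal_matrix c ** adjoint_matrix k) ** g"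
      by simp
    then show "(adjoint_matrix k ** g) ** diagonal_matrix c = diagonal_matrix c ** (adjoint_matrix k ** g)"
      using g k unitary_groupD[OF g] unitary_groupD[OF k] by (simp flip: matrix_mul_assoc)
  next
    assume "(adjoint_matrix k ** g) ** diagonal_matrix c = diagonal_matrix c ** (adjoint_matrix k ** g)"
    then have "k ** ((adjoint_matrix k ** g) ** diagonal_matrix c) ** adjoint_matrix g = k ** (diagonal_matrix c ** (adjoint_matrix k ** g)) ** adjoint_matrix g"
      by simp
    then have "g ** diagonal_matrix c ** adjoint_matrix g = k ** diagonal_matrix c ** adjoint_matrix k"
      using g k unitary_groupD[OF g] by (simp flip: matrix_mul_assoc)
    then show "conj_coords g (diag_coords c) = conj_coords k (diag_coords c)"
      by (simp add: conj_coords_def hm_diag_coords)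
  qed
  show ?thesis using commutes_diagonal[OF a] eq unfolding iff by blast
qed

text \<open>The inverse function argument at one regular spectrum \<open>a\<close> yields a radius,
  and the transfer lemma carries it to all spectra. Without this the radius could shrink as
  eigenvalues approach each other.\<close>

lemma polar_map_inj_on:
  fixes a :: "'n::{finite,wellorder} rvec"
  assumes a: "a \<in> open_chamber"
  obtains r where "r > 0" "inj_on polar_map {y :: 'n hcoord. diag_part y \<in> open_chamber \<and> norm (offdiag_part y) < r}"
proof -
  obtain r where r: "r > 0" "inj_on polar_map (ball (diag_coords a) r)"
    using polar_map_locally_injective[OF a] .
  have inj: "y = y'" if y: "diag_part y \<in> open_chamber" "norm (offdiag_part y) < r"
    and y': "diag_part y' \<in> open_chamber" "norm (offdiag_part y') < r"
    and eq: "polar_map y = polar_map y'" for y y' :: "'n hcoord"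
  proof -
    have d: "diag_part y = diag_part y'"
      using top_row_polar_map[OF y(1)] top_row_polar_map[OF y'(1)] eq by simp
    have p: "polar_map (diag_coords a + offdiag_part y) = conj_coords (cayley (offdiag_part y)) (diag_coords a)" for y
      by (simp add: polar_map_def)
    \<comment> \<open>Both points are moved to the reference spectrum \<open>a\<close>, where they
      lie in the ball on which injectivity is known.\<close>
    have "polar_map (diag_coords a + offdiag_part y) = polar_map (diag_coords a + offdiag_part y')"
      unfolding p by (rule conj_diagonal_eq_transfer[OF cayley_unitary cayley_unitary y(1)])
        (use eq d in \<open>simp add: polar_map_def\<close>)
    then have "diag_coords a + offdiag_part y = diag_coords a + offdiag_part y'"
      by (rule inj_onD[OF r(2)]) (use y(2) y'(2) in \<open>simp_all add: dist_norm\<close>)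
    then have "offdiag_part y = offdiag_part y'" by simp
    then have "diag_coords (diag_part y) + offdiag_part y = diag_coords (diag_part y') + offdiag_part y'"
      unfolding d by simp
    then show "y = y'" unfolding diag_offdiag .
  qed
  show ?thesis
    by (rule that[OF r(1)], rule inj_onI, rule inj) simp_all
qed

section \<open>Weyl integration\<close>

lemma nn_integral_lborel_shift:
  fixes f :: "'a::euclidean_space \<Rightarrow> ennreal"
  assumes [measurable]: "f \<in> borel_measurable borel"
  shows "(\<integral>\<^sup>+x. f (x + c) \<partial>lborel) = (\<integral>\<^sup>+x. f x \<partial>lborel)"
proof -
  have "(\<integral>\<^sup>+x. f x \<partial>lborel) = (\<integral>\<^sup>+x. f x \<partial>distr lborel borel ((+) c))"
    by (simp add: lborel_distr_plus)
  also have "\<dots> = (\<integral>\<^sup>+x. f (x + c) \<partial>lborel)"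
    by (subst nn_integral_distr) (simp_all add: add.commute)
  finally show ?thesis ..
qed

lemma measurable_parts_hcoord [measurable]:
  "(diag_part :: 'n::finite hcoord \<Rightarrow> 'n rvec) \<in> borel \<rightarrow>\<^sub>M borel"
  "(offdiag_part :: 'n hcoord \<Rightarrow> 'n hcoord) \<in> borel \<rightarrow>\<^sub>M borel"
  by (intro borel_measurable_continuous_onI linear_continuous_on bounded_linear_parts_hcoord)+

text \<open>
  Tonelli's theorem for the splitting into diagonal and off-diagonal part, obtained from
  translation invariance alone: \<open>K\<close> is inserted as \<open>K (a - diag_part y)\<close>, integrated over \<open>a\<close>.
\<close>

lemma nn_integral_diag_offdiag:
  fixes f :: "'n::finite rvec \<Rightarrow> ennreal" and w :: "'n hcoord \<Rightarrow> ennreal"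
  assumes [measurable]: "f \<in> borel_measurable borel" "w \<in> borel_measurable borel"
  defines "K \<equiv> indicator (ball 0 1) :: 'n rvec \<Rightarrow> ennreal"
  shows "(\<integral>\<^sup>+a. K a \<partial>lborel) * (\<integral>\<^sup>+y. f (diag_part y) * w (offdiag_part y) \<partial>lborel) =
    (\<integral>\<^sup>+a. f a \<partial>lborel) * (\<integral>\<^sup>+y. K (diag_part y) * w (offdiag_part y) \<partial>lborel)"
proof -
  have K [measurable]: "K \<in> borel_measurable borel"
    unfolding K_def by (rule borel_measurable_indicator[OF borel_open[OF open_ball]])
  have sym: "K (- a) = K a" for a by (simp add: K_def indicator_def)
  have "(\<integral>\<^sup>+a. K a \<partial>lborel) * (\<integral>\<^sup>+y. f (diag_part y) * w (offdiag_part y) \<partial>lborel) =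
      (\<integral>\<^sup>+y. (\<integral>\<^sup>+a. K a \<partial>lborel) * (f (diag_part y) * w (offdiag_part y)) \<partial>lborel)"
    by (subst nn_integral_cmult) simp_all
  also have "\<dots> = (\<integral>\<^sup>+y. (\<integral>\<^sup>+a. K (a - diag_part y) * (f (diag_part y) * w (offdiag_part y)) \<partial>lborel) \<partial>lborel)"
  proof (rule nn_integral_cong)
    fix y :: "'n hcoord"
    have "(\<integral>\<^sup>+a. K a \<partial>lborel) = (\<integral>\<^sup>+a. K (a - diag_part y) \<partial>lborel)"
      using nn_integral_lborel_shift[of K "- diag_part y"] by simp
    then show "(\<integral>\<^sup>+a. K a \<partial>lborel) * (f (diag_part y) * w (offdiag_part y)) =
        (\<integral>\<^sup>+a. K (a - diag_part y) * (f (diag_part y) * w (offdiag_part y)) \<partial>lborel)"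
      by (subst nn_integral_multc) simp_all
  qed
  also have "\<dots> = (\<integral>\<^sup>+a. (\<integral>\<^sup>+y. K (a - diag_part y) * (f (diag_part y) * w (offdiag_part y)) \<partial>lborel) \<partial>lborel)"
    by (rule lborel_pair.Fubini') measurable
  also have "\<dots> = (\<integral>\<^sup>+a. (\<integral>\<^sup>+y. f (diag_part y + a) * (K (diag_part y) * w (offdiag_part y)) \<partial>lborel) \<partial>lborel)"
  proof (rule nn_integral_cong)
    fix a :: "'n rvec"
    have "(\<lambda>y. K (a - diag_part y) * (f (diag_part y) * w (offdiag_part y))) \<in> borel_measurable borel"
      by measurable
    \<comment> \<open>Translation by \<open>diag_coords a\<close> changes the diagonal part only,
      and turns the weight into \<open>K (- diag_part y)\<close>, which equals
      \<open>K (diag_part y)\<close> by symmetry of the ball.\<close>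
    from nn_integral_lborel_shift[OF this, of "diag_coords a", symmetric]
    show "(\<integral>\<^sup>+y. K (a - diag_part y) * (f (diag_part y) * w (offdiag_part y)) \<partial>lborel) =
        (\<integral>\<^sup>+y. f (diag_part y + a) * (K (diag_part y) * w (offdiag_part y)) \<partial>lborel)"
      by (simp add: sym mult_ac)
  qed
  also have "\<dots> = (\<integral>\<^sup>+y. (\<integral>\<^sup>+a. f (diag_part y + a) * (K (diag_part y) * w (offdiag_part y)) \<partial>lborel) \<partial>lborel)"
    by (rule lborel_pair.Fubini') measurable
  also have "\<dots> = (\<integral>\<^sup>+y. (\<integral>\<^sup>+a. f a \<partial>lborel) * (K (diag_part y) * w (offdiag_part y)) \<partial>lborel)"
  proof (rule nn_integral_cong)
    fix y :: "'n hcoord"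
    have "(\<integral>\<^sup>+a. f (diag_part y + a) \<partial>lborel) = (\<integral>\<^sup>+a. f a \<partial>lborel)"
      using nn_integral_lborel_shift[of f "diag_part y"] by (simp add: add.commute)
    then show "(\<integral>\<^sup>+a. f (diag_part y + a) * (K (diag_part y) * w (offdiag_part y)) \<partial>lborel) =
        (\<integral>\<^sup>+a. f a \<partial>lborel) * (K (diag_part y) * w (offdiag_part y))"
      by (subst nn_integral_multc) simp_all
  qed
  also have "\<dots> = (\<integral>\<^sup>+a. f a \<partial>lborel) * (\<integral>\<^sup>+y. K (diag_part y) * w (offdiag_part y) \<partial>lborel)"
    by (subst nn_integral_cmult) simp_all
  finally show ?thesis .
qed

lemma open_open_chamber: "open (open_chamber :: ('n::{finite,wellorder} rvec) set)"
proof -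
  have "(open_chamber :: 'n rvec set) = (\<Inter>(i, j)\<in>{(i, j). i < j}. {a. a $ j < a $ i})"
    by (auto simp: open_chamber_def)
  also have "open \<dots>"
    by (intro open_INT) (auto intro!: open_Collect_less continuous_intros continuous_on_component)
  finally show ?thesis .
qed

lemma continuous_vandermonde: "continuous_on S vandermonde"
  unfolding vandermonde_def[abs_def] case_prod_beta
  by (intro continuous_on_prod continuous_intros continuous_on_component)

lemma measurable_vandermonde [measurable]: "vandermonde \<in> borel_measurable borel"
  by (intro borel_measurable_continuous_onI continuous_vandermonde)

definition polar_slice :: "real \<Rightarrow> ('n::{finite,wellorder} rvec) set \<Rightarrow> ('n hcoord) set" where
  "polar_slice r S = {y. diag_part y \<in> S \<and> norm (offdiag_part y) < r}"

text \<open>The integrand is arranged as a function of the diagonal part times a function of the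
  off-diagonal part, the shape required by \<open>nn_integral_diag_offdiag\<close>.\<close>

lemma emeasure_polar_image:
  fixes S :: "('n::{finite,wellorder} rvec) set"
  assumes inj: "inj_on polar_map (polar_slice r (open_chamber :: 'n rvec set))"
    and S [measurable]: "S \<in> sets borel" "S \<subseteq> open_chamber"
  shows "polar_map ` polar_slice r S \<in> sets borel" (is ?m)
    and "emeasure lborel (polar_map ` polar_slice r S) =
      (\<integral>\<^sup>+y. (ennreal ((vandermonde (diag_part y))\<^sup>2) * indicator S (diag_part y)) *
        (ennreal (polar_density (offdiag_part y)) * indicator (ball 0 r) (offdiag_part y)) \<partial>lborel)" (is ?e)
    and "open (polar_map ` polar_slice r (open_chamber :: 'n rvec set))" (is ?o)
proof -
  have "polar_slice r (open_chamber :: 'n rvec set) = diag_part -` open_chamber \<inter> offdiag_part -` ball 0 r"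
    by (auto simp: polar_slice_def)
  also have "open \<dots>"
    by (intro open_Int open_vimage open_open_chamber open_ball linear_continuous_on bounded_linear_parts_hcoord)
  finally have V: "open (polar_slice r (open_chamber :: 'n rvec set))" .
  have cont: "continuous_on X polar_map" for X :: "'n hcoord set"
    by (rule has_derivative_continuous_on[OF has_derivative_at_withinI[OF has_derivative_polar_map]])
  show ?o by (rule invariance_of_domain[OF cont V inj])
  have sub: "polar_slice r S \<subseteq> polar_slice r open_chamber" using S by (auto simp: polar_slice_def)
  have B: "polar_slice r S \<in> sets borel" unfolding polar_slice_def by measurable
  show m: ?m by (rule borel_image_of_open_injection[OF V cont inj B sub])
  have "emeasure lborel (polar_map ` polar_slice r S) =
      (\<integral>\<^sup>+y\<in>polar_slice r S. ennreal \<bar>Determinants.det (matrix (polar_deriv y))\<bar> \<partial>lborel)"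
    by (rule emeasure_differentiable_image[OF B m has_derivative_polar_map inj_on_subset[OF inj sub]])
  also have "\<dots> = (\<integral>\<^sup>+y. (ennreal ((vandermonde (diag_part y))\<^sup>2) * indicator S (diag_part y)) *
        (ennreal (polar_density (offdiag_part y)) * indicator (ball 0 r) (offdiag_part y)) \<partial>lborel)"
    by (intro nn_integral_cong)
      (auto simp: det_polar_deriv indicator_def polar_slice_def ennreal_mult' polar_density_def)
  finally show ?e .
qed

lemma generic_diagonalization:
  assumes "x \<in> generic"
  obtains k where "k \<in> unitary_group" "x = conj_coords k (diag_coords (gz_top_row (hm x)))"
proof -
  obtain k where k: "k \<in> unitary_group" "hm x = k ** diagonal_matrix (gz_top_row (hm x)) ** adjoint_matrix k"
    using hermitian_diagonalization[OF hm_hermitian, of x] assms by (auto simp: generic_def)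
  then have "hm x = hm (conj_coords k (diag_coords (gz_top_row (hm x))))"
    by (simp add: hm_conj_coords hm_diag_coords)
  then have "x = conj_coords k (diag_coords (gz_top_row (hm x)))" by (rule injD[OF inj_hm])
  with k(1) show ?thesis by (rule that)
qed

lemma top_row_conj_diag:
  "g \<in> unitary_group \<Longrightarrow> a \<in> open_chamber \<Longrightarrow> gz_top_row (hm (conj_coords g (diag_coords a))) = a"
  unfolding hm_conj_coords hm_diag_coords by (rule gz_top_row_conj_diagonal)

lemma top_row_conj:
  assumes g: "g \<in> unitary_group" and x: "x \<in> generic"
  shows "gz_top_row (hm (conj_coords g x)) = gz_top_row (hm x)"
proof -
  obtain k where k: "k \<in> unitary_group" "x = conj_coords k (diag_coords (gz_top_row (hm x)))"
    using generic_diagonalization[OF x] .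
  have "conj_coords g x = conj_coords (g ** k) (diag_coords (gz_top_row (hm x)))"
    by (subst k(2)) (simp add: conj_coords_mult)
  then show ?thesis
    using top_row_conj_diag[OF unitary_group_mult[OF g k(1)] generic_top_row[OF x]] by simp
qed

lemma measurable_conj_coords_adjoint:
  "(\<lambda>(g, x). conj_coords (adjoint_matrix g) x) \<in> haar \<Otimes>\<^sub>M (lborel :: 'n::{finite,wellorder} hcoord measure) \<rightarrow>\<^sub>M borel"
proof -
  have "(\<lambda>p. (fst p, snd p)) \<in> haar \<Otimes>\<^sub>M (lborel :: 'n hcoord measure) \<rightarrow>\<^sub>M borel \<Otimes>\<^sub>M borel"
    by (intro measurable_Pair measurable_compose[OF measurable_fst measurable_haar_borel]
        measurable_compose[OF measurable_snd]) simp
  moreover have "(\<lambda>p :: 'n cmat \<times> 'n hcoord. conj_coords (adjoint_matrix (fst p)) (snd p)) \<in> borel \<Otimes>\<^sub>M borel \<rightarrow>\<^sub>M borel"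
    unfolding borel_prod
    by (intro borel_measurable_continuous_onI
        continuous_on_compose2[OF continuous_conj_coords[of UNIV], where f = "\<lambda>p. (adjoint_matrix (fst p), snd p)", simplified]
        continuous_on_Pair continuous_adjoint_matrix continuous_intros)
  ultimately show ?thesis
    unfolding case_prod_beta by (auto intro: measurable_compose)
qed

lemma generic_spectrum_set:
  assumes S: "S \<in> sets borel"
  shows "{x \<in> generic. gz_top_row (hm x) \<in> S} \<in> sets (borel :: ('n::{finite,wellorder} hcoord) measure)"
proof -
  have "(\<lambda>x :: 'n hcoord. gz_top_row (hm x)) -` S \<inter> space (restrict_space borel generic) \<in> sets (restrict_space borel generic)"
    by (rule measurable_sets[OF measurable_gz_top_row S])
  moreover have "(\<lambda>x :: 'n hcoord. gz_top_row (hm x)) -` S \<inter> space (restrict_space borel generic) = {x \<in> generic. gz_top_row (hm x) \<in> S}"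
    by (auto simp: space_restrict_space)
  ultimately show ?thesis by (auto simp: sets_restrict_space_iff)
qed

text \<open>
  The measure of \<open>{(g, x). x generic with spectrum in S, g\<^sup>* x g \<in> N}\<close> computed in both orders.
\<close>

lemma haar_averaging:
  fixes N :: "('n::{finite,wellorder} hcoord) set"
  assumes N: "open N" and b: "b \<in> open_chamber"
    and inv: "\<And>a h. a \<in> open_chamber \<Longrightarrow> h \<in> unitary_group \<Longrightarrow>
      conj_coords h (diag_coords a) \<in> N \<longleftrightarrow> conj_coords h (diag_coords b) \<in> N"
    and S: "S \<in> sets borel"
    and M: "{x \<in> N. gz_top_row (hm x) \<in> S} \<in> sets borel"
  shows "emeasure haar (unitary_group :: 'n cmat set) * emeasure lborel {x \<in> N. gz_top_row (hm x) \<in> S} =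
    emeasure haar {h \<in> unitary_group. conj_coords (adjoint_matrix h) (diag_coords b) \<in> N} *
      emeasure lborel {x \<in> generic. gz_top_row (hm x) \<in> S}"
proof -
  let ?A = "{x \<in> generic. gz_top_row (hm x) \<in> S}" and ?M = "{x \<in> N. gz_top_row (hm x) \<in> S}"
  let ?c = "\<lambda>g. conj_coords (adjoint_matrix g)"
  let ?W = "{h \<in> unitary_group. ?c h (diag_coords b) \<in> N}"
  define Q where "Q = {p. fst p \<in> unitary_group \<and> snd p \<in> ?A \<and> ?c (fst p) (snd p) \<in> N}"
  have A: "?A \<in> sets borel" by (rule generic_spectrum_set[OF S])
  have Nb: "N \<in> sets borel" using N by simp
  have "(\<lambda>(g, x). ?c g x) -` N \<inter> space (haar \<Otimes>\<^sub>M lborel) \<inter> (space haar \<times> ?A) \<in> sets (haar \<Otimes>\<^sub>M (lborel :: 'n hcoord measure))"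
    by (rule sets.Int[OF measurable_sets[OF measurable_conj_coords_adjoint Nb] pair_measureI[OF sets.top]]) (use A in simp)
  also have "(\<lambda>(g, x). ?c g x) -` N \<inter> space (haar \<Otimes>\<^sub>M lborel) \<inter> (space haar \<times> ?A) = Q"
    by (auto simp: Q_def space_pair_measure)
  finally have Q: "Q \<in> sets (haar \<Otimes>\<^sub>M (lborel :: 'n hcoord measure))" .
  have "emeasure (haar \<Otimes>\<^sub>M lborel) Q = (\<integral>\<^sup>+g. emeasure lborel (Pair g -` Q) \<partial>haar)"
    by (rule lborel.emeasure_pair_measure_alt[OF Q])
  also have "\<dots> = (\<integral>\<^sup>+g. emeasure lborel ?M \<partial>(haar :: 'n cmat measure))"
  proof (rule nn_integral_cong)
    fix g :: "'n cmat" assume "g \<in> space haar"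
    then have g: "g \<in> unitary_group" by simp
    \<comment> \<open>Invariance of the spectrum under conjugation is available for generic points,
      so the two sets are compared up to the null set of non-generic ones.\<close>
    have iff: "x \<in> Pair g -` Q \<longleftrightarrow> x \<in> conj_coords g ` ?M" if x: "x \<in> generic" for x
    proof
      assume "x \<in> Pair g -` Q"
      then have "?c g x \<in> ?M"
        using top_row_conj[OF unitary_group_adjoint[OF g] x] by (simp add: Q_def)
      then have "conj_coords g (?c g x) \<in> conj_coords g ` ?M" by (rule imageI)
      then show "x \<in> conj_coords g ` ?M" using g by simp
    next
      assume "x \<in> conj_coords g ` ?M"
      then obtain m where "m \<in> ?M" "x = conj_coords g m" by blast
      then have "?c g x \<in> ?M" using g by simp
      then show "x \<in> Pair g -` Q"
        using top_row_conj[OF unitary_group_adjoint[OF g] x] x g by (simp add: Q_def)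
    qed
    have "AE x in lborel. x \<in> Pair g -` Q \<longleftrightarrow> x \<in> conj_coords g ` ?M"
      using AE_generic by eventually_elim (rule iff)
    then have "emeasure lborel (Pair g -` Q) = emeasure lborel (conj_coords g ` ?M)"
    proof (rule emeasure_eq_AE)
      show "Pair g -` Q \<in> sets lborel" by (rule sets_Pair1[OF Q])
      have "inj_on (conj_coords g) X" for X
        by (rule inj_on_subset[OF orthogonal_transformation_inj[OF orthogonal_conj_coords[OF g]]]) simp
      then show "conj_coords g ` ?M \<in> sets lborel"
        using borel_image_of_open_injection[OF open_UNIV linear_continuous_on[OF linear_conv_bounded_linear[THEN iffD1, OF linear_conj_coords]] _ M, of g]
        by simp
    qed
    then show "emeasure lborel (Pair g -` Q) = emeasure lborel ?M"
      using emeasure_conj_coords_image[OF g M] by simp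
  qed
  also have "\<dots> = emeasure haar (unitary_group :: 'n cmat set) * emeasure lborel ?M"
    by (simp add: mult.commute)
  finally have 1: "emeasure (haar \<Otimes>\<^sub>M lborel) Q = emeasure haar (unitary_group :: 'n cmat set) * emeasure lborel ?M" .
  have Wsets: "?W \<in> sets haar"
  proof -
    have "(\<lambda>g. (g, diag_coords b)) \<in> haar \<rightarrow>\<^sub>M haar \<Otimes>\<^sub>M lborel"
      by (rule measurable_Pair2') simp
    from measurable_compose[OF this measurable_conj_coords_adjoint]
    have "(\<lambda>g. ?c g (diag_coords b)) \<in> haar \<rightarrow>\<^sub>M borel"
      by (simp only: prod.case)
    from measurable_sets[OF this Nb] show ?thesis
      by (simp add: vimage_def Int_def conj_commute)
  qed
  have "emeasure (haar \<Otimes>\<^sub>M lborel) Q = (\<integral>\<^sup>+x. emeasure haar ((\<lambda>g. (g, x)) -` Q) \<partial>lborel)"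
    by (rule haar_lborel.emeasure_pair_measure_alt2[OF Q])
  also have "\<dots> = (\<integral>\<^sup>+x. emeasure haar ?W * indicator ?A x \<partial>lborel)"
  proof (rule nn_integral_cong)
    fix x :: "'n hcoord"
    show "emeasure haar ((\<lambda>g. (g, x)) -` Q) = emeasure haar ?W * indicator ?A x"
    proof (cases "x \<in> ?A")
      case True
      then have x: "x \<in> generic" by simp
      obtain k where k: "k \<in> unitary_group" "x = conj_coords k (diag_coords (gz_top_row (hm x)))"
        using generic_diagonalization[OF x] .
      have ak: "adjoint_matrix k \<in> unitary_group" by (rule unitary_group_adjoint[OF k(1)])
      \<comment> \<open>Undoing the conjugation by \<open>g\<close> leaves the diagonal matrix of
        the spectrum conjugated by \<open>adjoint_matrix g ** k\<close>. By \<open>inv\<close> the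
        spectrum may be replaced by \<open>b\<close>, so the admissible \<open>g\<close> form a left
        translate of \<open>?W\<close> and have the same Haar measure for every
        \<open>x\<close>.\<close>
      have "?c g x \<in> N \<longleftrightarrow> adjoint_matrix k ** g \<in> ?W" if g: "g \<in> unitary_group" for g
      proof -
        have "?c g x = conj_coords (adjoint_matrix g ** k) (diag_coords (gz_top_row (hm x)))"
          by (subst k(2)) (simp add: conj_coords_mult)
        then have "?c g x \<in> N \<longleftrightarrow> conj_coords (adjoint_matrix g ** k) (diag_coords b) \<in> N"
          using inv[OF generic_top_row[OF x] unitary_group_mult[OF unitary_group_adjoint[OF g] k(1)]] by simp
        then show ?thesis using unitary_group_mult[OF ak g] by (simp add: adjoint_matrix_mult)
      qed
      then have "(\<lambda>g. (g, x)) -` Q = (\<lambda>g. adjoint_matrix k ** g) -` ?W \<inter> space haar"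
        using True unitary_group_mult[OF ak] by (auto simp: Q_def)
      then have "emeasure haar ((\<lambda>g. (g, x)) -` Q) = emeasure (distr haar haar (\<lambda>g. adjoint_matrix k ** g)) ?W"
        by (simp add: emeasure_distr[OF measurable_left_mult_haar[OF ak] Wsets])
      then show ?thesis using True by (simp add: haar_left_invariant[OF ak])
    next
      case False
      then have "(\<lambda>g. (g, x)) -` Q = {}" by (auto simp: Q_def)
      then show ?thesis using False by simp
    qed
  qed
  also have "\<dots> = emeasure haar ?W * emeasure lborel ?A"
    using A by (simp add: nn_integral_cmult_indicator)
  finally show ?thesis using 1 by simp
qed

lemma open_chamber_nonempty: "\<exists>a. a \<in> (open_chamber :: ('n::{finite,wellorder} rvec) set)"
  by (rule exI[of _ "\<chi> i. - real (rank_of i)"]) (simp add: open_chamber_def rank_of_less_iff)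

lemma emeasure_lborel_open_pos:
  fixes U :: "'a::euclidean_space set"
  assumes "open U" "U \<noteq> {}" shows "emeasure lborel U > 0"
proof -
  obtain x e where "e > 0" "ball x e \<subseteq> U" using assms by (metis ex_in_conv openE)
  moreover have "emeasure lborel (ball x e) > 0"
    using \<open>e > 0\<close> by (simp add: emeasure_ball ennreal_zero_less_mult_iff unit_ball_vol_pos)
  ultimately show ?thesis
    using assms(1) by (metis borel_open emeasure_mono order_less_le_trans sets_lborel)
qed

text \<open>Two proportionalities are combined. In polar coordinates the part of \<open>N\<close>
  with spectrum in \<open>S\<close> has measure proportional to the integral of the squared
  Vandermonde product (\<open>order1\<close>); averaging over the group makes it proportional to the
  wanted measure (\<open>order2\<close>). The constant is H d / (c \<open>\<kappa>\<close>), and the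
  remaining work is to show these four numbers positive and finite.\<close>

theorem spectral_measure_of_lebesgue:
  obtains C :: real where "C > 0"
    "\<And>S. S \<in> sets borel \<Longrightarrow> S \<subseteq> open_chamber \<Longrightarrow>
      emeasure lborel {x :: 'n::{finite,wellorder} hcoord. x \<in> generic \<and> gz_top_row (hm x) \<in> S} =
        ennreal C * (\<integral>\<^sup>+a\<in>S. ennreal ((vandermonde a)\<^sup>2) \<partial>lborel)"
proof -
  obtain b :: "'n rvec" where b: "b \<in> open_chamber" using open_chamber_nonempty by blast
  obtain r where r: "r > 0" "inj_on polar_map (polar_slice r (open_chamber :: 'n rvec set))"
    using polar_map_inj_on[OF b] unfolding polar_slice_def by blast
  define N :: "'n hcoord set" where "N = polar_map ` polar_slice r open_chamber"
  have N: "open N" unfolding N_def by (rule emeasure_polar_image(3)[OF r(2) sets.empty_sets]) simp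
  \<comment> \<open>\<open>N\<close> consists of whole families: the off-diagonal coordinates
    describe the eigenbasis, so exchanging the diagonal part for another regular spectrum stays
    inside \<open>N\<close>.\<close>
  have inv: "conj_coords h (diag_coords a') \<in> N"
    if a: "a \<in> open_chamber" "a' \<in> open_chamber" and h: "h \<in> unitary_group" and m: "conj_coords h (diag_coords a) \<in> N" for a a' h
  proof -
    obtain y where y: "diag_part y \<in> open_chamber" "norm (offdiag_part y) < r" "conj_coords h (diag_coords a) = polar_map y"
      using m by (auto simp: N_def polar_slice_def)
    have "a = diag_part y"
      using top_row_conj_diag[OF h a(1)] top_row_polar_map[OF y(1)] y(3) by simp
    then have "conj_coords h (diag_coords a) = conj_coords (cayley (offdiag_part y)) (diag_coords a)"
      using y(3) by (simp add: polar_map_def)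
    from conj_diagonal_eq_transfer[OF h cayley_unitary a(1) this]
    have "conj_coords h (diag_coords a') = polar_map (diag_coords a' + offdiag_part y)"
      by (simp add: polar_map_def)
    moreover have "diag_coords a' + offdiag_part y \<in> polar_slice r open_chamber"
      using y(2) a(2) by (simp add: polar_slice_def)
    ultimately show ?thesis by (auto simp: N_def)
  qed
  let ?\<nu> = "\<lambda>S. emeasure lborel {x :: 'n hcoord. x \<in> generic \<and> gz_top_row (hm x) \<in> S}"
  let ?I = "\<lambda>S :: 'n rvec set. \<integral>\<^sup>+a\<in>S. ennreal ((vandermonde a)\<^sup>2) \<partial>lborel"
  define H where "H = emeasure haar (unitary_group :: 'n cmat set)"
  define c where "c = emeasure haar {h \<in> unitary_group. conj_coords (adjoint_matrix h) (diag_coords b) \<in> N}"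
  define \<kappa> where "\<kappa> = (\<integral>\<^sup>+a. indicator (ball 0 1) a \<partial>(lborel :: 'n rvec measure))"
  define d where "d = (\<integral>\<^sup>+y. indicator (ball 0 1) (diag_part y) *
    (ennreal (polar_density (offdiag_part y)) * indicator (ball 0 r) (offdiag_part y)) \<partial>(lborel :: 'n hcoord measure))"
  have Neq: "{x \<in> N. gz_top_row (hm x) \<in> S} = polar_map ` polar_slice r S" if "S \<subseteq> open_chamber" for S
    using that by (auto simp: N_def polar_slice_def top_row_polar_map)
  have [measurable]: "ball (0 :: 'n hcoord) r \<in> sets borel" by simp
  have [measurable]: "polar_density \<in> borel_measurable (borel :: 'n hcoord measure)"
    by (intro borel_measurable_continuous_onI continuous_polar_density)
  have order1: "\<kappa> * emeasure lborel {x \<in> N. gz_top_row (hm x) \<in> S} = ?I S * d"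
    if S [measurable]: "S \<in> sets borel" and sub: "S \<subseteq> open_chamber" for S
    unfolding Neq[OF sub] emeasure_polar_image(2)[OF r(2) S sub] \<kappa>_def d_def
    by (rule nn_integral_diag_offdiag) measurable
  have order2: "H * emeasure lborel {x \<in> N. gz_top_row (hm x) \<in> S} = c * ?\<nu> S"
    if S: "S \<in> sets borel" and sub: "S \<subseteq> open_chamber" for S
    unfolding H_def c_def
  proof (rule haar_averaging[OF N b _ S])
    show "conj_coords h (diag_coords a) \<in> N \<longleftrightarrow> conj_coords h (diag_coords b) \<in> N"
      if "a \<in> open_chamber" "h \<in> unitary_group" for a h
      using inv[OF that(1) b that(2)] inv[OF b that] by blast
    show "{x \<in> N. gz_top_row (hm x) \<in> S} \<in> sets borel"
      unfolding Neq[OF sub] by (rule emeasure_polar_image(1)[OF r(2) S sub])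
  qed
  have main: "c * \<kappa> * ?\<nu> S = H * d * ?I S" if S: "S \<in> sets borel" and sub: "S \<subseteq> open_chamber" for S
  proof -
    have "c * \<kappa> * ?\<nu> S = \<kappa> * (c * ?\<nu> S)" by (simp only: mult_ac)
    also have "\<dots> = H * (\<kappa> * emeasure lborel {x \<in> N. gz_top_row (hm x) \<in> S})"
      unfolding order2[OF that, symmetric] by (simp only: mult_ac)
    also have "\<dots> = H * d * ?I S" unfolding order1[OF that] by (simp only: mult_ac)
    finally show ?thesis .
  qed
  have H: "0 < H" "H < \<infinity>" using haar_pos haar_finite by (auto simp: H_def)
  have \<kappa>: "0 < \<kappa>" "\<kappa> < \<infinity>"
    by (simp_all add: \<kappa>_def emeasure_ball ennreal_zero_less_mult_iff unit_ball_vol_pos ennreal_mult_less_top)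
  have c_fin: "c < \<infinity>"
  proof -
    have "c \<le> H" unfolding c_def H_def
      using emeasure_space[of haar] by simp
    with H(2) show ?thesis by simp
  qed
  have chamber: "open_chamber \<in> sets (borel :: 'n rvec measure)" by (rule borel_open[OF open_open_chamber])
  \<comment> \<open>This part of \<open>N\<close> is all of \<open>N\<close>, a nonempty open set.
    If \<open>c\<close> or \<open>d\<close> vanished, one of the two proportionalities would give it
    measure zero.\<close>
  have Npos: "emeasure lborel {x \<in> N. gz_top_row (hm x) \<in> open_chamber} > 0"
  proof -
    have "{x \<in> N. gz_top_row (hm x) \<in> open_chamber} = N" unfolding Neq[OF order_refl] by (simp only: N_def)
    moreover have "diag_coords b \<in> polar_slice r open_chamber" using b r(1) by (simp add: polar_slice_def)
    then have "N \<noteq> {}" by (auto simp: N_def)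
    ultimately show ?thesis using emeasure_lborel_open_pos[OF N] by simp
  qed
  have c_pos: "c > 0"
  proof (rule ccontr)
    assume "\<not> c > 0"
    then have "H * emeasure lborel {x \<in> N. gz_top_row (hm x) \<in> open_chamber} = 0"
      using order2[OF chamber order_refl] by simp
    with H(1) Npos show False by (simp add: zero_less_iff_neq_zero)
  qed
  have d_pos: "d > 0"
  proof (rule ccontr)
    assume "\<not> d > 0"
    then have "\<kappa> * emeasure lborel {x \<in> N. gz_top_row (hm x) \<in> open_chamber} = 0"
      using order1[OF chamber order_refl] by simp
    with \<kappa>(1) Npos show False by (simp add: zero_less_iff_neq_zero)
  qed
  have d_fin: "d < \<infinity>"
  proof -
    have "compact (polar_density ` cball (0 :: 'n hcoord) r)"
      by (intro compact_continuous_image continuous_polar_density) simp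
    from compact_imp_bounded[OF this]
    obtain B where "\<forall>w\<in>cball (0 :: 'n hcoord) r. \<bar>polar_density w\<bar> \<le> B" by (auto simp: bounded_iff)
    then have B: "norm w \<le> r \<Longrightarrow> \<bar>polar_density w\<bar> \<le> B" for w :: "'n hcoord" by simp
    obtain L where L: "\<And>a :: 'n rvec. norm (diag_coords a) \<le> norm a * L" "L > 0"
      using bounded_linear.pos_bounded[OF bounded_linear_parts_hcoord(3)] by blast
    \<comment> \<open>On the support of the integrand the norm of \<open>y\<close> is below
      \<open>L + r\<close>, where \<open>L\<close> bounds the norm of \<open>diag_coords\<close>; on
      the ball of radius \<open>r\<close> the density is at most \<open>B\<close>.\<close>
    have "d \<le> (\<integral>\<^sup>+y. ennreal B * indicator (ball 0 (L + r)) y \<partial>(lborel :: 'n hcoord measure))"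
      unfolding d_def
    proof (rule nn_integral_mono)
      fix y :: "'n hcoord"
      show "indicator (ball 0 1) (diag_part y) * (ennreal (polar_density (offdiag_part y)) * indicator (ball 0 r) (offdiag_part y))
          \<le> ennreal B * indicator (ball 0 (L + r)) y"
      proof (cases "norm (diag_part y) < 1 \<and> norm (offdiag_part y) < r")
        case True
        have "norm (diag_coords (diag_part y)) \<le> norm (diag_part y) * L" by (rule L)
        also have "\<dots> \<le> L" using True L(2) by simp
        finally have "norm (diag_coords (diag_part y) + offdiag_part y) < L + r"
          using True norm_triangle_ineq[of "diag_coords (diag_part y)" "offdiag_part y"] by linarith
        then have "norm y < L + r" by (simp only: diag_offdiag)
        then show ?thesis using True B[of "offdiag_part y"] by (auto intro!: ennreal_leI)
      qed auto
    qed
    also have "\<dots> = ennreal B * emeasure lborel (ball (0 :: 'n hcoord) (L + r))"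
      by (rule nn_integral_cmult_indicator) simp
    also have "\<dots> < \<infinity>" using emeasure_bounded_finite[of "ball (0 :: 'n hcoord) (L + r)"]
      by (simp add: ennreal_mult_less_top)
    finally show ?thesis .
  qed
  define p q where "p = enn2real (c * \<kappa>)" and "q = enn2real (H * d)"
  have p: "p > 0" "c * \<kappa> = ennreal p"
    using c_pos c_fin \<kappa> by (auto simp: p_def enn2real_positive_iff ennreal_zero_less_mult_iff ennreal_mult_less_top)
  have q: "q > 0" "H * d = ennreal q"
    using d_pos d_fin H by (auto simp: q_def enn2real_positive_iff ennreal_zero_less_mult_iff ennreal_mult_less_top)
  show ?thesis
  proof (rule that)
    show "q / p > 0" using p q by simp
    fix S :: "'n rvec set" assume S: "S \<in> sets borel" "S \<subseteq> open_chamber"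
    have "?\<nu> S = ennreal (1 / p) * (ennreal p * ?\<nu> S)"
      using p(1) by (simp add: mult.assoc[symmetric] ennreal_mult'[symmetric])
    also have "\<dots> = ennreal (1 / p) * (ennreal q * ?I S)"
      using main[OF S] by (simp add: p q)
    also have "\<dots> = ennreal (q / p) * ?I S"
      using p(1) q(1) by (simp add: mult.assoc[symmetric] ennreal_mult'[symmetric])
    finally show "?\<nu> S = ennreal (q / p) * ?I S" .
  qed
qed

section \<open>The double Gelfand--Zeitlin map\<close>

text \<open>The recorded spectrum is that of the negated fibre coordinate; this lemma removes the
  sign.\<close>

lemma emeasure_lborel_uminus:
  fixes A :: "'a::euclidean_space set"
  assumes A: "A \<in> sets borel"
  shows "emeasure lborel {x. - x \<in> A} = emeasure lborel A"
proof -
  have "(lborel :: 'a measure) = distr lborel borel uminus"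
    using lborel_affine[of "-1" "0 :: 'a"] by (simp add: density_1)
  then have "emeasure lborel A = emeasure (distr lborel borel uminus) A" by simp
  also have "\<dots> = emeasure lborel {x. - x \<in> A}"
    using A by (subst emeasure_distr) (simp_all add: vimage_def)
  finally show ?thesis ..
qed

text \<open>Conjugation preserves Lebesgue measure, so the preimage of the null set of non-generic
  points is null. This disposes of the regularity condition on the left moment.\<close>

lemma AE_conj_coords_generic:
  assumes g: "g \<in> unitary_group"
  shows "AE x in lborel. conj_coords g x \<in> generic"
proof -
  let ?N = "- (generic :: 'a hcoord set)" and ?h = "adjoint_matrix g"
  have h: "?h \<in> unitary_group" by (rule unitary_group_adjoint[OF g])
  have N: "?N \<in> sets borel" using borel_generic by simp
  have "AE x in lborel. x \<notin> ?N" using AE_generic by simp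
  then have "emeasure lborel ?N = 0"
    using N by (subst (asm) AE_iff_measurable[of ?N]) auto
  then have z: "emeasure lborel (conj_coords ?h ` ?N) = 0"
    using emeasure_conj_coords_image[OF h N] by simp
  have m: "conj_coords ?h ` ?N \<in> sets borel"
    by (rule borel_image_of_open_injection[OF open_UNIV linear_continuous_on[OF linear_conv_bounded_linear[THEN iffD1, OF linear_conj_coords]]
        orthogonal_transformation_inj[OF orthogonal_conj_coords[OF h]] N]) simp
  have "AE x in lborel. x \<notin> conj_coords ?h ` ?N"
    using z m by (intro AE_not_in null_setsI) simp_all
  then show ?thesis
  proof eventually_elim
    case (elim x)
    then show ?case
      using conj_coords_inverse(1)[OF g, of x] by (metis ComplI imageI)
  qed
qed

abbreviation hermitian_pair :: "'n::{finite,wellorder} cmat \<times> 'n hcoord \<Rightarrow> 'n cmat \<times> 'n cmat" where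
  "hermitian_pair \<equiv> (\<lambda>(g, x). (g, hm x))"

lemma cotangent_unitary_hermitian_pair:
  "p \<in> cotangent_unitary \<Longrightarrow> p = (fst p, hm (hermitian_coords (snd p)))"
  by (cases p) (simp add: cotangent_unitary_def hm_hermitian_coords)

lemma left_moment_hermitian_pair:
  assumes g: "g \<in> unitary_group" shows "left_moment (g, hm x) = hm (conj_coords g x)"
proof -
  have "matrix_inv g = adjoint_matrix g"
    using unitary_groupD[OF g] by (intro matrix_inv_eqI) simp_all
  then show ?thesis by (simp add: left_moment_def hm_conj_coords)
qed

lemma right_moment_hermitian_pair: "right_moment (g, hm x) = hm (- x)"
  by (simp add: right_moment_def hm_neg)

lemma hermitian_pair_locus_iff:
  assumes g: "g \<in> unitary_group"
  shows "(g, hm x) \<in> strongly_regular_locus \<longleftrightarrow> conj_coords g x \<in> generic \<and> - x \<in> generic"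
  using g by (simp add: strongly_regular_locus_def left_moment_hermitian_pair right_moment_hermitian_pair
      generic_iff_interlacing cotangent_unitary_def hm_hermitian)

lemma proj_top_double_gz: "(proj_top \<circ> double_gz) (g, hm x) = gz_top_row (hm (- x))"
  by (simp add: proj_top_def double_gz_def right_moment_hermitian_pair)

lemma locus_sets:
  "(strongly_regular_locus :: ('n::{finite,wellorder} cmat \<times> 'n cmat) set) \<in> sets (restrict_space borel cotangent_unitary)"
proof -
  let ?l = "\<lambda>p :: 'n cmat \<times> 'n cmat. conj_coords (fst p) (hermitian_coords (snd p))"
  let ?r = "\<lambda>p :: 'n cmat \<times> 'n cmat. - hermitian_coords (snd p)"
  have l: "?l \<in> borel \<rightarrow>\<^sub>M borel"
    by (intro borel_measurable_continuous_onI
        continuous_on_compose2[OF continuous_conj_coords[of UNIV], where f = "\<lambda>p. (fst p, hermitian_coords (snd p))", simplified]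
        continuous_on_Pair bounded_linear.continuous_on[OF bounded_linear_hermitian_coords] continuous_intros)
  have r: "?r \<in> borel \<rightarrow>\<^sub>M borel"
    by (intro borel_measurable_continuous_onI bounded_linear.continuous_on[OF bounded_linear_hermitian_coords] continuous_intros)
  have "strongly_regular_locus = cotangent_unitary \<inter> (?l -` generic \<inter> ?r -` generic)"
  proof (intro equalityI subsetI)
    fix p :: "'n cmat \<times> 'n cmat" assume p: "p \<in> strongly_regular_locus"
    then have c: "p \<in> cotangent_unitary" by (simp add: strongly_regular_locus_def)
    then have "fst p \<in> unitary_group" by (simp add: cotangent_unitary_def mem_Times_iff)
    then show "p \<in> cotangent_unitary \<inter> (?l -` generic \<inter> ?r -` generic)"
      using p c hermitian_pair_locus_iff[of "fst p" "hermitian_coords (snd p)"]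
      unfolding cotangent_unitary_hermitian_pair[OF c, symmetric] by simp
  next
    fix p :: "'n cmat \<times> 'n cmat" assume p: "p \<in> cotangent_unitary \<inter> (?l -` generic \<inter> ?r -` generic)"
    then have c: "p \<in> cotangent_unitary" by simp
    then have "fst p \<in> unitary_group" by (simp add: cotangent_unitary_def mem_Times_iff)
    then show "p \<in> strongly_regular_locus"
      using p hermitian_pair_locus_iff[of "fst p" "hermitian_coords (snd p)"]
      unfolding cotangent_unitary_hermitian_pair[OF c, symmetric] by simp
  qed
  moreover have "?l -` generic \<inter> ?r -` generic \<in> sets borel"
    using measurable_sets[OF l borel_generic] measurable_sets[OF r borel_generic] by (intro sets.Int) simp_all
  ultimately show ?thesis by (auto simp: sets_restrict_space)
qed

text \<open>On the locus the map depends on the fibre alone: it is the spectrum of the negated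
  Hermitian matrix, which is Borel on generic points.\<close>

lemma measurable_proj_top_double_gz:
  "proj_top \<circ> double_gz \<in> restrict_space liouville_measure (strongly_regular_locus :: ('n::{finite,wellorder} cmat \<times> 'n cmat) set)
     \<rightarrow>\<^sub>M restrict_space borel open_chamber"
proof -
  let ?L = "restrict_space borel (strongly_regular_locus :: ('n cmat \<times> 'n cmat) set)"
  have sets: "sets (restrict_space liouville_measure (strongly_regular_locus :: ('n cmat \<times> 'n cmat) set)) = sets ?L"
  proof -
    have "sets (restrict_space liouville_measure (strongly_regular_locus :: ('n cmat \<times> 'n cmat) set)) =
        sets (restrict_space (restrict_space borel cotangent_unitary) strongly_regular_locus)"
      by (rule sets_restrict_space_cong) (simp add: liouville_measure_eq)
    also have "\<dots> = sets (restrict_space borel (cotangent_unitary \<inter> (strongly_regular_locus :: ('n cmat \<times> 'n cmat) set)))"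
      by (rule sets_restrict_restrict_space)
    also have "cotangent_unitary \<inter> strongly_regular_locus = (strongly_regular_locus :: ('n cmat \<times> 'n cmat) set)"
      by (auto simp: strongly_regular_locus_def)
    finally show ?thesis .
  qed
  have p: "\<exists>g x. p = (g, hm x) \<and> g \<in> unitary_group \<and> x = hermitian_coords (snd p) \<and> - x \<in> generic"
    if p: "p \<in> strongly_regular_locus" for p :: "'n cmat \<times> 'n cmat"
  proof -
    have c: "p \<in> cotangent_unitary" using p by (simp add: strongly_regular_locus_def)
    then have g: "fst p \<in> unitary_group" by (simp add: cotangent_unitary_def mem_Times_iff)
    have e: "p = (fst p, hm (hermitian_coords (snd p)))" by (rule cotangent_unitary_hermitian_pair[OF c])
    have "(fst p, hm (hermitian_coords (snd p))) \<in> strongly_regular_locus" using p e by simp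
    then have "- hermitian_coords (snd p) \<in> generic" using hermitian_pair_locus_iff[OF g] by blast
    with e g show ?thesis by blast
  qed
  have "(\<lambda>p. - hermitian_coords (snd p)) \<in> ?L \<rightarrow>\<^sub>M restrict_space borel generic"
  proof (rule measurable_restrict_space2)
    show "(\<lambda>p. - hermitian_coords (snd p)) \<in> space ?L \<rightarrow> generic"
      using p by (auto simp: space_restrict_space)
    have "(\<lambda>p :: 'n cmat \<times> 'n cmat. - hermitian_coords (snd p)) \<in> borel \<rightarrow>\<^sub>M borel"
      by (intro borel_measurable_continuous_onI bounded_linear.continuous_on[OF bounded_linear_hermitian_coords] continuous_intros)
    then show "(\<lambda>p. - hermitian_coords (snd p)) \<in> ?L \<rightarrow>\<^sub>M borel" by (rule measurable_restrict_space1)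
  qed
  from measurable_compose[OF this measurable_gz_top_row]
  have m: "(\<lambda>p. gz_top_row (hm (- hermitian_coords (snd p)))) \<in> ?L \<rightarrow>\<^sub>M borel" .
  have e: "(proj_top \<circ> double_gz) p = gz_top_row (hm (- hermitian_coords (snd p)))" if "p \<in> space ?L" for p
  proof -
    have "p \<in> strongly_regular_locus" using that by (simp add: space_restrict_space)
    from p[OF this] obtain g x where e: "p = (g, hm x)" by blast
    show ?thesis unfolding e proj_top_double_gz by simp
  qed
  have "proj_top \<circ> double_gz \<in> ?L \<rightarrow>\<^sub>M borel"
    by (rule measurable_cong[THEN iffD2, OF e m])
  then have "proj_top \<circ> double_gz \<in> ?L \<rightarrow>\<^sub>M restrict_space borel open_chamber"
  proof (rule measurable_restrict_space2[rotated])
    show "proj_top \<circ> double_gz \<in> space ?L \<rightarrow> open_chamber"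
    proof
      fix q assume "q \<in> space ?L"
      then have "q \<in> strongly_regular_locus" by (simp add: space_restrict_space)
      from p[OF this] obtain g x where q: "q = (g, hm x)" "- x \<in> generic" by blast
      show "(proj_top \<circ> double_gz) q \<in> open_chamber"
        unfolding q(1) proj_top_double_gz by (rule generic_top_row[OF q(2)])
    qed
  qed
  then show ?thesis by (simp cong: measurable_cong_sets[OF sets refl])
qed

theorem proposition3p11:
  shows "\<exists>C::real. C > 0 \<and>
    distr (restrict_space liouville_measure strongly_regular_locus)
          (restrict_space borel (open_chamber :: (real^'n::{finite,wellorder}) set))
          (proj_top \<circ> double_gz)
      = density (restrict_space lborel open_chamber) (\<lambda>a. ennreal (C * (vandermonde a)\<^sup>2))"
proof -
  let ?T = "proj_top \<circ> (double_gz :: 'n cmat \<times> 'n cmat \<Rightarrow> _)"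
  let ?L = "strongly_regular_locus :: ('n cmat \<times> 'n cmat) set"
  define \<kappa> where "\<kappa> = liouville_constant TYPE('n \<times> 'n)"
  have \<kappa>: "\<kappa> > 0" by (simp add: \<kappa>_def liouville_constant_pos)
  obtain c :: real where c: "c > 0" "\<And>S. S \<in> sets borel \<Longrightarrow> S \<subseteq> open_chamber \<Longrightarrow>
      emeasure lborel {x :: 'n hcoord. x \<in> generic \<and> gz_top_row (hm x) \<in> S} =
        ennreal c * (\<integral>\<^sup>+a\<in>S. ennreal ((vandermonde a)\<^sup>2) \<partial>lborel)"
    by (rule spectral_measure_of_lebesgue[where 'n='n]) blast
  define H where "H = measure haar (unitary_group :: 'n cmat set)"
  have H: "H > 0" "emeasure haar (unitary_group :: 'n cmat set) = ennreal H"
    using haar_pos[where 'a='n] by (simp_all add: H_def haar.emeasure_eq_measure)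
  \<comment> \<open>The Liouville constant, the total Haar mass and the constant of the spectral
    density.\<close>
  let ?C = "\<kappa> * (H * c)"
  have chamber: "open_chamber \<in> sets (borel :: 'n rvec measure)" by (rule borel_open[OF open_open_chamber])
  have Lsets: "?L \<in> sets liouville_measure" using locus_sets by (simp add: liouville_measure_eq)
  have "distr (restrict_space liouville_measure ?L) (restrict_space borel open_chamber) ?T
      = density (restrict_space lborel open_chamber) (\<lambda>a. ennreal (?C * (vandermonde a)\<^sup>2))"
  proof (rule measure_eqI)
    show "sets (distr (restrict_space liouville_measure ?L) (restrict_space borel open_chamber) ?T) =
        sets (density (restrict_space lborel open_chamber) (\<lambda>a. ennreal (?C * (vandermonde a)\<^sup>2)))"
      by (simp add: sets_restrict_space)
    fix B assume "B \<in> sets (distr (restrict_space liouville_measure ?L) (restrict_space borel open_chamber) ?T)"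
    then have B0: "B \<in> sets (restrict_space borel (open_chamber :: 'n rvec set))" by simp
    then have B [measurable]: "B \<in> sets borel" "B \<subseteq> open_chamber"
      using chamber by (auto simp: sets_restrict_space_iff)
    let ?A = "{x :: 'n hcoord. x \<in> generic \<and> gz_top_row (hm x) \<in> B}"
    let ?P = "?T -` B \<inter> ?L"
    have A: "?A \<in> sets borel" using generic_spectrum_set[OF B(1)] by simp
    have P: "?P \<in> sets liouville_measure"
      using measurable_sets[OF measurable_proj_top_double_gz B0] Lsets
      by (simp add: space_restrict_space sets_restrict_space_iff Int_absorb2 sets.sets_into_space)
    have Pc: "?P \<in> sets (restrict_space borel cotangent_unitary)" using P by (simp add: liouville_measure_eq)
    let ?Q = "hermitian_pair -` ?P \<inter> space (haar \<Otimes>\<^sub>M (lborel :: 'n hcoord measure))"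
    have Q: "?Q \<in> sets (haar \<Otimes>\<^sub>M (lborel :: 'n hcoord measure))"
      by (rule measurable_sets[OF measurable_Pair_hm Pc])
    have "emeasure (distr (restrict_space liouville_measure ?L) (restrict_space borel open_chamber) ?T) B =
        emeasure (restrict_space liouville_measure ?L) ?P"
      using Lsets by (subst emeasure_distr[OF measurable_proj_top_double_gz B0])
        (simp add: space_restrict_space Int_absorb2 sets.sets_into_space)
    also have "\<dots> = emeasure liouville_measure ?P"
      using Lsets by (intro emeasure_restrict_space) auto
    also have "\<dots> = ennreal \<kappa> * emeasure (haar \<Otimes>\<^sub>M (lborel :: 'n hcoord measure)) ?Q"
      unfolding liouville_measure_eq \<kappa>_def emeasure_scale_measure
      by (subst emeasure_distr[OF measurable_Pair_hm Pc]) simp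
    also have "emeasure (haar \<Otimes>\<^sub>M (lborel :: 'n hcoord measure)) ?Q = (\<integral>\<^sup>+g. emeasure lborel (Pair g -` ?Q) \<partial>haar)"
      by (rule lborel.emeasure_pair_measure_alt[OF Q])
    also have "\<dots> = (\<integral>\<^sup>+g. emeasure lborel ?A \<partial>(haar :: 'n cmat measure))"
    proof (rule nn_integral_cong)
      fix g :: "'n cmat" assume "g \<in> space haar"
      then have g: "g \<in> unitary_group" by simp
      \<comment> \<open>For fixed \<open>g\<close> the first condition holds for almost every
        \<open>x\<close>, and the second involves \<open>- x\<close> only. So the inner measure does
        not depend on \<open>g\<close>, and the outer integral contributes the total Haar
        mass.\<close>
      have sec: "x \<in> Pair g -` ?Q \<longleftrightarrow> conj_coords g x \<in> generic \<and> - x \<in> ?A" for x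
        using g hermitian_pair_locus_iff[OF g, of x] proj_top_double_gz[of g x]
        by (auto simp: space_pair_measure)
      have "AE x in lborel. x \<in> Pair g -` ?Q \<longleftrightarrow> x \<in> {x. - x \<in> ?A}"
        using AE_conj_coords_generic[OF g] by eventually_elim (simp only: sec mem_Collect_eq simp_thms)
      then have "emeasure lborel (Pair g -` ?Q) = emeasure lborel {x. - x \<in> ?A}"
      proof (rule emeasure_eq_AE)
        show "Pair g -` ?Q \<in> sets lborel" by (rule sets_Pair1[OF Q])
        have "uminus -` ?A \<inter> space (borel :: 'n hcoord measure) \<in> sets borel"
          using A by (intro measurable_sets[of uminus borel borel]) simp_all
        then show "{x. - x \<in> ?A} \<in> sets lborel" by (simp add: vimage_def)
      qed
      then show "emeasure lborel (Pair g -` ?Q) = emeasure lborel ?A"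
        unfolding emeasure_lborel_uminus[OF A] .
    qed
    also have "\<dots> = ennreal H * emeasure lborel ?A" by (simp add: H(2)[symmetric] mult.commute)
    also have "emeasure lborel ?A = ennreal c * (\<integral>\<^sup>+a\<in>B. ennreal ((vandermonde a)\<^sup>2) \<partial>lborel)"
      by (rule c(2)[OF B])
    finally have 1: "emeasure (distr (restrict_space liouville_measure ?L) (restrict_space borel open_chamber) ?T) B =
        ennreal \<kappa> * (ennreal H * (ennreal c * (\<integral>\<^sup>+a\<in>B. ennreal ((vandermonde a)\<^sup>2) \<partial>lborel)))" .
    have C: "ennreal ?C = ennreal \<kappa> * (ennreal H * ennreal c)"
      using \<kappa> H(1) c(1) by (simp add: ennreal_mult')
    have "emeasure (density (restrict_space lborel open_chamber) (\<lambda>a. ennreal (?C * (vandermonde a)\<^sup>2))) B =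
        (\<integral>\<^sup>+a\<in>B. ennreal (?C * (vandermonde a)\<^sup>2) \<partial>restrict_space lborel open_chamber)"
    proof (rule emeasure_density)
      show "(\<lambda>a. ennreal (?C * (vandermonde a)\<^sup>2)) \<in> borel_measurable (restrict_space lborel open_chamber)"
        by (rule measurable_restrict_space1) measurable
      show "B \<in> sets (restrict_space lborel open_chamber)"
        using B0 by (simp add: sets_restrict_space)
    qed
    also have "\<dots> = (\<integral>\<^sup>+a. ennreal (?C * (vandermonde a)\<^sup>2) * indicator B a * indicator open_chamber a \<partial>lborel)"
      by (rule nn_integral_restrict_space) (use chamber in simp)
    also have "\<dots> = (\<integral>\<^sup>+a. ennreal ?C * (ennreal ((vandermonde a)\<^sup>2) * indicator B a) \<partial>lborel)"
    proof (rule nn_integral_cong)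
      fix a :: "'n rvec"
      have "ennreal (?C * (vandermonde a)\<^sup>2) = ennreal ?C * ennreal ((vandermonde a)\<^sup>2)"
        by (rule ennreal_mult'') simp
      then show "ennreal (?C * (vandermonde a)\<^sup>2) * indicator B a * indicator open_chamber a =
          ennreal ?C * (ennreal ((vandermonde a)\<^sup>2) * indicator B a)"
        using B(2) by (auto simp: indicator_def)
    qed
    also have "\<dots> = ennreal ?C * (\<integral>\<^sup>+a\<in>B. ennreal ((vandermonde a)\<^sup>2) \<partial>lborel)"
      by (rule nn_integral_cmult) measurable
    finally show "emeasure (distr (restrict_space liouville_measure ?L) (restrict_space borel open_chamber) ?T) B =
        emeasure (density (restrict_space lborel open_chamber) (\<lambda>a. ennreal (?C * (vandermonde a)\<^sup>2))) B"
      unfolding 1 by (simp only: C mult.assoc)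
  qed
  moreover have "?C > 0" using \<kappa> H(1) c(1) by simp
  ultimately show ?thesis by blast
qed

end
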